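(* Fix a sequence $(\lambda_L)_{L\ge 1}$ of numbers in $(0,1)$ with $\sum_{L=1}^\infty \lambda_L<\sum_{L=1}^\infty L\lambda_L<\sum_{L=1}^\infty L^2\lambda_L<\infty$, and for every CAT(0) space $(X,d)$ let $\widehat X=(X,\hat d)$ be its curtain model, defined using this sequence. Then: (1) There exist a CAT(0) space $(X,d)$ and a quasi-isometry $\phi:(X,d)\to (X,d)$ such that $\phi$ does not descend to a quasi-isometry of $\widehat X$; that is, the same map of underlying sets, regarded as a map $\phi:(X,\hat d)\to (X,\hat d)$, is not a quasi-isometry. (2) There exist two CAT(0) spaces $W$ and $Z$ that are quasi-isometric to each other but whose curtain models $\widehat W$ and $\widehat Z$ are not quasi-isometric.
   Context: Let $(X,d)$ be a CAT(0) space. Curtains. Let $\alpha:I\to X$ be a (unit-speed) geodesic, where $I\subset\mathbb R$ is a closed interval (possibly unbounded), and let $\pi_\alpha:X\to\alpha(I)$ be the closest point projection. For a number $r$ such that $[r-\frac12,r+\frac12]$ lies in the interior of $I$, the curtain dual to $\alpha$ at $r$ is $h=h_{\alpha,r}=\pi_\alpha^{-1}(\alpha([r-\frac12,r+\frac12]))$. Its two halfspaces are $h^-=\pi_\alpha^{-1}(\alpha(I\cap(-\infty,r-\frac12)))$ and $h^+=\pi_\alpha^{-1}(\alpha(I\cap(r+\frac12,\infty)))$. A curtain is any set of this form. Separation and chains. A curtain $h$ separates sets $A,B\subset X$ if $A\subset h^-$ and $B\subset h^+$ (up to exchanging the names of the two halfspaces, i.e. reversing $\alpha$); points are treated as singletons.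 A set of curtains $\{h_i\}$ (indexed by consecutive integers) is a chain if the $h_i$ are pairwise disjoint and $h_i$ separates $h_{i-1}$ and $h_{i+1}$ for all $i$ for which these are defined. A chain separates $A$ and $B$ if each of its curtains does. $L$-separation. Let $L\in\mathbb N=\{1,2,\dots\}$. Disjoint curtains $h,h'$ are $L$-separated if every chain all of whose curtains meet both $h$ and $h'$ has cardinality at most $L$. An $L$-chain is a chain of curtains each pair of which is $L$-separated. $L$-metric. For $x\ne y$ in $X$, $d_L(x,y)=1+\max\{|c| : c \text{ is an } L\text{-chain separating } x \text{ from } y\}$, and $d_L(x,x)=0$. (One has $d_L(x,y)<1+d(x,y)$ for all $x \neq y$.) Curtain model. Given the fixed sequence $(\lambda_L)$, set $\hat d(x,y)=\sum_{L=1}^\infty\lambda_L d_L(x,y)$. The curtain model of $X$ is the metric space $\widehat X=(X,\hat d)$; it has the same underlying set as $X$. Quasi-isometry means the usual notion: a map (not necessarily continuous) that is a quasi-isometric embedding with coarsely dense image; two metric spaces are quasi-isometric if there is a quasi-isometry between them. *)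

theory Defs
  imports "HOL-Analysis.Analysis"
begin

text \<open>A metric space is a carrier \<open>X\<close> with a distance function \<open>d\<close>, as in the locale
  \<^locale>\<open>Metric_space\<close> of the library.\<close>

section \<open>CAT(0) spaces\<close>

definition geodesic_on :: "'a set \<Rightarrow> ('a \<Rightarrow> 'a \<Rightarrow> real) \<Rightarrow> real set \<Rightarrow> (real \<Rightarrow> 'a) \<Rightarrow> bool" where
  "geodesic_on X d I \<alpha> \<longleftrightarrow>
     is_interval I \<and> closed I \<and> \<alpha> ` I \<subseteq> X \<and> (\<forall>s\<in>I. \<forall>t\<in>I. d (\<alpha> s) (\<alpha> t) = \<bar>s - t\<bar>)"

definition geodesic_segment ::
    "'a set \<Rightarrow> ('a \<Rightarrow> 'a \<Rightarrow> real) \<Rightarrow> 'a \<Rightarrow> 'a \<Rightarrow> 'a set \<Rightarrow> bool" where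
  "geodesic_segment X d x y S \<longleftrightarrow>
     (\<exists>\<gamma>. geodesic_on X d {0..d x y} \<gamma> \<and> \<gamma> 0 = x \<and> \<gamma> (d x y) = y \<and> S = \<gamma> ` {0..d x y})"

definition comparison_point ::
    "('a \<Rightarrow> 'a \<Rightarrow> real) \<Rightarrow> 'a \<Rightarrow> 'a set \<Rightarrow> real^2 \<Rightarrow> real^2 \<Rightarrow> 'a \<Rightarrow> real^2 \<Rightarrow> bool" where
  "comparison_point d x S x' y' p p' \<longleftrightarrow>
     p \<in> S \<and> p' \<in> closed_segment x' y' \<and> dist x' p' = d x p"

text \<open>Distances in a geodesic triangle, with sides \<open>A\<close>, \<open>B\<close>, \<open>C\<close>, are at most the corresponding
  distances in a Euclidean comparison triangle with vertices \<open>x'\<close>, \<open>y'\<close>, \<open>z'\<close>.\<close>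

definition CAT0 :: "'a set \<Rightarrow> ('a \<Rightarrow> 'a \<Rightarrow> real) \<Rightarrow> bool" where
  "CAT0 X d \<longleftrightarrow>
     Metric_space X d \<and>
     (\<forall>x\<in>X. \<forall>y\<in>X. \<exists>S. geodesic_segment X d x y S) \<and>
     (\<forall>x\<in>X. \<forall>y\<in>X. \<forall>z\<in>X. \<forall>A B C x' y' z'.
        geodesic_segment X d x y A \<longrightarrow> geodesic_segment X d y z B \<longrightarrow> geodesic_segment X d z x C \<longrightarrow>
        dist x' y' = d x y \<longrightarrow> dist y' z' = d y z \<longrightarrow> dist z' x' = d z x \<longrightarrow>
        (let comp = (\<lambda>p p'. comparison_point d x A x' y' p p' \<or>
                            comparison_point d y B y' z' p p' \<or>
                            comparison_point d z C z' x' p p')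
         in \<forall>p p' q q'. comp p p' \<longrightarrow> comp q q' \<longrightarrow> d p q \<le> dist p' q'))"

section \<open>Curtains\<close>

text \<open>In a CAT(0) space the closest point on the image of a geodesic defined on a closed interval
  exists and is unique.\<close>

definition closest_proj :: "('a \<Rightarrow> 'a \<Rightarrow> real) \<Rightarrow> 'a set \<Rightarrow> 'a \<Rightarrow> 'a" where
  "closest_proj d S x = (THE p. p \<in> S \<and> (\<forall>q\<in>S. d x p \<le> d x q))"

definition proj_preimage ::
    "'a set \<Rightarrow> ('a \<Rightarrow> 'a \<Rightarrow> real) \<Rightarrow> real set \<Rightarrow> (real \<Rightarrow> 'a) \<Rightarrow> real set \<Rightarrow> 'a set" where
  "proj_preimage X d I \<alpha> T = {x \<in> X. closest_proj d (\<alpha> ` I) x \<in> \<alpha> ` T}"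

definition curtain_halfspaces ::
    "'a set \<Rightarrow> ('a \<Rightarrow> 'a \<Rightarrow> real) \<Rightarrow> 'a set \<Rightarrow> 'a set \<Rightarrow> 'a set \<Rightarrow> bool" where
  "curtain_halfspaces X d h hm hp \<longleftrightarrow>
     (\<exists>I \<alpha> r. geodesic_on X d I \<alpha> \<and> {r - 1/2..r + 1/2} \<subseteq> interior I \<and>
        h = proj_preimage X d I \<alpha> {r - 1/2..r + 1/2} \<and>
        hm = proj_preimage X d I \<alpha> (I \<inter> {..<r - 1/2}) \<and>
        hp = proj_preimage X d I \<alpha> (I \<inter> {r + 1/2<..}))"

definition curtain :: "'a set \<Rightarrow> ('a \<Rightarrow> 'a \<Rightarrow> real) \<Rightarrow> 'a set \<Rightarrow> bool" where
  "curtain X d h \<longleftrightarrow> (\<exists>hm hp. curtain_halfspaces X d h hm hp)"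

text \<open>A curtain is a set of points and may be dual to several geodesics. This does not affect
  separation: the two halfspaces are the connected components of the complement of the curtain,
  so they depend on the geodesic only up to order.\<close>

definition separates ::
    "'a set \<Rightarrow> ('a \<Rightarrow> 'a \<Rightarrow> real) \<Rightarrow> 'a set \<Rightarrow> 'a set \<Rightarrow> 'a set \<Rightarrow> bool" where
  "separates X d h A B \<longleftrightarrow>
     (\<exists>hm hp. curtain_halfspaces X d h hm hp \<and>
        (A \<subseteq> hm \<and> B \<subseteq> hp \<or> A \<subseteq> hp \<and> B \<subseteq> hm))"

text \<open>The index set \<open>J\<close> is a possibly infinite, possibly empty interval of integers.\<close>

definition curtain_chain :: "'a set \<Rightarrow> ('a \<Rightarrow> 'a \<Rightarrow> real) \<Rightarrow> 'a set set \<Rightarrow> bool" where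
  "curtain_chain X d c \<longleftrightarrow>
     (\<exists>(J::int set) h.
        (\<forall>i\<in>J. \<forall>k\<in>J. {i..k} \<subseteq> J) \<and> c = h ` J \<and>
        (\<forall>i\<in>J. curtain X d (h i)) \<and> disjoint_family_on h J \<and>
        (\<forall>i. i - 1 \<in> J \<and> i \<in> J \<and> i + 1 \<in> J \<longrightarrow> separates X d (h i) (h (i - 1)) (h (i + 1))))"

definition chain_separates ::
    "'a set \<Rightarrow> ('a \<Rightarrow> 'a \<Rightarrow> real) \<Rightarrow> 'a set set \<Rightarrow> 'a set \<Rightarrow> 'a set \<Rightarrow> bool" where
  "chain_separates X d c A B \<longleftrightarrow> (\<forall>h\<in>c. separates X d h A B)"

text \<open>Finiteness is required because \<^const>\<open>card\<close> is 0 on infinite sets.\<close>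

definition L_separated ::
    "'a set \<Rightarrow> ('a \<Rightarrow> 'a \<Rightarrow> real) \<Rightarrow> nat \<Rightarrow> 'a set \<Rightarrow> 'a set \<Rightarrow> bool" where
  "L_separated X d L h h' \<longleftrightarrow>
     curtain X d h \<and> curtain X d h' \<and> h \<inter> h' = {} \<and>
     (\<forall>c. curtain_chain X d c \<and> (\<forall>k\<in>c. k \<inter> h \<noteq> {} \<and> k \<inter> h' \<noteq> {}) \<longrightarrow> finite c \<and> card c \<le> L)"

definition L_chain :: "'a set \<Rightarrow> ('a \<Rightarrow> 'a \<Rightarrow> real) \<Rightarrow> nat \<Rightarrow> 'a set set \<Rightarrow> bool" where
  "L_chain X d L c \<longleftrightarrow> curtain_chain X d c \<and> pairwise (L_separated X d L) c"

section \<open>The curtain model\<close>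

text \<open>In a CAT(0) space a chain separating two points at distance \<open>D\<close> is finite, with fewer than
  \<open>D\<close> elements if it is nonempty, so the maximum exists; the empty chain is admitted.\<close>

definition dist_L :: "'a set \<Rightarrow> ('a \<Rightarrow> 'a \<Rightarrow> real) \<Rightarrow> nat \<Rightarrow> 'a \<Rightarrow> 'a \<Rightarrow> real" where
  "dist_L X d L x y =
     (if x = y then 0
      else 1 + real (Max {card c |c. L_chain X d L c \<and> chain_separates X d c {x} {y}}))"

text \<open>The curtain model of \<open>(X, d)\<close> has carrier \<open>X\<close> and the following metric.\<close>

definition curtain_dist ::
    "(nat \<Rightarrow> real) \<Rightarrow> 'a set \<Rightarrow> ('a \<Rightarrow> 'a \<Rightarrow> real) \<Rightarrow> 'a \<Rightarrow> 'a \<Rightarrow> real" where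
  "curtain_dist lam X d x y = (\<Sum>\<^sub>\<infinity>L\<in>{1..}. lam L * dist_L X d L x y)"

section \<open>Quasi-isometries\<close>

definition quasi_isometry ::
    "'a set \<Rightarrow> ('a \<Rightarrow> 'a \<Rightarrow> real) \<Rightarrow> 'b set \<Rightarrow> ('b \<Rightarrow> 'b \<Rightarrow> real) \<Rightarrow> ('a \<Rightarrow> 'b) \<Rightarrow> bool" where
  "quasi_isometry X d Y e \<phi> \<longleftrightarrow>
     \<phi> ` X \<subseteq> Y \<and>
     (\<exists>K C. 1 \<le> K \<and> 0 \<le> C \<and>
        (\<forall>x\<in>X. \<forall>y\<in>X. d x y / K - C \<le> e (\<phi> x) (\<phi> y) \<and> e (\<phi> x) (\<phi> y) \<le> K * d x y + C) \<and>
        (\<forall>z\<in>Y. \<exists>x\<in>X. e z (\<phi> x) \<le> C))"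

definition quasi_isometric ::
    "'a set \<Rightarrow> ('a \<Rightarrow> 'a \<Rightarrow> real) \<Rightarrow> 'b set \<Rightarrow> ('b \<Rightarrow> 'b \<Rightarrow> real) \<Rightarrow> bool" where
  "quasi_isometric X d Y e \<longleftrightarrow> (\<exists>\<phi>. quasi_isometry X d Y e \<phi>)"

end

theory Submission
  imports Defs
begin

text \<open>A quasi-isometry distorts distances by bounded factors, but it may wind a geodesic around on every
scale, and curtains notice this.  Let \<open>H\<close> be a Euclidean half-plane.  Any two disjoint
curtains of \<open>H\<close> are crossed by an infinite chain, so no two curtains are \<open>L\<close>-separated and the
curtain model of \<open>H\<close> is bounded.  We compare \<open>H\<close> with a \<^emph>\<open>spiral\<close> \<open>Z\<close>: a sector of the plane, without its tip, is cut
into blocks of sizes \<open>2\<^sup>j\<close>, each block is bent (by a bilipschitz map whose constant does not depend on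
\<open>j\<close>) until the segments along which it meets its two neighbours, the gates, lie on one line, and
the bent blocks are glued along these gates.  The result is bilipschitz to the sector, hence
quasi-isometric to \<open>H\<close>.  But a path that crosses a whole block of \<open>Z\<close> from gate to gate is shortest
along the straight inner wall between the gates.  So geodesics between blocks that are not
adjacent pass through the \<^emph>\<open>hinges\<close>, the end points of the inner walls, and the inner walls form one
geodesic ray, the spine.

A curtain is a union of geodesics that end on a segment of length \<open>1\<close>.  If it meets two blocks
that are far apart then it joins them by three geodesics, and one of these contains a hinge.  Disjoint
curtains contain different hinges, so curtains dual to the spine at every fourth block are
\<open>3\<close>-separated.  Therefore the metric of the curtain model, which dominates \<open>\<lambda>\<^sub>3 d\<^sub>3\<close>, is unbounded
on the spine.  This gives the second claim for \<open>Z\<close> and \<open>H\<close>.  For the first, glue \<open>Z\<close> and \<open>H\<close> at a point: exchanging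
the two parts is a quasi-isometry of the wedge, but it maps a bounded part of the
curtain model to an unbounded one.  (In the wedge a chain can also contain one curtain through the wedge
point.)

That these spaces are CAT(0) is proved by means of Stewart's inequality
\<open>d(x,m)\<^sup>2 d(y,z) \<le> d(x,y)\<^sup>2 d(m,z) + d(x,z)\<^sup>2 d(y,m) - d(y,m) d(m,z) d(y,z)\<close> for \<open>m\<close> on a geodesic
from \<open>y\<close> to \<open>z\<close>, which is an equality in the plane and is equivalent to the comparison of triangles
(\<open>stewart_space_CAT0\<close>).  For the spiral the inequality follows from \<^emph>\<open>logarithm maps\<close>: for each point \<open>m\<close>
there is a map of \<open>Z\<close> to the plane that does not increase distances, preserves distances from \<open>m\<close>, and
is an isometry on a block around \<open>m\<close> (\<open>log_map_short\<close>, \<open>spiral_dist_log\<close>).  The same maps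
evaluate the distances of \<open>Z\<close>, and so they also show where its geodesics pass (\<open>aligned_hinge\<close>).
The unbounded part of the curtain model is \<open>hinged_ray_long_chain\<close>, the bounded part
\<open>half_plane_dist_L_bounded\<close>.\<close>

section \<open>Stewart's inequality and CAT(0) spaces\<close>

text \<open>The point \<open>m\<close> lies on a geodesic from \<open>y\<close> to \<open>z\<close>.\<close>

definition aligned :: "('a \<Rightarrow> 'a \<Rightarrow> real) \<Rightarrow> 'a \<Rightarrow> 'a \<Rightarrow> 'a \<Rightarrow> bool" where
  "aligned d y m z \<longleftrightarrow> d y m + d m z = d y z"

definition stewart :: "('a \<Rightarrow> 'a \<Rightarrow> real) \<Rightarrow> 'a \<Rightarrow> 'a \<Rightarrow> 'a \<Rightarrow> 'a \<Rightarrow> bool" where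
  "stewart d x y m z \<longleftrightarrow>
     (d x m)\<^sup>2 * d y z \<le> (d x y)\<^sup>2 * d m z + (d x z)\<^sup>2 * d y m - d y m * d m z * d y z"

text \<open>The CAT(0) condition in a form that mentions neither geodesics nor comparison
triangles.  It passes to isometric copies at once and is easy to check for wedges and limits.\<close>

definition stewart_space :: "'a set \<Rightarrow> ('a \<Rightarrow> 'a \<Rightarrow> real) \<Rightarrow> bool" where
  "stewart_space X d \<longleftrightarrow> Metric_space X d \<and>
     (\<forall>y\<in>X. \<forall>z\<in>X. \<forall>t\<in>{0..d y z}. \<exists>m\<in>X. d y m = t \<and> d m z = d y z - t) \<and>
     (\<forall>x\<in>X. \<forall>y\<in>X. \<forall>m\<in>X. \<forall>z\<in>X. aligned d y m z \<longrightarrow> stewart d x y m z)"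

text \<open>In an inner product space, with \<open>m = y + t (z - y)\<close>, this is the expansion of
\<open>\<bar>(1 - t) (x - y) + t (x - z)\<bar>\<^sup>2\<close>.\<close>

lemma stewart_equality:
  fixes x y m z :: "'b::real_inner"
  assumes "aligned dist y m z"
  shows "(dist x m)\<^sup>2 * dist y z = (dist x y)\<^sup>2 * dist m z + (dist x z)\<^sup>2 * dist y m
    - dist y m * dist m z * dist y z"
proof (cases "y = z")
  case True
  then have "m = z" using assms by (simp add: aligned_def dist_commute)
  then show ?thesis using True by simp
next
  case False
  define t where "t = dist y m / dist y z"
  have D: "dist y z > 0" using False by simp
  have ym: "dist y m = t * dist y z" using D by (simp add: t_def)
  have mz: "dist m z = (1 - t) * dist y z" using assms ym by (simp add: aligned_def algebra_simps)
  have "m = y + t *\<^sub>R (z - y)"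
  proof -
    have "dist y m + dist m z = dist y z" using assms by (simp add: aligned_def)
    then have "norm (m - y) + norm (z - m) = norm ((m - y) + (z - m))"
      by (simp add: dist_norm norm_minus_commute)
    then have "norm (m - y) *\<^sub>R (z - m) = norm (z - m) *\<^sub>R (m - y)"
      using norm_triangle_eq[of "m - y" "z - m"] by simp
    then have "(t * dist y z) *\<^sub>R (z - m) = ((1 - t) * dist y z) *\<^sub>R (m - y)"
      using ym mz by (simp add: dist_norm norm_minus_commute)
    then have "dist y z *\<^sub>R (t *\<^sub>R (z - m)) = dist y z *\<^sub>R ((1 - t) *\<^sub>R (m - y))"
      by (simp add: mult.commute)
    then have "t *\<^sub>R (z - m) = (1 - t) *\<^sub>R (m - y)"
      by (rule scaleR_left_imp_eq[rotated]) (use False in simp)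
    then show ?thesis by (simp add: algebra_simps)
  qed
  then have xm: "x - m = (1 - t) *\<^sub>R (x - y) + t *\<^sub>R (x - z)" by (simp add: algebra_simps)
  have yz: "y - z = (x - z) - (x - y)" by simp
  have "(dist x m)\<^sup>2 = (1 - t) * (dist x y)\<^sup>2 + t * (dist x z)\<^sup>2 - t * (1 - t) * (dist y z)\<^sup>2"
    unfolding dist_norm xm yz power2_norm_eq_inner
    by (simp add: inner_add_left inner_add_right inner_diff_left inner_diff_right inner_commute)
      (simp add: algebra_simps power2_eq_square)
  then show ?thesis unfolding ym mz \<open>(dist x m)\<^sup>2 = _\<close> by (simp add: algebra_simps power2_eq_square)
qed

context
  fixes X :: "'a set" and d
  assumes CN: "stewart_space X d"
begin

interpretation Metric_space X d
  using CN by (simp add: stewart_space_def)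

lemma stewart_between_point:
  assumes "y \<in> X" "z \<in> X" "0 \<le> t" "t \<le> d y z"
  obtains m where "m \<in> X" "d y m = t" "d m z = d y z - t"
proof -
  have "t \<in> {0..d y z}" using assms by simp
  then show ?thesis using CN assms that unfolding stewart_space_def by blast
qed

lemma stewart_inequality:
  assumes "x \<in> X" "y \<in> X" "m \<in> X" "z \<in> X" "aligned d y m z"
  shows "(d x m)\<^sup>2 * d y z \<le> (d x y)\<^sup>2 * d m z + (d x z)\<^sup>2 * d y m - d y m * d m z * d y z"
  using CN assms unfolding stewart_space_def stewart_def by auto

text \<open>Stewart's inequality for \<open>m\<close> between \<open>y\<close> and \<open>z\<close> and the vertex \<open>m'\<close> has right-hand
side \<open>0\<close> if \<open>m'\<close> has the same distances from \<open>y\<close> and \<open>z\<close>.\<close>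

lemma between_unique:
  assumes "y \<in> X" "z \<in> X" "m \<in> X" "m' \<in> X" "aligned d y m z" "aligned d y m' z" "d y m' = d y m"
  shows "m = m'"
proof (cases "y = z")
  case True
  have "d y m = 0" "d y m' = 0" using True assms nonneg[of y m] nonneg[of m z]
    by (auto simp: aligned_def commute)
  then show ?thesis using assms by simp
next
  case False
  have "d m' z = d m z" using assms by (simp add: aligned_def)
  then have "(d m' m)\<^sup>2 * d y z \<le> (d y m)\<^sup>2 * d m z + (d m z)\<^sup>2 * d y m - d y m * d m z * d y z"
    using stewart_inequality[of m' y m z] assms by (simp add: commute)
  also have "\<dots> = 0"
    using assms(5) unfolding aligned_def by (simp add: algebra_simps power2_eq_square flip: assms(5)[unfolded aligned_def])
  finally have "(d m' m)\<^sup>2 * d y z \<le> 0" .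
  moreover have "d y z > 0" using False assms by simp
  ultimately have "(d m' m)\<^sup>2 \<le> 0" by (simp add: mult_le_0_iff)
  then have "d m' m = 0" by simp
  then show ?thesis using assms by simp
qed

text \<open>By uniqueness the points between \<open>y\<close> and \<open>z\<close> fit together to a geodesic: a point
between \<open>y\<close> and \<open>\<gamma> t\<close> is also between \<open>y\<close> and \<open>z\<close>.\<close>

lemma geodesic_through_between_points:
  assumes "y \<in> X" "z \<in> X"
  obtains \<gamma> where "geodesic_on X d {0..d y z} \<gamma>" "\<gamma> 0 = y" "\<gamma> (d y z) = z"
proof -
  let ?D = "d y z"
  have "\<exists>\<gamma>. \<forall>t\<in>{0..?D}. \<gamma> t \<in> X \<and> d y (\<gamma> t) = t \<and> d (\<gamma> t) z = ?D - t"
    using CN assms unfolding stewart_space_def by (intro bchoice) blast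
  then obtain \<gamma> where \<gamma>: "\<And>t. t \<in> {0..?D} \<Longrightarrow> \<gamma> t \<in> X \<and> d y (\<gamma> t) = t \<and> d (\<gamma> t) z = ?D - t"
    by blast
  have lt: "d (\<gamma> s) (\<gamma> t) = t - s" if st: "s \<in> {0..?D}" "t \<in> {0..?D}" "s \<le> t" for s t
  proof -
    obtain w where w: "w \<in> X" "d y w = s" "d w (\<gamma> t) = t - s"
      using stewart_between_point[of y "\<gamma> t" s] assms \<gamma>[OF st(2)] st by auto
    have "d w z \<le> ?D - s" using triangle[of w "\<gamma> t" z] w \<gamma>[OF st(2)] assms by simp
    moreover have "?D \<le> s + d w z" using triangle[of y w z] w assms by simp
    ultimately have "w = \<gamma> s"
      using between_unique[of y z w "\<gamma> s"] w \<gamma>[OF st(1)] assms by (simp add: aligned_def)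
    then show ?thesis using w by simp
  qed
  have "geodesic_on X d {0..?D} \<gamma>"
    unfolding geodesic_on_def
  proof (intro conjI ballI)
    fix s t assume "s \<in> {0..?D}" "t \<in> {0..?D}"
    then show "d (\<gamma> s) (\<gamma> t) = \<bar>s - t\<bar>"
      using lt[of s t] lt[of t s] by (cases "s \<le> t") (auto simp: commute)
  qed (use \<gamma> in auto)
  moreover have "\<gamma> 0 = y"
  proof -
    have "0 \<in> {0..?D}" by simp
    then have "d y (\<gamma> 0) = 0" "\<gamma> 0 \<in> X" using \<gamma> by blast+
    then show ?thesis using assms by simp
  qed
  moreover have "\<gamma> ?D = z"
  proof -
    have "?D \<in> {0..?D}" by simp
    then have "d (\<gamma> ?D) z = 0" "\<gamma> ?D \<in> X" using \<gamma>[of ?D] by simp_all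
    then show ?thesis using assms by simp
  qed
  ultimately show ?thesis using that by blast
qed

lemma geodesic_segment_between:
  assumes "geodesic_segment X d x y S" "p \<in> S"
  shows "p \<in> X" "aligned d x p y"
proof -
  obtain \<gamma> t where \<gamma>: "geodesic_on X d {0..d x y} \<gamma>" "\<gamma> 0 = x" "\<gamma> (d x y) = y" "p = \<gamma> t" "t \<in> {0..d x y}"
    using assms unfolding geodesic_segment_def by blast
  have *: "d (\<gamma> s) (\<gamma> t) = \<bar>s - t\<bar>" if "s \<in> {0..d x y}" "t \<in> {0..d x y}" for s t
    using \<gamma>(1) that unfolding geodesic_on_def by blast
  show "p \<in> X" using \<gamma> unfolding geodesic_on_def by blast
  have "d x p = t" using *[of 0 t] \<gamma> by simp
  moreover have "d p y = d x y - t" using *[of t "d x y"] \<gamma> by simp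
  ultimately show "aligned d x p y" by (simp add: aligned_def)
qed

text \<open>The right-hand side of Stewart's inequality increases with the distances of \<open>w\<close> from
\<open>x\<close> and \<open>y\<close>, and the comparison points satisfy it with equality.\<close>

lemma stewart_comparison:
  fixes w' x' y' p' :: "real^2"
  assumes "w \<in> X" "x \<in> X" "y \<in> X" "p \<in> X" "aligned d x p y" "aligned dist x' p' y'"
    and xy: "dist x' y' = d x y" and xp: "dist x' p' = d x p"
    and wx: "d w x \<le> dist w' x'" and wy: "d w y \<le> dist w' y'"
  shows "d w p \<le> dist w' p'"
proof (cases "x = y")
  case True
  then have "d x p = 0" using assms nonneg[of x p] nonneg[of p y]
    by (auto simp: aligned_def commute)
  then have "x = p" "x' = p'" using assms by auto
  then show ?thesis using wx by simp
next
  case False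
  have py: "dist p' y' = d p y" using assms by (simp add: aligned_def)
  have "(d w p)\<^sup>2 * d x y \<le> (d w x)\<^sup>2 * d p y + (d w y)\<^sup>2 * d x p - d x p * d p y * d x y"
    using stewart_inequality assms by blast
  also have "\<dots> \<le> (dist w' x')\<^sup>2 * d p y + (dist w' y')\<^sup>2 * d x p - d x p * d p y * d x y"
    using wx wy by (intro diff_right_mono add_mono mult_right_mono power_mono) auto
  also have "\<dots> = (dist w' p')\<^sup>2 * d x y"
    using stewart_equality[OF assms(6), of w'] xy xp py by simp
  finally have "(d w p)\<^sup>2 \<le> (dist w' p')\<^sup>2"
    using mdist_pos_less[OF False assms(2,3)] by (simp add: mult_le_cancel_right)
  then show ?thesis by (rule power2_le_imp_le) simp
qed

text \<open>The preceding lemma is applied twice.  A point \<open>q\<close> on any side compares well with the three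
vertices, each of which lies on or opposite to that side; and then \<open>q\<close>, as the new vertex, compares well
with every point \<open>p\<close> on a side.\<close>

lemma stewart_space_CAT0: "CAT0 X d"
  unfolding CAT0_def
proof (intro conjI ballI allI impI)
  show "Metric_space X d" by (rule Metric_space_axioms)
next
  fix x y assume "x \<in> X" "y \<in> X"
  then show "\<exists>S. geodesic_segment X d x y S"
    using geodesic_through_between_points[of x y] unfolding geodesic_segment_def by metis
next
  fix x y z A B C and x' y' z' :: "real^2"
  assume xyz: "x \<in> X" "y \<in> X" "z \<in> X"
    and seg: "geodesic_segment X d x y A" "geodesic_segment X d y z B" "geodesic_segment X d z x C"
    and base_triangle: "dist x' y' = d x y" "dist y' z' = d y z" "dist z' x' = d z x"
  define comp where "comp = (\<lambda>p p'. comparison_point d x A x' y' p p' \<or>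
     comparison_point d y B y' z' p p' \<or> comparison_point d z C z' x' p p')"
  have bt: "aligned dist u' p' v'" if "p' \<in> closed_segment u' v'" for p' u' v' :: "real^2"
    using iffD1[OF Line_Segment.between iffD2[OF between_mem_segment that]] by (simp add: aligned_def)
  have vertex: "d w p \<le> dist w' p'"
    if c: "comp p p'" and w: "w \<in> X" "d w x \<le> dist w' x'" "d w y \<le> dist w' y'" "d w z \<le> dist w' z'"
    for p p' w w'
    using c unfolding comp_def comparison_point_def
  proof (elim disjE conjE)
    assume "p \<in> A" "p' \<in> closed_segment x' y'" "dist x' p' = d x p"
    then show ?thesis
      using stewart_comparison[of w x y p x' p' y' w'] geodesic_segment_between[OF seg(1)] bt xyz w base_triangle by auto
  next
    assume "p \<in> B" "p' \<in> closed_segment y' z'" "dist y' p' = d y p"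
    then show ?thesis
      using stewart_comparison[of w y z p y' p' z' w'] geodesic_segment_between[OF seg(2)] bt xyz w base_triangle by auto
  next
    assume "p \<in> C" "p' \<in> closed_segment z' x'" "dist z' p' = d z p"
    then show ?thesis
      using stewart_comparison[of w z x p z' p' x' w'] geodesic_segment_between[OF seg(3)] bt xyz w base_triangle by auto
  qed
  have X: "p \<in> X" if "comp p p'" for p p'
    using that geodesic_segment_between seg unfolding comp_def comparison_point_def by metis
  have "d p q \<le> dist p' q'" if p: "comp p p'" and q: "comp q q'" for p p' q q'
  proof -
    have "d x q \<le> dist x' q'"
      by (rule vertex[OF q]) (use xyz base_triangle in \<open>simp_all add: dist_commute commute\<close>)
    moreover have "d y q \<le> dist y' q'"
      by (rule vertex[OF q]) (use xyz base_triangle in \<open>simp_all add: dist_commute commute\<close>)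
    moreover have "d z q \<le> dist z' q'"
      by (rule vertex[OF q]) (use xyz base_triangle in \<open>simp_all add: dist_commute commute\<close>)
    ultimately have "d q p \<le> dist q' p'"
      using vertex[OF p X[OF q], of q'] xyz X[OF q] by (simp add: dist_commute commute)
    then show ?thesis by (simp add: dist_commute commute)
  qed
  then show "let comp = (\<lambda>p p'. comparison_point d x A x' y' p p' \<or>
                            comparison_point d y B y' z' p p' \<or>
                            comparison_point d z C z' x' p p')
         in \<forall>p p' q q'. comp p p' \<longrightarrow> comp q q' \<longrightarrow> d p q \<le> dist p' q'"
    unfolding Let_def comp_def by blast
qed

text \<open>Both \<open>p\<close> and \<open>v\<close> are compared with the midpoint of \<open>u\<close> and \<open>q\<close>.  This inequality of Berg and
Nikolaev makes projections \<open>1\<close>-Lipschitz.\<close>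

lemma quadrilateral_inequality:
  assumes "u \<in> X" "v \<in> X" "p \<in> X" "q \<in> X"
  shows "(d u q)\<^sup>2 + (d p v)\<^sup>2 \<le> (d u p)\<^sup>2 + (d p q)\<^sup>2 + (d q v)\<^sup>2 + (d u v)\<^sup>2"
proof (cases "u = q")
  case True
  have "(d p v)\<^sup>2 \<le> (d p q + d q v)\<^sup>2" using triangle[of p q v] assms by (intro power_mono) auto
  also have "\<dots> \<le> 2 * (d p q)\<^sup>2 + 2 * (d q v)\<^sup>2"
    using sum_squares_bound[of "d p q" "d q v"] by (simp add: power2_sum)
  finally show ?thesis using True assms by (simp add: commute)
next
  case False
  let ?D = "d u q"
  have D: "?D > 0" using False assms by simp
  obtain m where m: "m \<in> X" "d u m = ?D / 2" "d m q = ?D - ?D / 2"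
    using stewart_between_point[of u q "?D/2"] assms D by auto
  have b: "aligned d u m q" using m by (simp add: aligned_def)
  have half: "(d w m)\<^sup>2 \<le> (d w u)\<^sup>2 / 2 + (d w q)\<^sup>2 / 2 - ?D\<^sup>2 / 4" if "w \<in> X" for w
  proof -
    have "(d w m)\<^sup>2 * ?D \<le> ((d w u)\<^sup>2 / 2 + (d w q)\<^sup>2 / 2 - ?D\<^sup>2 / 4) * ?D"
      using stewart_inequality[OF that assms(1) m(1) assms(4) b] m
      by (simp add: algebra_simps power2_eq_square)
    then show ?thesis using D by simp
  qed
  have "(d p v)\<^sup>2 \<le> (d p m + d m v)\<^sup>2" using triangle[of p m v] assms m by (intro power_mono) auto
  also have "\<dots> \<le> 2 * (d p m)\<^sup>2 + 2 * (d v m)\<^sup>2"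
    using sum_squares_bound[of "d p m" "d v m"] by (simp add: power2_sum commute)
  also have "\<dots> \<le> (d p u)\<^sup>2 + (d p q)\<^sup>2 + (d v u)\<^sup>2 + (d v q)\<^sup>2 - ?D\<^sup>2"
    using half[of p] half[of v] assms by simp
  finally show ?thesis by (simp add: commute)
qed

section \<open>Projection to a geodesic\<close>

context
  fixes I \<alpha>
  assumes geo: "geodesic_on X d I \<alpha>" and ne: "I \<noteq> {}"
begin

lemma geodesic_dist: "s \<in> I \<Longrightarrow> t \<in> I \<Longrightarrow> d (\<alpha> s) (\<alpha> t) = \<bar>s - t\<bar>"
  using geo by (simp add: geodesic_on_def)

lemma geodesic_in: "s \<in> I \<Longrightarrow> \<alpha> s \<in> X"
  using geo by (auto simp: geodesic_on_def)

lemma geodesic_inj: "s \<in> I \<Longrightarrow> t \<in> I \<Longrightarrow> \<alpha> s = \<alpha> t \<longleftrightarrow> s = t"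
  using geodesic_dist[of s t] geodesic_in[of s] by auto

text \<open>The closest point as a parameter of the geodesic.  Unlike \<^const>\<open>closest_proj\<close>, this is a
relation, so that existence and uniqueness are theorems about it.\<close>

definition is_foot :: "'a \<Rightarrow> real \<Rightarrow> bool" where
  "is_foot x t \<longleftrightarrow> t \<in> I \<and> (\<forall>s\<in>I. d x (\<alpha> t) \<le> d x (\<alpha> s))"

text \<open>Points of the geodesic farther than \<open>2 d(x, \<alpha> s0)\<close> from \<open>\<alpha> s0\<close> are farther from \<open>x\<close> than \<open>\<alpha> s0\<close>, so
the minimum over a compact interval is the minimum over \<open>I\<close>.\<close>

lemma foot_exists:
  assumes "x \<in> X"
  shows "\<exists>t. is_foot x t"
proof -
  obtain s0 where s0: "s0 \<in> I" using ne by blast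
  let ?r = "2 * d x (\<alpha> s0)"
  let ?K = "I \<inter> cball s0 ?r"
  have "compact ?K" using geo by (intro closed_Int_compact) (auto simp: geodesic_on_def)
  moreover have "?K \<noteq> {}" using s0 by auto
  moreover have "continuous_on ?K (\<lambda>t. d x (\<alpha> t))"
    unfolding continuous_on_iff
  proof (intro ballI allI impI)
    fix t and e :: real assume t: "t \<in> ?K" and e: "e > 0"
    have "dist (d x (\<alpha> t')) (d x (\<alpha> t)) < e" if t': "t' \<in> ?K" "dist t' t < e" for t'
    proof -
      have "d x (\<alpha> t') \<le> d x (\<alpha> t) + \<bar>t - t'\<bar>" "d x (\<alpha> t) \<le> d x (\<alpha> t') + \<bar>t' - t\<bar>"
        using triangle[of x "\<alpha> t" "\<alpha> t'"] triangle[of x "\<alpha> t'" "\<alpha> t"]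
          geodesic_dist[of t t'] geodesic_dist[of t' t] geodesic_in t t' assms by auto
      then show ?thesis using t'(2) by (simp add: dist_real_def)
    qed
    then show "\<exists>\<delta>>0. \<forall>t'\<in>?K. dist t' t < \<delta> \<longrightarrow> dist (d x (\<alpha> t')) (d x (\<alpha> t)) < e"
      using e by blast
  qed
  ultimately have "\<exists>t\<in>?K. \<forall>s\<in>?K. d x (\<alpha> t) \<le> d x (\<alpha> s)"
    by (rule continuous_attains_inf)
  then obtain t where t: "t \<in> ?K" "\<And>s. s \<in> ?K \<Longrightarrow> d x (\<alpha> t) \<le> d x (\<alpha> s)"
    by blast
  have "d x (\<alpha> t) \<le> d x (\<alpha> s)" if s: "s \<in> I" for s
  proof (cases "s \<in> ?K")
    case False
    then have "\<bar>s - s0\<bar> > ?r" using s by (auto simp: dist_real_def)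
    then have "d x (\<alpha> s0) \<le> d x (\<alpha> s)"
      using triangle[of "\<alpha> s" x "\<alpha> s0"] geodesic_dist[OF s s0] geodesic_in s s0 assms by (simp add: commute)
    then show ?thesis using t(2)[of s0] s0 by simp
  qed (use t in blast)
  then show ?thesis using t by (auto simp: is_foot_def)
qed

text \<open>The angle at the foot is at least a right angle: Stewart's inequality for a point at
distance \<open>\<delta>\<close> from the foot, which is not closer to \<open>x\<close> than the foot itself, gives the claim up to \<open>\<delta> D\<close>.\<close>

lemma foot_pythagoras:
  assumes "x \<in> X" "is_foot x t" "s \<in> I"
  shows "(d x (\<alpha> t))\<^sup>2 + (s - t)\<^sup>2 \<le> (d x (\<alpha> s))\<^sup>2"
proof (cases "s = t")
  case False
  define D where "D = \<bar>s - t\<bar>"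
  have D: "D > 0" using False by (simp add: D_def)
  have t: "t \<in> I" using assms by (simp add: is_foot_def)
  have "(d x (\<alpha> t))\<^sup>2 + D\<^sup>2 \<le> (d x (\<alpha> s))\<^sup>2"
  proof (rule field_le_epsilon)
    fix e :: real assume e: "e > 0"
    \<comment> \<open>\<open>\<delta> D \<le> e\<close> bounds the error, and \<open>\<delta> \<le> D\<close> keeps the comparison point between the two parameters.\<close>
    define \<delta> where "\<delta> = min (D / 2) (e / D)"
    have \<delta>: "0 < \<delta>" "\<delta> \<le> D" "\<delta> * D \<le> e" using e D unfolding \<delta>_def
      by (auto simp: min_def field_simps)
    define w where "w = (if t < s then t + \<delta> else t - \<delta>)"
    have w: "\<bar>w - t\<bar> = \<delta>" "\<bar>s - w\<bar> = D - \<delta>" using \<delta> False by (auto simp: w_def D_def)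
    have "min s t \<le> w" "w \<le> max s t" using \<delta> False by (auto simp: w_def D_def)
    then have wI: "w \<in> I" using geo t assms(3) unfolding geodesic_on_def is_interval_1
      by (metis max_def min_def)
    have e1: "d (\<alpha> t) (\<alpha> w) = \<delta>" "d (\<alpha> w) (\<alpha> s) = D - \<delta>" "d (\<alpha> t) (\<alpha> s) = D"
      using w geodesic_dist t assms(3) wI by (simp_all add: D_def abs_minus_commute)
    have "(d x (\<alpha> w))\<^sup>2 * D \<le> (d x (\<alpha> t))\<^sup>2 * (D - \<delta>) + (d x (\<alpha> s))\<^sup>2 * \<delta> - \<delta> * (D - \<delta>) * D"
      using stewart_inequality[of x "\<alpha> t" "\<alpha> w" "\<alpha> s"] e1 geodesic_in t assms wI by (simp add: aligned_def)
    moreover have "(d x (\<alpha> t))\<^sup>2 * D \<le> (d x (\<alpha> w))\<^sup>2 * D"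
      using assms wI D by (intro mult_right_mono power_mono) (auto simp: is_foot_def)
    ultimately have "\<delta> * ((d x (\<alpha> t))\<^sup>2 + D\<^sup>2) \<le> \<delta> * ((d x (\<alpha> s))\<^sup>2 + \<delta> * D)"
      by (simp add: algebra_simps power2_eq_square)
    then have "(d x (\<alpha> t))\<^sup>2 + D\<^sup>2 \<le> (d x (\<alpha> s))\<^sup>2 + \<delta> * D" using \<delta> by simp
    then show "(d x (\<alpha> t))\<^sup>2 + D\<^sup>2 \<le> (d x (\<alpha> s))\<^sup>2 + e" using \<delta> by simp
  qed
  then show ?thesis by (simp add: D_def)
qed simp

lemma foot_unique:
  assumes "x \<in> X" "is_foot x t" "is_foot x s"
  shows "s = t"
proof -
  have "d x (\<alpha> t) = d x (\<alpha> s)" using assms by (auto simp: is_foot_def intro: antisym)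
  then have "(s - t)\<^sup>2 \<le> 0" using foot_pythagoras[OF assms(1,2), of s] assms by (simp add: is_foot_def)
  then show ?thesis by simp
qed

lemma closest_proj_foot:
  assumes "x \<in> X" "is_foot x t"
  shows "closest_proj d (\<alpha> ` I) x = \<alpha> t"
  unfolding closest_proj_def
proof (rule the_equality)
  show "\<alpha> t \<in> \<alpha> ` I \<and> (\<forall>q\<in>\<alpha> ` I. d x (\<alpha> t) \<le> d x q)"
    using assms by (auto simp: is_foot_def)
next
  fix p assume p: "p \<in> \<alpha> ` I \<and> (\<forall>q\<in>\<alpha> ` I. d x p \<le> d x q)"
  then obtain s where "p = \<alpha> s" "is_foot x s" by (auto simp: is_foot_def)
  then show "p = \<alpha> t" using foot_unique[OF assms] by simp
qed

lemma proj_preimage_foot: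
  assumes "T \<subseteq> I"
  shows "x \<in> proj_preimage X d I \<alpha> T \<longleftrightarrow> x \<in> X \<and> (\<exists>t\<in>T. is_foot x t)"
proof (cases "x \<in> X")
  case True
  obtain t where t: "is_foot x t" using foot_exists[OF True] by blast
  have "closest_proj d (\<alpha> ` I) x = \<alpha> t" using closest_proj_foot[OF True t] .
  moreover have "\<alpha> t \<in> \<alpha> ` T \<longleftrightarrow> t \<in> T"
    using geodesic_inj t assms by (auto simp: is_foot_def)
  moreover have "(\<exists>s\<in>T. is_foot x s) \<longleftrightarrow> t \<in> T" using t foot_unique[OF True t] by blast
  ultimately show ?thesis using True by (simp add: proj_preimage_def)
qed (simp add: proj_preimage_def)

text \<open>Add the two Pythagorean inequalities to the quadrilateral inequality for \<open>u\<close>, \<open>\<alpha> s\<close>, \<open>\<alpha> t\<close>,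
\<open>v\<close>: what remains is \<open>2 (s - t)\<^sup>2 \<le> (s - t)\<^sup>2 + d(u, v)\<^sup>2\<close>.\<close>

lemma foot_lipschitz:
  assumes "u \<in> X" "v \<in> X" "is_foot u s" "is_foot v t"
  shows "\<bar>s - t\<bar> \<le> d u v"
proof -
  have I: "s \<in> I" "t \<in> I" using assms by (auto simp: is_foot_def)
  have "(d u (\<alpha> s))\<^sup>2 + (t - s)\<^sup>2 \<le> (d u (\<alpha> t))\<^sup>2" using foot_pythagoras[OF assms(1,3) I(2)] .
  moreover have "(d v (\<alpha> t))\<^sup>2 + (s - t)\<^sup>2 \<le> (d v (\<alpha> s))\<^sup>2" using foot_pythagoras[OF assms(2,4) I(1)] .
  moreover have "(d u (\<alpha> t))\<^sup>2 + (d (\<alpha> s) v)\<^sup>2 \<le> (d u (\<alpha> s))\<^sup>2 + (d (\<alpha> s) (\<alpha> t))\<^sup>2 + (d (\<alpha> t) v)\<^sup>2 + (d u v)\<^sup>2"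
    using quadrilateral_inequality[of u v "\<alpha> s" "\<alpha> t"] geodesic_in I assms by simp
  ultimately have "\<bar>s - t\<bar>\<^sup>2 \<le> (d u v)\<^sup>2"
    using geodesic_dist[OF I] by (simp add: commute power2_commute)
  then show ?thesis by (rule power2_le_imp_le) simp
qed

text \<open>The points of the geodesic from \<open>x\<close> to its foot have the same foot.  So a curtain contains the
geodesic from each of its points to its core segment.\<close>

lemma foot_between:
  assumes "x \<in> X" "p \<in> X" "is_foot x t" "aligned d x p (\<alpha> t)"
  shows "is_foot p t"
  unfolding is_foot_def
proof (intro conjI ballI)
  show "t \<in> I" using assms by (simp add: is_foot_def)
  fix s assume s: "s \<in> I"
  then have "d x (\<alpha> t) \<le> d x (\<alpha> s)" using assms by (simp add: is_foot_def)
  then show "d p (\<alpha> t) \<le> d p (\<alpha> s)"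
    using triangle[of x p "\<alpha> s"] assms geodesic_in[OF s] by (simp add: aligned_def)
qed

end

end

section \<open>Chains separating two points are finite\<close>

context
  fixes X :: "'a set" and d
  assumes CN: "stewart_space X d"
begin

interpretation Metric_space X d
  using CN by (simp add: stewart_space_def)

lemma interval_interior:
  fixes I :: "real set"
  assumes "{r - 1/2..r + 1/2} \<subseteq> interior I"
  shows "{r - 1/2..r + 1/2} \<subseteq> I" "I \<noteq> {}"
proof -
  show 1: "{r - 1/2..r + 1/2} \<subseteq> I" using assms interior_subset by blast
  have "r \<in> {r - 1/2..r + 1/2}" by simp
  then show "I \<noteq> {}" using 1 by blast
qed

text \<open>A sequence with steps at most \<open>1\<close> cannot jump over an interval of length \<open>1\<close>.\<close>

lemma step_function_hits_unit_interval:
  fixes f :: "nat \<Rightarrow> real"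
  assumes "f 0 < r - 1/2" "r - 1/2 \<le> f N" "\<And>n. n < N \<Longrightarrow> \<bar>f (Suc n) - f n\<bar> \<le> 1"
  shows "\<exists>n\<le>N. f n \<in> {r - 1/2..r + 1/2}"
  using assms(2,3)
proof (induction N)
  case 0
  then show ?case using assms(1) by simp
next
  case (Suc N)
  show ?case
  proof (cases "r - 1/2 \<le> f N")
    case True
    then obtain n where "n \<le> N" "f n \<in> {r - 1/2..r + 1/2}" using Suc by auto
    then show ?thesis using le_Suc_eq by blast
  next
    case False
    then have "f (Suc N) \<in> {r - 1/2..r + 1/2}" using Suc.prems(1) Suc.prems(2)[of N] by auto
    then show ?thesis by blast
  qed
qed

text \<open>The feet of \<open>\<gamma> 0, \<gamma> 1, \<gamma> 2, \<dots>\<close> on the geodesic that \<open>h\<close> is dual to move by steps of at most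
\<open>1\<close> from one side of the core segment to the other.\<close>

lemma curtain_meets_integer_point:
  assumes sep: "separates X d h {x} {y}" and xy: "x \<in> X" "y \<in> X"
    and \<gamma>: "geodesic_on X d {0..d x y} \<gamma>" "\<gamma> 0 = x" "\<gamma> (d x y) = y"
  shows "\<exists>n\<le>nat \<lfloor>d x y\<rfloor>. \<gamma> (real n) \<in> h"
proof -
  define N where "N = nat \<lfloor>d x y\<rfloor>"
  obtain I \<alpha> r where geo: "geodesic_on X d I \<alpha>" and r: "{r - 1/2..r + 1/2} \<subseteq> interior I"
    and h: "h = proj_preimage X d I \<alpha> {r - 1/2..r + 1/2}"
    and side: "x \<in> proj_preimage X d I \<alpha> (I \<inter> {..<r - 1/2}) \<and> y \<in> proj_preimage X d I \<alpha> (I \<inter> {r + 1/2<..}) \<or>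
      y \<in> proj_preimage X d I \<alpha> (I \<inter> {..<r - 1/2}) \<and> x \<in> proj_preimage X d I \<alpha> (I \<inter> {r + 1/2<..})"
    using sep unfolding separates_def curtain_halfspaces_def by auto
  have rI: "{r - 1/2..r + 1/2} \<subseteq> I" and ne: "I \<noteq> {}" using interval_interior[OF r] by auto
  note pp = proj_preimage_foot[OF CN geo ne]
  define \<tau> where "\<tau> u = (SOME t. is_foot d I \<alpha> u t)" for u
  have \<tau>: "is_foot d I \<alpha> u (\<tau> u)" if "u \<in> X" for u
    unfolding \<tau>_def using foot_exists[OF CN geo ne that] by (rule someI_ex)
  have lip: "\<bar>\<tau> u - \<tau> v\<bar> \<le> d u v" if "u \<in> X" "v \<in> X" for u v
    using foot_lipschitz[OF CN geo ne] that \<tau> by blast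
  have \<tau>_eq: "\<tau> u = t" if "u \<in> X" "is_foot d I \<alpha> u t" for u t
    using foot_unique[OF CN geo ne] that \<tau> by metis
  have side': "\<tau> x < r - 1/2 \<and> r + 1/2 < \<tau> y \<or> \<tau> y < r - 1/2 \<and> r + 1/2 < \<tau> x"
    using side pp[of "I \<inter> {..<r - 1/2}"] pp[of "I \<inter> {r + 1/2<..}"] \<tau>_eq xy by auto
  have N: "real N \<le> d x y" "d x y < real N + 1" unfolding N_def using nonneg[of x y] by linarith+
  have \<gamma>X: "\<gamma> t \<in> X" if "t \<in> {0..d x y}" for t using \<gamma>(1) that by (auto simp: geodesic_on_def)
  have \<gamma>d: "d (\<gamma> s) (\<gamma> t) = \<bar>s - t\<bar>" if "s \<in> {0..d x y}" "t \<in> {0..d x y}" for s t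
    using \<gamma>(1) that by (auto simp: geodesic_on_def)
  define f where "f n = \<tau> (\<gamma> (real n))" for n :: nat
  have f0: "f 0 = \<tau> x" using \<gamma> by (simp add: f_def)
  have step: "\<bar>f (Suc n) - f n\<bar> \<le> 1" if "n < N" for n
  proof -
    have "real n + 1 \<le> real N" using that by linarith
    then have "real n + 1 \<le> d x y" using N(1) by linarith
    then have "{real n, real (Suc n)} \<subseteq> {0..d x y}" by simp
    then show ?thesis
      using lip[of "\<gamma> (real (Suc n))" "\<gamma> (real n)"] \<gamma>X \<gamma>d[of "real (Suc n)" "real n"] by (auto simp: f_def)
  qed
  have last: "\<bar>f N - \<tau> y\<bar> < 1"
  proof -
    have "real N \<in> {0..d x y}" "d x y \<in> {0..d x y}" using N nonneg by auto
    then have "d (\<gamma> (real N)) y = d x y - real N" "\<gamma> (real N) \<in> X"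
      using \<gamma>d[of "real N" "d x y"] \<gamma>(3) \<gamma>X N by auto
    then show ?thesis using lip[of "\<gamma> (real N)" y] xy N by (simp add: f_def)
  qed
  have "\<exists>n\<le>N. f n \<in> {r - 1/2..r + 1/2}"
    using side'
  proof
    assume "\<tau> x < r - 1/2 \<and> r + 1/2 < \<tau> y"
    then show ?thesis using step_function_hits_unit_interval[of f r N] f0 step last by auto
  next
    assume *: "\<tau> y < r - 1/2 \<and> r + 1/2 < \<tau> x"
    \<comment> \<open>Now \<open>y\<close> is on the lower side; reverse the geodesic that \<open>h\<close> is dual to.\<close>
    have "\<exists>n\<le>N. - f n \<in> {- r - 1/2..- r + 1/2}"
    proof (rule step_function_hits_unit_interval)
      show "- f 0 < - r - 1/2" using f0 * by simp
      show "- r - 1/2 \<le> - f N" using last * by linarith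
      show "\<bar>- f (Suc n) - - f n\<bar> \<le> 1" if "n < N" for n using step[OF that] by linarith
    qed
    then show ?thesis by (force simp: algebra_simps)
  qed
  then obtain n where n: "n \<le> N" "f n \<in> {r - 1/2..r + 1/2}" by blast
  have "real n \<le> real N" using n by simp
  then have "\<gamma> (real n) \<in> X" using \<gamma>X N by auto
  then have "\<gamma> (real n) \<in> h"
    using n \<tau> pp[OF rI] unfolding h f_def by blast
  then show ?thesis using n unfolding N_def by blast
qed

lemma chain_disjoint:
  assumes "curtain_chain X d c" "h \<in> c" "h' \<in> c" "h \<noteq> h'"
  shows "h \<inter> h' = {}"
proof -
  obtain J :: "int set" and f where f: "c = f ` J" "disjoint_family_on f J"
    using assms(1) unfolding curtain_chain_def by blast
  obtain i k where "i \<in> J" "k \<in> J" "h = f i" "h' = f k" using assms(2,3) f(1) by blast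
  moreover have "i \<noteq> k" using calculation assms(4) by blast
  ultimately show ?thesis using disjoint_family_onD[OF f(2)] by blast
qed

lemma disjoint_sets_with_representatives:
  fixes P :: "'b set"
  assumes "finite P" "\<And>h h'. h \<in> c \<Longrightarrow> h' \<in> c \<Longrightarrow> h \<noteq> h' \<Longrightarrow> h \<inter> h' = {}"
    and "\<And>h. h \<in> c \<Longrightarrow> h \<inter> P \<noteq> {}"
  shows "finite c" "card c \<le> card P"
proof -
  define f where "f h = (SOME p. p \<in> h \<inter> P)" for h
  have f: "f h \<in> h" "f h \<in> P" if "h \<in> c" for h
  proof -
    have "\<exists>p. p \<in> h \<inter> P" using assms(3)[OF that] by blast
    then have "f h \<in> h \<inter> P" unfolding f_def by (rule someI_ex)
    then show "f h \<in> h" "f h \<in> P" by simp_all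
  qed
  have "inj_on f c"
  proof (rule inj_onI, rule ccontr)
    fix h h' assume "h \<in> c" "h' \<in> c" "f h = f h'" "h \<noteq> h'"
    then have "f h \<in> h" "f h \<in> h'" "h \<inter> h' = {}" using f(1)[of h] f(1)[of h'] assms(2)[of h h'] by simp_all
    then show False by blast
  qed
  moreover have "f ` c \<subseteq> P" using f by blast
  ultimately show "finite c" "card c \<le> card P"
    using assms(1) by (auto intro: inj_on_finite card_inj_on_le)
qed

text \<open>The curtains of the chain are disjoint and each contains one of the points
\<open>\<gamma> 0, \<dots>, \<gamma> \<lfloor>d x y\<rfloor>\<close> of the geodesic from \<open>x\<close> to \<open>y\<close>.\<close>

lemma separating_chain_card:
  assumes "curtain_chain X d c" "chain_separates X d c {x} {y}" "x \<in> X" "y \<in> X"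
  shows "finite c" "real (card c) \<le> d x y + 1"
proof -
  obtain \<gamma> where \<gamma>: "geodesic_on X d {0..d x y} \<gamma>" "\<gamma> 0 = x" "\<gamma> (d x y) = y"
    using geodesic_through_between_points[OF CN assms(3,4)] .
  let ?N = "nat \<lfloor>d x y\<rfloor>"
  let ?P = "(\<lambda>n. \<gamma> (real n)) ` {..?N}"
  have meet: "h \<inter> ?P \<noteq> {}" if "h \<in> c" for h
  proof -
    have "separates X d h {x} {y}" using assms(2) that by (simp add: chain_separates_def)
    then obtain n where "n \<le> ?N" "\<gamma> (real n) \<in> h"
      using curtain_meets_integer_point assms(3,4) \<gamma> by blast
    then show ?thesis by blast
  qed
  have *: "finite c \<and> card c \<le> card ?P"
    using disjoint_sets_with_representatives[of ?P c] chain_disjoint[OF assms(1)] meet by blast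
  have "card ?P \<le> card {..?N}" by (rule card_image_le) simp
  then have "card c \<le> ?N + 1" using * by simp
  then have "real (card c) \<le> real ?N + 1" by linarith
  moreover have "real ?N \<le> d x y" using nonneg[of x y] by linarith
  ultimately show "finite c" "real (card c) \<le> d x y + 1" using * by linarith+
qed

lemma empty_chain: "L_chain X d L {} \<and> chain_separates X d {} {x} {y}"
  unfolding L_chain_def chain_separates_def curtain_chain_def
  by (auto intro!: exI[of _ "{}"] simp: disjoint_family_on_def)

lemma chain_cards_finite:
  assumes "x \<in> X" "y \<in> X"
  shows "finite {card c |c. L_chain X d L c \<and> chain_separates X d c {x} {y}}"
proof (rule finite_subset)
  show "{card c |c. L_chain X d L c \<and> chain_separates X d c {x} {y}} \<subseteq> {..nat \<lfloor>d x y + 1\<rfloor>}"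
  proof (rule subsetI)
    fix k assume "k \<in> {card c |c. L_chain X d L c \<and> chain_separates X d c {x} {y}}"
    then obtain c where k: "k = card c" and "L_chain X d L c" "chain_separates X d c {x} {y}" by blast
    then have "real (card c) \<le> d x y + 1"
      using separating_chain_card assms by (auto simp: L_chain_def)
    then have "card c \<le> nat \<lfloor>d x y + 1\<rfloor>" by (rule le_nat_floor)
    then show "k \<in> {..nat \<lfloor>d x y + 1\<rfloor>}" unfolding k by (rule iffD2[OF atMost_iff])
  qed
qed simp

text \<open>Since the cardinalities form a finite set, \<^const>\<open>Max\<close> is their maximum in the definition of
\<^const>\<open>dist_L\<close>, and one chain is enough for a lower bound.\<close>

lemma dist_L_ge:
  assumes "x \<in> X" "y \<in> X" "x \<noteq> y" "L_chain X d L c" "chain_separates X d c {x} {y}"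
  shows "1 + real (card c) \<le> dist_L X d L x y"
proof -
  have "card c \<le> Max {card c |c. L_chain X d L c \<and> chain_separates X d c {x} {y}}"
    using assms by (intro Max_ge chain_cards_finite) auto
  then show ?thesis using assms by (simp add: dist_L_def)
qed

lemma dist_L_le:
  assumes "x \<in> X" "y \<in> X" "0 \<le> B"
    and "\<And>c. L_chain X d L c \<Longrightarrow> chain_separates X d c {x} {y} \<Longrightarrow> real (card c) \<le> B"
  shows "dist_L X d L x y \<le> 1 + B"
proof (cases "x = y")
  case False
  let ?A = "{card c |c. L_chain X d L c \<and> chain_separates X d c {x} {y}}"
  have "?A \<noteq> {}" using empty_chain by blast
  then have "Max ?A \<in> ?A" using chain_cards_finite assms by (intro Max_in) auto
  then have "real (Max ?A) \<le> B" using assms(4) by auto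
  then show ?thesis using False by (simp add: dist_L_def)
qed (use assms in \<open>simp add: dist_L_def\<close>)

lemma dist_L_nonneg: "0 \<le> dist_L X d L x y"
  by (simp add: dist_L_def)

lemma dist_L_le_dist:
  assumes "x \<in> X" "y \<in> X"
  shows "dist_L X d L x y \<le> 2 + d x y"
  using dist_L_le[of x y "d x y + 1" L] separating_chain_card(2) assms nonneg[of x y]
  by (auto simp: L_chain_def)

text \<open>Without summability \<^const>\<open>infsum\<close> would be \<open>0\<close>; the bound on the lengths of chains makes
\<^const>\<open>dist_L\<close> bounded in \<open>L\<close>.\<close>

lemma curtain_dist_summable:
  assumes "\<And>L. 1 \<le> L \<Longrightarrow> 0 \<le> lam L" "lam summable_on {1::nat..}" "x \<in> X" "y \<in> X"
  shows "(\<lambda>L. lam L * dist_L X d L x y) summable_on {1..}"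
proof (rule summable_on_comparison_test)
  show "(\<lambda>L. lam L * (2 + d x y)) summable_on {1..}"
    using assms(2) by (intro summable_on_cmult_left)
  fix L :: nat assume "L \<in> {1..}"
  then have "0 \<le> lam L" using assms by simp
  then show "lam L * dist_L X d L x y \<le> lam L * (2 + d x y)" "0 \<le> lam L * dist_L X d L x y"
    using dist_L_le_dist assms dist_L_nonneg by (auto intro!: mult_left_mono)
qed

lemma curtain_dist_le:
  assumes "\<And>L. 1 \<le> L \<Longrightarrow> 0 \<le> lam L" "lam summable_on {1::nat..}" "x \<in> X" "y \<in> X"
    and "\<And>L. dist_L X d L x y \<le> B"
  shows "curtain_dist lam X d x y \<le> (\<Sum>\<^sub>\<infinity>L\<in>{1..}. lam L) * B"
proof -
  have "curtain_dist lam X d x y \<le> (\<Sum>\<^sub>\<infinity>L\<in>{1..}. lam L * B)"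
    unfolding curtain_dist_def
  proof (rule infsum_mono)
    show "(\<lambda>L. lam L * B) summable_on {1..}" using assms(2) by (intro summable_on_cmult_left)
  qed (use assms curtain_dist_summable[of lam x y] in \<open>auto intro!: mult_left_mono\<close>)
  also have "\<dots> = (\<Sum>\<^sub>\<infinity>L\<in>{1..}. lam L) * B"
    using assms(2) by (intro infsum_cmult_left) auto
  finally show ?thesis .
qed

lemma curtain_dist_ge:
  assumes "\<And>L. 1 \<le> L \<Longrightarrow> 0 \<le> lam L" "lam summable_on {1::nat..}" "x \<in> X" "y \<in> X" "1 \<le> L"
  shows "lam L * dist_L X d L x y \<le> curtain_dist lam X d x y"
proof -
  have "(\<Sum>\<^sub>\<infinity>L\<in>{L}. lam L * dist_L X d L x y) \<le> curtain_dist lam X d x y"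
    unfolding curtain_dist_def
    using assms dist_L_nonneg by (intro infsum_mono_neutral curtain_dist_summable) auto
  then show ?thesis by simp
qed

section \<open>Chains dual to a geodesic\<close>

lemma curtain_dual:
  assumes "geodesic_on X d I \<alpha>" "{r - 1/2..r + 1/2} \<subseteq> interior I"
  shows "curtain X d (proj_preimage X d I \<alpha> {r - 1/2..r + 1/2})"
  using assms unfolding curtain_def curtain_halfspaces_def by blast

lemma curtains_dual_chain:
  fixes J :: "int set" and r :: "int \<Rightarrow> real"
  assumes geo: "geodesic_on X d I \<alpha>" and J: "\<And>i k. i \<in> J \<Longrightarrow> k \<in> J \<Longrightarrow> {i..k} \<subseteq> J"
    and int: "\<And>i. i \<in> J \<Longrightarrow> {r i - 1/2..r i + 1/2} \<subseteq> interior I"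
    and gap: "\<And>i k. i \<in> J \<Longrightarrow> k \<in> J \<Longrightarrow> i < k \<Longrightarrow> r i + 1 < r k"
  defines "h \<equiv> (\<lambda>i. proj_preimage X d I \<alpha> {r i - 1/2..r i + 1/2})"
  shows "curtain_chain X d (h ` J)" and "disjoint_family_on h J"
proof -
  have sub: "{r i - 1/2..r i + 1/2} \<subseteq> I" and ne: "I \<noteq> {}" if "i \<in> J" for i
    using interval_interior[OF int[OF that]] by auto
  have mono: "proj_preimage X d I \<alpha> T \<subseteq> proj_preimage X d I \<alpha> T'" if "T \<subseteq> T'" for T T'
    using that by (auto simp: proj_preimage_def)
  have lt: "h i \<inter> h k = {}" if ik: "i \<in> J" "k \<in> J" "i < k" for i k
  proof (rule ccontr)
    assume "h i \<inter> h k \<noteq> {}"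
    then obtain u where u: "u \<in> h i" "u \<in> h k" by blast
    obtain s t where "u \<in> X" "s \<in> {r i - 1/2..r i + 1/2}" "is_foot d I \<alpha> u s"
      "t \<in> {r k - 1/2..r k + 1/2}" "is_foot d I \<alpha> u t"
      using u proj_preimage_foot[OF CN geo ne[OF ik(1)] sub[OF ik(1)]]
        proj_preimage_foot[OF CN geo ne[OF ik(1)] sub[OF ik(2)]] unfolding h_def by blast
    moreover have "s = t" using foot_unique[OF CN geo ne[OF ik(1)]] calculation by metis
    ultimately show False using gap[OF ik] by auto
  qed
  show disj: "disjoint_family_on h J"
    unfolding disjoint_family_on_def
  proof (intro ballI impI)
    fix i k assume "i \<in> J" "k \<in> J" "i \<noteq> k"
    then show "h i \<inter> h k = {}" using lt[of i k] lt[of k i] by (cases "i < k") auto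
  qed
  have sep: "separates X d (h i) (h (i - 1)) (h (i + 1))" if i: "i - 1 \<in> J" "i \<in> J" "i + 1 \<in> J" for i
  proof -
    have "h (i - 1) \<subseteq> proj_preimage X d I \<alpha> (I \<inter> {..<r i - 1/2})"
      unfolding h_def
    proof (rule mono)
      show "{r (i - 1) - 1/2..r (i - 1) + 1/2} \<subseteq> I \<inter> {..<r i - 1/2}"
        using sub[OF i(1)] gap[OF i(1,2)] by auto
    qed
    moreover have "h (i + 1) \<subseteq> proj_preimage X d I \<alpha> (I \<inter> {r i + 1/2<..})"
      unfolding h_def
    proof (rule mono)
      show "{r (i + 1) - 1/2..r (i + 1) + 1/2} \<subseteq> I \<inter> {r i + 1/2<..}"
        using sub[OF i(3)] gap[OF i(2,3)] by auto
    qed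
    moreover have "curtain_halfspaces X d (h i) (proj_preimage X d I \<alpha> (I \<inter> {..<r i - 1/2}))
        (proj_preimage X d I \<alpha> (I \<inter> {r i + 1/2<..}))"
      using geo int[OF i(2)] unfolding curtain_halfspaces_def h_def by blast
    ultimately show ?thesis unfolding separates_def by blast
  qed
  show "curtain_chain X d (h ` J)"
    unfolding curtain_chain_def
  proof (intro exI[of _ J] exI[of _ h] conjI)
    show "\<forall>i\<in>J. \<forall>k\<in>J. {i..k} \<subseteq> J" using J by blast
    show "\<forall>i\<in>J. curtain X d (h i)" using curtain_dual[OF geo int] unfolding h_def by blast
    show "\<forall>i. i - 1 \<in> J \<and> i \<in> J \<and> i + 1 \<in> J \<longrightarrow> separates X d (h i) (h (i - 1)) (h (i + 1))"
      using sep by blast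
  qed (use disj in auto)
qed

lemma foot_of_geodesic_point:
  assumes geo: "geodesic_on X d I \<alpha>" and "t \<in> I"
  shows "is_foot d I \<alpha> (\<alpha> t) t"
proof -
  have ne: "I \<noteq> {}" using assms by blast
  have "d (\<alpha> t) (\<alpha> t) = 0" using geodesic_dist[OF CN geo ne assms(2) assms(2)] by simp
  then show ?thesis using assms nonneg by (simp add: is_foot_def[OF CN geo ne])
qed

end

section \<open>Rays with hinges\<close>

context
  fixes X :: "'a set" and d
  assumes CN: "stewart_space X d"
begin

interpretation Metric_space X d
  using CN by (simp add: stewart_space_def)

text \<open>Geodesics are unique, so a point between two points of a geodesic lies on it.\<close>

lemma aligned_on_geodesic:
  assumes geo: "geodesic_on X d I \<alpha>" and st: "s \<in> I" "t \<in> I"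
    and q: "q \<in> X" "aligned d (\<alpha> s) q (\<alpha> t)"
  shows "\<exists>w. min s t \<le> w \<and> w \<le> max s t \<and> w \<in> I \<and> q = \<alpha> w"
proof -
  have ne: "I \<noteq> {}" using st by blast
  note gd = geodesic_dist[OF CN geo ne] and gX = geodesic_in[OF CN geo ne]
  define \<delta> where "\<delta> = d (\<alpha> s) q"
  have sum: "\<delta> + d q (\<alpha> t) = \<bar>s - t\<bar>"
    using q(2) gd[OF st] unfolding \<delta>_def aligned_def by simp
  have \<delta>: "0 \<le> \<delta>" "\<delta> \<le> \<bar>s - t\<bar>" "d q (\<alpha> t) = \<bar>s - t\<bar> - \<delta>"
    using sum nonneg[of q "\<alpha> t"] nonneg[of "\<alpha> s" q] \<delta>_def by linarith+
  define w where "w = (if s \<le> t then s + \<delta> else s - \<delta>)"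
  have w: "min s t \<le> w" "w \<le> max s t" "\<bar>s - w\<bar> = \<delta>" "\<bar>w - t\<bar> = \<bar>s - t\<bar> - \<delta>"
    using \<delta> by (auto simp: w_def)
  have wI: "w \<in> I" using geo st w(1,2) unfolding geodesic_on_def is_interval_1
    by (metis max_def min_def)
  have "q = \<alpha> w"
  proof (rule between_unique[OF CN gX[OF st(1)] gX[OF st(2)] q(1) gX[OF wI] q(2)])
    show "aligned d (\<alpha> s) (\<alpha> w) (\<alpha> t)" "d (\<alpha> s) (\<alpha> w) = d (\<alpha> s) q"
      using gd[OF st(1) wI] gd[OF wI st(2)] gd[OF st] w \<delta> by (simp_all add: aligned_def \<delta>_def)
  qed
  then show ?thesis using w wI by blast
qed

text \<open>Here \<open>idx\<close> stands for the number of the block that a point belongs to, and \<open>p n\<close> for the hinge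
between block \<open>n\<close> and block \<open>n + 1\<close>.  From \<open>x\<close> one can go inside \<open>k\<close> along three geodesics to \<open>y\<close>: to the foot of \<open>x\<close>, along the
core segment, and from the foot of \<open>y\<close> to \<open>y\<close>.  The block number increases by at least \<open>4\<close> on the way; so one of the three
geodesics skips a block and contains a hinge.\<close>

lemma curtain_contains_hinge:
  fixes idx :: "'a \<Rightarrow> nat" and p :: "nat \<Rightarrow> 'a"
  assumes k: "curtain X d k" and pX: "\<And>n. p n \<in> X"
    and hinge: "\<And>u v n. u \<in> X \<Longrightarrow> v \<in> X \<Longrightarrow> idx u \<le> n \<Longrightarrow> n + 2 \<le> idx v \<Longrightarrow> aligned d u (p n) v"
    and xy: "x \<in> k" "y \<in> k" "idx x + 4 \<le> idx y"
  shows "k \<inter> {p (idx x), p (idx x + 1), p (idx x + 2)} \<noteq> {}"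
proof -
  let ?i = "idx x"
  obtain I \<beta> r where geo: "geodesic_on X d I \<beta>" and r: "{r - 1/2..r + 1/2} \<subseteq> interior I"
    and k_eq: "k = proj_preimage X d I \<beta> {r - 1/2..r + 1/2}"
    using k unfolding curtain_def curtain_halfspaces_def by auto
  have rI: "{r - 1/2..r + 1/2} \<subseteq> I" and ne: "I \<noteq> {}" using interval_interior[OF CN r] by auto
  have k_iff: "u \<in> k \<longleftrightarrow> u \<in> X \<and> (\<exists>t\<in>{r - 1/2..r + 1/2}. is_foot d I \<beta> u t)" for u
    unfolding k_eq by (rule proj_preimage_foot[OF CN geo ne rI])
  obtain s where x: "x \<in> X" "s \<in> {r - 1/2..r + 1/2}" "is_foot d I \<beta> x s" using xy k_iff by blast
  obtain t where y: "y \<in> X" "t \<in> {r - 1/2..r + 1/2}" "is_foot d I \<beta> y t" using xy k_iff by blast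
  have st: "s \<in> I" "t \<in> I" using x y rI by auto
  have \<beta>X: "\<beta> s \<in> X" "\<beta> t \<in> X" using geodesic_in[OF CN geo ne] st by auto
  \<comment> \<open>\<open>k\<close> contains the geodesic from each of its points to the core segment, and the core segment.\<close>
  have leg: "q \<in> k" if "q \<in> X" "aligned d u q (\<beta> w)" "u \<in> X" "w \<in> {r - 1/2..r + 1/2}" "is_foot d I \<beta> u w"
    for u w q
    using foot_between[OF CN geo ne that(3,1,5,2)] that k_iff by blast
  have core: "q \<in> k" if q: "q \<in> X" "aligned d (\<beta> s) q (\<beta> t)" for q
  proof -
    obtain w where w: "min s t \<le> w" "w \<le> max s t" "w \<in> I" "q = \<beta> w"
      using aligned_on_geodesic[OF geo st q] by blast
    then have "w \<in> {r - 1/2..r + 1/2}" using x(2) y(2) by auto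
    then show ?thesis using foot_of_geodesic_point[OF CN geo w(3)] w(4) q k_iff by blast
  qed
  have "p ?i \<in> k \<or> p (?i + 1) \<in> k \<or> p (?i + 2) \<in> k"
  proof (cases "?i + 2 \<le> idx (\<beta> s)")
    case True
    then have "aligned d x (p ?i) (\<beta> s)" using hinge[of x "\<beta> s" ?i] x \<beta>X by simp
    then show ?thesis using leg[OF pX _ x(1,2,3)] by blast
  next
    case s: False
    show ?thesis
    proof (cases "?i + 3 \<le> idx (\<beta> t)")
      case True
      then have "aligned d (\<beta> s) (p (?i + 1)) (\<beta> t)" using hinge[of "\<beta> s" "\<beta> t" "?i + 1"] s \<beta>X by simp
      then show ?thesis using core[OF pX] by blast
    next
      case False
      then have "aligned d (\<beta> t) (p (?i + 2)) y" using hinge[of "\<beta> t" y "?i + 2"] xy(3) y \<beta>X by simp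
      then have "aligned d y (p (?i + 2)) (\<beta> t)" by (simp add: aligned_def commute)
      then show ?thesis using leg[OF pX _ y(1,2,3)] by blast
    qed
  qed
  then show ?thesis by blast
qed

text \<open>Curtains dual to the ray \<open>\<alpha>\<close> inside every fourth block are \<open>3\<close>-separated: each curtain that
meets two of them contains one of the three hinges of the preceding lemma, and disjoint curtains contain
different hinges.\<close>

lemma hinged_ray_long_chain:
  fixes idx :: "'a \<Rightarrow> nat" and p :: "nat \<Rightarrow> 'a" and r :: "nat \<Rightarrow> real"
  assumes geo: "geodesic_on X d {0..} \<alpha>" and pX: "\<And>n. p n \<in> X"
    and hinge: "\<And>u v n. u \<in> X \<Longrightarrow> v \<in> X \<Longrightarrow> idx u \<le> n \<Longrightarrow> n + 2 \<le> idx v \<Longrightarrow> aligned d u (p n) v"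
    and r0: "1/2 < r 0" and rinc: "\<And>i j. i < j \<Longrightarrow> r i + 1 < r j"
    and foot: "\<And>u t j. u \<in> X \<Longrightarrow> is_foot d {0..} \<alpha> u t \<Longrightarrow> t \<in> {r j - 1/2..r j + 1/2} \<Longrightarrow> idx u = j"
  shows "1 + real N \<le> dist_L X d 3 (\<alpha> 0) (\<alpha> (r (4 * N)))"
proof (cases "N = 0")
  case True
  have "\<alpha> 0 \<noteq> \<alpha> (r 0)" using geodesic_inj[OF CN geo, of 0 "r 0"] r0 by auto
  then show ?thesis using True by (simp add: dist_L_def)
next
  case False
  define J where "J = {0..<int N}"
  define q where "q i = r (4 * nat i)" for i
  define h where "h = (\<lambda>i. proj_preimage X d {0..} \<alpha> {q i - 1/2..q i + 1/2})"
  have qinc: "q i + 1 < q j" if "0 \<le> i" "i < j" for i j unfolding q_def using rinc that by simp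
  have q0: "1/2 < q i" if "0 \<le> i" for i
    using qinc[of 0 i] r0 that by (cases "i = 0") (auto simp: q_def)
  have int: "{q i - 1/2..q i + 1/2} \<subseteq> interior {0..}" if "i \<in> J" for i
    using q0[of i] that by (auto simp: J_def interior_real_atLeast)
  have qI: "{q i - 1/2..q i + 1/2} \<subseteq> {0..}" if "i \<in> J" for i
    using int[OF that] interior_subset by blast
  have chain: "curtain_chain X d (h ` J)" "disjoint_family_on h J"
    unfolding h_def
    by (rule curtains_dual_chain[OF CN geo _ int]; use qinc in \<open>auto simp: J_def\<close>)+
  have h_iff: "u \<in> h i \<longleftrightarrow> u \<in> X \<and> (\<exists>t\<in>{q i - 1/2..q i + 1/2}. is_foot d {0..} \<alpha> u t)" if "i \<in> J" for u i
    unfolding h_def by (rule proj_preimage_foot[OF CN geo _ qI[OF that]]) simp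
  have idx_h: "idx u = 4 * nat i" if "u \<in> h i" "i \<in> J" for u i
    using that h_iff foot unfolding q_def by blast
  have \<alpha>_foot: "is_foot d {0..} \<alpha> (\<alpha> t) t" "\<alpha> t \<in> X" if "0 \<le> t" for t
    using foot_of_geodesic_point[OF CN geo, of t] geodesic_in[OF CN geo, of t] that by auto
  have h_ne: "\<alpha> (q i) \<in> h i" if "i \<in> J" for i
    using \<alpha>_foot[of "q i"] q0[of i] h_iff[OF that, of "\<alpha> (q i)"] that by (force simp: J_def)
  have inj: "inj_on h J"
  proof (rule inj_onI, rule ccontr)
    fix i j assume "i \<in> J" "j \<in> J" "h i = h j" "i \<noteq> j"
    then show False using h_ne[of i] disjoint_family_onD[OF chain(2), of i j] by auto
  qed
  have Lsep: "L_separated X d 3 (h i) (h j)" if ij: "i \<in> J" "j \<in> J" "i \<noteq> j" for i j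
    unfolding L_separated_def
  proof (intro conjI allI impI)
    show "curtain X d (h i)" "curtain X d (h j)"
      unfolding h_def using curtain_dual[OF CN geo int] ij by blast+
    show "h i \<inter> h j = {}" using disjoint_family_onD[OF chain(2)] ij by blast
    fix c assume c: "curtain_chain X d c \<and> (\<forall>k\<in>c. k \<inter> h i \<noteq> {} \<and> k \<inter> h j \<noteq> {})"
    \<comment> \<open>The block that contains the first of the two curtains.\<close>
    let ?m = "4 * nat (min i j)"
    let ?P = "{p ?m, p (?m + 1), p (?m + 2)}"
    have lt: "4 * nat (min i j) + 4 \<le> 4 * nat (max i j)" using ij by (auto simp: J_def)
    have "k \<inter> ?P \<noteq> {}" if k: "k \<in> c" for k
    proof -
      have cur: "curtain X d k" using c k unfolding curtain_chain_def by blast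
      have "k \<inter> h (min i j) \<noteq> {}" "k \<inter> h (max i j) \<noteq> {}" using c k by (auto simp: min_def max_def)
      then obtain x y where x: "x \<in> k" "x \<in> h (min i j)" and y: "y \<in> k" "y \<in> h (max i j)" by blast
      have "idx x = ?m" "idx y = 4 * nat (max i j)"
        using idx_h x y ij by (auto simp: min_def max_def)
      then show ?thesis
        using curtain_contains_hinge[where idx = idx and p = p, OF cur pX hinge x(1) y(1)] lt by auto
    qed
    then have "finite c \<and> card c \<le> card ?P"
      using disjoint_sets_with_representatives[OF CN, of ?P c] chain_disjoint[OF CN] c by blast
    moreover have "card ?P \<le> 3" by (simp add: card_insert_if)
    ultimately show "finite c" "card c \<le> 3" by auto
  qed
  have "L_chain X d 3 (h ` J)"
    unfolding L_chain_def pairwise_def using chain(1) Lsep by auto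
  moreover have "chain_separates X d (h ` J) {\<alpha> 0} {\<alpha> (r (4 * N))}"
    unfolding chain_separates_def
  proof
    fix k assume "k \<in> h ` J"
    then obtain i where i: "i \<in> J" "k = h i" by blast
    have lt: "q i + 1 < r (4 * N)" using rinc[of "4 * nat i" "4 * N"] i by (auto simp: q_def J_def)
    have pos: "1/2 < q i" using q0 i by (auto simp: J_def)
    have "\<alpha> 0 \<in> proj_preimage X d {0..} \<alpha> ({0..} \<inter> {..<q i - 1/2})"
      using proj_preimage_foot[OF CN geo, of "{0..} \<inter> {..<q i - 1/2}" "\<alpha> 0"] \<alpha>_foot[of 0] pos by force
    moreover have "\<alpha> (r (4 * N)) \<in> proj_preimage X d {0..} \<alpha> ({0..} \<inter> {q i + 1/2<..})"
      using proj_preimage_foot[OF CN geo, of "{0..} \<inter> {q i + 1/2<..}" "\<alpha> (r (4 * N))"] \<alpha>_foot[of "r (4 * N)"] pos lt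
      by force
    ultimately show "separates X d k {\<alpha> 0} {\<alpha> (r (4 * N))}"
      unfolding separates_def curtain_halfspaces_def i(2) h_def using geo int[OF i(1)] by blast
  qed
  moreover have "card (h ` J) = N" using inj by (simp add: card_image J_def)
  moreover have "0 < r (4 * N)" using q0[of "int N"] by (simp add: q_def)
  moreover have "\<alpha> 0 \<noteq> \<alpha> (r (4 * N))"
    using geodesic_inj[OF CN geo, of 0 "r (4 * N)"] calculation(4) by auto
  ultimately show ?thesis
    using dist_L_ge[OF CN, of "\<alpha> 0" "\<alpha> (r (4 * N))" 3 "h ` J"] \<alpha>_foot by auto
qed

section \<open>Curtains in a half-plane\<close>

text \<open>The distances from two points at distance \<open>1\<close> determine the inner product with their
difference, and here the remaining component vanishes.\<close>

lemma line_from_two_distances: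
  fixes P Q W :: "'b::real_inner"
  assumes "dist P Q = 1" "dist W P = \<bar>s\<bar>" "dist W Q = \<bar>s - 1\<bar>"
  shows "W = P + s *\<^sub>R (Q - P)"
proof -
  define v u where "v = W - P" and "u = Q - P"
  have uu: "u \<bullet> u = 1" using assms(1) by (simp add: u_def dist_norm norm_minus_commute flip: power2_norm_eq_inner)
  have vv: "v \<bullet> v = s\<^sup>2" using assms(2) by (simp add: v_def dist_norm flip: power2_norm_eq_inner)
  have "W - Q = v - u" by (simp add: v_def u_def)
  then have "(v - u) \<bullet> (v - u) = (s - 1)\<^sup>2"
    using assms(3) by (simp add: dist_norm flip: power2_norm_eq_inner)
  then have "v \<bullet> u = s"
    using uu vv by (simp add: inner_diff_left inner_diff_right inner_commute power2_eq_square algebra_simps)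
  then have "(v - s *\<^sub>R u) \<bullet> (v - s *\<^sub>R u) = 0"
    using uu vv by (simp add: inner_diff_left inner_diff_right inner_commute power2_eq_square algebra_simps)
  then have "v - s *\<^sub>R u = 0" by simp
  then show ?thesis by (simp add: v_def u_def algebra_simps)
qed

lemma dist_to_line:
  fixes w b u :: "'b::real_inner"
  assumes "norm u = 1"
  shows "dist w (b + ((w - b) \<bullet> u) *\<^sub>R u) \<le> dist w (b + t *\<^sub>R u)"
proof (rule power2_le_imp_le)
  have uu: "u \<bullet> u = 1" using assms by (simp flip: power2_norm_eq_inner)
  have eq: "(dist w (b + s *\<^sub>R u))\<^sup>2 = (w - b) \<bullet> (w - b) - 2 * s * ((w - b) \<bullet> u) + s\<^sup>2" for s
  proof -
    have "(dist w (b + s *\<^sub>R u))\<^sup>2 = ((w - b) - s *\<^sub>R u) \<bullet> ((w - b) - s *\<^sub>R u)"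
      by (simp add: dist_norm power2_norm_eq_inner algebra_simps)
    then show ?thesis
      unfolding inner_diff_left[of "w - b" "s *\<^sub>R u"] inner_diff_right[of _ "w - b" "s *\<^sub>R u"]
      using uu by (simp add: inner_commute power2_eq_square algebra_simps)
  qed
  have "0 \<le> (t - (w - b) \<bullet> u)\<^sup>2" by simp
  then show "(dist w (b + ((w - b) \<bullet> u) *\<^sub>R u))\<^sup>2 \<le> (dist w (b + t *\<^sub>R u))\<^sup>2"
    unfolding eq by (simp add: power2_eq_square algebra_simps)
qed simp

context
  fixes e :: "complex \<Rightarrow> 'a"
  assumes eX: "\<And>w. 0 \<le> Im w \<Longrightarrow> e w \<in> X"
    and e_dist: "\<And>v w. 0 \<le> Im v \<Longrightarrow> 0 \<le> Im w \<Longrightarrow> d (e v) (e w) = dist v w"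
    and e_wedge: "\<And>w z. 0 \<le> Im w \<Longrightarrow> z \<in> X \<Longrightarrow> z \<notin> e ` {w. 0 \<le> Im w} \<Longrightarrow> aligned d (e w) (e 0) z"
begin

abbreviation "half_plane \<equiv> e ` {w. 0 \<le> Im w}"

text \<open>The core segment of \<open>h\<close> avoids the wedge point.  It is contained in the half-plane: a
point of the half-plane sees what is outside only through the wedge point, so if some point of the core were outside then the wedge
point would have a foot on the same side of the core as \<open>x\<close>, and likewise one on the side of \<open>y\<close>.  Therefore the core is a
unit segment of the half-plane, and the points of the half-plane that project to it orthogonally have their feet on it: if a part of the
geodesic is outside, then the wedge point is on the geodesic and not farther from them than that part.\<close>

lemma separating_curtain_contains_strip:
  assumes sep: "separates X d h {x} {y}" and xy: "x \<in> half_plane" "y \<in> half_plane" and o: "e 0 \<notin> h"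
  shows "\<exists>b u. 0 \<le> Im b \<and> norm u = 1 \<and> (\<forall>w. 0 \<le> Im w \<longrightarrow> \<bar>(w - b) \<bullet> u\<bar> \<le> 1/2 \<longrightarrow> e w \<in> h)"
proof -
  obtain I \<beta> r where geo: "geodesic_on X d I \<beta>" and r: "{r - 1/2..r + 1/2} \<subseteq> interior I"
    and h: "h = proj_preimage X d I \<beta> {r - 1/2..r + 1/2}"
    and side: "x \<in> proj_preimage X d I \<beta> (I \<inter> {..<r - 1/2}) \<and> y \<in> proj_preimage X d I \<beta> (I \<inter> {r + 1/2<..}) \<or>
      y \<in> proj_preimage X d I \<beta> (I \<inter> {..<r - 1/2}) \<and> x \<in> proj_preimage X d I \<beta> (I \<inter> {r + 1/2<..})"
    using sep unfolding separates_def curtain_halfspaces_def by auto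
  let ?S = "{r - 1/2..r + 1/2}"
  have rI: "?S \<subseteq> I" and ne: "I \<noteq> {}" using interval_interior[OF CN r] by auto
  note pp = proj_preimage_foot[OF CN geo ne]
  note foot_def = is_foot_def[OF CN geo ne]
  have \<beta>X: "\<beta> t \<in> X" if "t \<in> I" for t using geodesic_in[OF CN geo ne that] .
  have h_iff: "z \<in> h \<longleftrightarrow> z \<in> X \<and> (\<exists>t\<in>?S. is_foot d I \<beta> z t)" for z unfolding h by (rule pp[OF rI])
  have oX: "e 0 \<in> X" by (rule eX) simp
  have o_foot: "t \<notin> ?S" if "is_foot d I \<beta> (e 0) t" for t using that o oX h_iff by blast
  obtain z1 t1 z2 t2 where z1: "z1 \<in> half_plane" "is_foot d I \<beta> z1 t1" "t1 < r - 1/2"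
    and z2: "z2 \<in> half_plane" "is_foot d I \<beta> z2 t2" "r + 1/2 < t2"
  proof -
    have "\<exists>z1 t1 z2 t2. z1 \<in> half_plane \<and> is_foot d I \<beta> z1 t1 \<and> t1 < r - 1/2 \<and>
       z2 \<in> half_plane \<and> is_foot d I \<beta> z2 t2 \<and> r + 1/2 < t2"
      using side xy pp[of "I \<inter> {..<r - 1/2}"] pp[of "I \<inter> {r + 1/2<..}"] by auto
    then show ?thesis using that by blast
  qed
  have cross: "\<exists>w. min t t0 \<le> w \<and> w \<le> max t t0 \<and> w \<in> I \<and> e 0 = \<beta> w"
    if t: "t \<in> I" "t0 \<in> I" "\<beta> t \<in> half_plane" "\<beta> t0 \<notin> half_plane" for t t0
  proof -
    obtain v where "0 \<le> Im v" "\<beta> t = e v" using t(3) by blast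
    then have "aligned d (\<beta> t) (e 0) (\<beta> t0)" using e_wedge t \<beta>X by metis
    then show ?thesis using aligned_on_geodesic[OF geo t(1,2) oX] by blast
  qed
  have o_side: "\<exists>t'. is_foot d I \<beta> (e 0) t' \<and> (t' = t \<or> min t t0 \<le> t' \<and> t' \<le> max t t0)"
    if z: "z \<in> half_plane" "is_foot d I \<beta> z t" and t0: "t0 \<in> I" "\<beta> t0 \<notin> half_plane" for z t t0
  proof -
    have t: "t \<in> I" using z by (simp add: foot_def)
    show ?thesis
    proof (cases "\<beta> t \<in> half_plane")
      case True
      obtain t' where t': "min t t0 \<le> t'" "t' \<le> max t t0" "t' \<in> I" "e 0 = \<beta> t'"
        using cross[OF t t0(1) True t0(2)] by blast
      then have "is_foot d I \<beta> (e 0) t'" using foot_of_geodesic_point[OF CN geo t'(3)] by simp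
      then show ?thesis using t' by blast
    next
      case False
      obtain v where v: "0 \<le> Im v" "z = e v" using z by auto
      have zX: "z \<in> X" using v eX by blast
      have al: "aligned d z (e 0) (\<beta> t)" using e_wedge[OF v(1) \<beta>X[OF t] False] v by simp
      have "is_foot d I \<beta> (e 0) t"
        unfolding foot_def
      proof (intro conjI ballI)
        fix s assume s: "s \<in> I"
        have "d z (\<beta> t) \<le> d z (\<beta> s)" using z(2) s by (simp add: foot_def)
        then show "d (e 0) (\<beta> t) \<le> d (e 0) (\<beta> s)"
          using al triangle[OF zX oX \<beta>X[OF s]] by (simp add: aligned_def)
      qed (rule t)
      then show ?thesis by blast
    qed
  qed
  \<comment> \<open>Otherwise the wedge point would have feet on both sides of the core segment.\<close>
  have core: "\<beta> t \<in> half_plane" if t: "t \<in> ?S" for t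
  proof (rule ccontr)
    assume n: "\<beta> t \<notin> half_plane"
    have tI: "t \<in> I" using t rI by blast
    obtain s1 where s1: "is_foot d I \<beta> (e 0) s1" "s1 = t1 \<or> min t1 t \<le> s1 \<and> s1 \<le> max t1 t"
      using o_side[OF z1(1,2) tI n] by blast
    obtain s2 where s2: "is_foot d I \<beta> (e 0) s2" "s2 = t2 \<or> min t2 t \<le> s2 \<and> s2 \<le> max t2 t"
      using o_side[OF z2(1,2) tI n] by blast
    have "s1 = s2" using foot_unique[OF CN geo ne oX] s1 s2 by blast
    then show False using o_foot[OF s1(1)] s1(2) s2(2) z1(3) z2(3) t by (auto simp: min_def max_def split: if_splits)
  qed
  have "r - 1/2 \<in> ?S" "r + 1/2 \<in> ?S" by auto
  then obtain P Q where P: "0 \<le> Im P" "\<beta> (r - 1/2) = e P" and Q: "0 \<le> Im Q" "\<beta> (r + 1/2) = e Q"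
    using core by (metis (no_types, lifting) image_iff mem_Collect_eq)
  have PI: "r - 1/2 \<in> I" "r + 1/2 \<in> I" using rI by auto
  note gd = geodesic_dist[OF CN geo ne]
  have PQ: "dist P Q = 1" using e_dist[OF P(1) Q(1)] gd[OF PI] P Q by simp
  define u where "u = Q - P"
  define b where "b = P + (1/2) *\<^sub>R u"
  have u: "norm u = 1" using PQ by (simp add: u_def dist_norm norm_minus_commute)
  have line: "W = b + (t - r) *\<^sub>R u" if t: "t \<in> I" "0 \<le> Im W" "\<beta> t = e W" for t W
  proof -
    have "dist W P = \<bar>t - (r - 1/2)\<bar>" "dist W Q = \<bar>t - (r - 1/2) - 1\<bar>"
      using e_dist[OF t(2) P(1)] e_dist[OF t(2) Q(1)] gd[OF t(1) PI(1)] gd[OF t(1) PI(2)] t P Q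
      by (simp_all add: algebra_simps)
    then have "W = P + (t - (r - 1/2)) *\<^sub>R u"
      unfolding u_def using line_from_two_distances[OF PQ] by blast
    then show ?thesis by (simp add: b_def algebra_simps flip: scaleR_add_left)
  qed
  have "Im b \<ge> 0" using P Q by (simp add: b_def u_def field_simps)
  moreover have "e w \<in> h" if w: "0 \<le> Im w" "\<bar>(w - b) \<bullet> u\<bar> \<le> 1/2" for w
  proof -
    define \<tau> where "\<tau> = (w - b) \<bullet> u"
    have "\<bar>\<tau>\<bar> \<le> 1/2" using w by (simp add: \<tau>_def)
    then have \<tau>S: "r + \<tau> \<in> ?S" unfolding atLeastAtMost_iff by linarith
    then have \<tau>I: "r + \<tau> \<in> I" using rI by blast
    obtain W where W: "0 \<le> Im W" "\<beta> (r + \<tau>) = e W" using core[OF \<tau>S] by auto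
    have W_eq: "W = b + \<tau> *\<^sub>R u" using line[OF \<tau>I W] by simp
    have near: "d (e w) (e W) \<le> d (e w) (\<beta> t)" if t: "t \<in> I" "\<beta> t \<in> half_plane" for t
    proof -
      obtain V where V: "0 \<le> Im V" "\<beta> t = e V" using t by auto
      have "dist w W \<le> dist w V"
        using dist_to_line[OF u, of w b "t - r"] line[OF t(1) V] unfolding W_eq \<tau>_def by simp
      then show ?thesis using e_dist w V W by simp
    qed
    have "is_foot d I \<beta> (e w) (r + \<tau>)"
      unfolding foot_def
    proof (intro conjI ballI \<tau>I)
      fix s assume s: "s \<in> I"
      show "d (e w) (\<beta> (r + \<tau>)) \<le> d (e w) (\<beta> s)"
      proof (cases "\<beta> s \<in> half_plane")
        case True
        then show ?thesis using near[OF s] W by simp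
      next
        case False
        obtain t' where t': "t' \<in> I" "e 0 = \<beta> t'" using cross[OF \<tau>I s core[OF \<tau>S] False] by blast
        have "\<beta> t' \<in> half_plane" unfolding t'(2)[symmetric] by (rule imageI) simp
        then have "d (e w) (e W) \<le> d (e w) (e 0)" using near[OF t'(1)] t'(2) by simp
        also have "\<dots> \<le> d (e w) (\<beta> s)"
          using e_wedge[OF w(1) \<beta>X[OF s] False] nonneg[of "e 0" "\<beta> s"] unfolding aligned_def by linarith
        finally show ?thesis using W by simp
      qed
    qed
    then show ?thesis using h_iff eX w \<tau>S by blast
  qed
  ultimately show ?thesis using u by blast
qed

lemma infinite_crossing_chain:
  fixes J :: "int set" and r :: "int \<Rightarrow> real"
  assumes geo: "geodesic_on X d I \<alpha>" and J: "\<And>i k. i \<in> J \<Longrightarrow> k \<in> J \<Longrightarrow> {i..k} \<subseteq> J" "infinite J"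
    and int: "\<And>i. i \<in> J \<Longrightarrow> {r i - 1/2..r i + 1/2} \<subseteq> interior I"
    and gap: "\<And>i k. i \<in> J \<Longrightarrow> k \<in> J \<Longrightarrow> i < k \<Longrightarrow> r i + 1 < r k"
    and x: "\<And>i. i \<in> J \<Longrightarrow> \<exists>x\<in>h. x \<in> X \<and> is_foot d I \<alpha> x (r i)"
    and y: "\<And>i. i \<in> J \<Longrightarrow> \<exists>y\<in>h'. y \<in> X \<and> is_foot d I \<alpha> y (r i)"
  shows "\<not> L_separated X d L h h'"
proof
  assume L: "L_separated X d L h h'"
  define k where "k = (\<lambda>i. proj_preimage X d I \<alpha> {r i - 1/2..r i + 1/2})"
  have chain: "curtain_chain X d (k ` J)" "disjoint_family_on k J"
    unfolding k_def by (rule curtains_dual_chain[OF CN geo J(1) int gap]; assumption)+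
  have k: "z \<in> k i" if "i \<in> J" "z \<in> X" "is_foot d I \<alpha> z (r i)" for i z
  proof -
    have "{r i - 1/2..r i + 1/2} \<subseteq> I" "I \<noteq> {}" using interval_interior[OF CN int[OF that(1)]] by auto
    then show ?thesis
      unfolding k_def using proj_preimage_foot[OF CN geo] that by force
  qed
  have meet: "k i \<inter> h \<noteq> {}" "k i \<inter> h' \<noteq> {}" if "i \<in> J" for i
    using x[OF that] y[OF that] k[OF that] by blast+
  have "inj_on k J"
  proof (rule inj_onI, rule ccontr)
    fix i j assume "i \<in> J" "j \<in> J" "k i = k j" "i \<noteq> j"
    then show False using meet[of i] disjoint_family_onD[OF chain(2), of i j] by auto
  qed
  then have "infinite (k ` J)" using J(2) finite_imageD by blast
  moreover have "\<forall>l\<in>k ` J. l \<inter> h \<noteq> {} \<and> l \<inter> h' \<noteq> {}" using meet by blast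
  ultimately show False using L chain(1) unfolding L_separated_def by blast
qed

text \<open>A strip whose direction is not that of the boundary reaches every height, so two such strips are
crossed by all strips parallel to the boundary, that is, by the curtains dual to a ray orthogonal to the boundary.
Two strips parallel to the boundary are crossed by the curtains dual to the boundary line.  Two strips of
different kind intersect.\<close>

lemma half_plane_strips_not_L_separated:
  assumes b: "0 \<le> Im b" "norm u = 1" "\<And>w. 0 \<le> Im w \<Longrightarrow> \<bar>(w - b) \<bullet> u\<bar> \<le> 1/2 \<Longrightarrow> e w \<in> h"
    and b': "0 \<le> Im b'" "norm u' = 1" "\<And>w. 0 \<le> Im w \<Longrightarrow> \<bar>(w - b') \<bullet> u'\<bar> \<le> 1/2 \<Longrightarrow> e w \<in> h'"
  shows "\<not> L_separated X d L h h'"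
proof
  assume L: "L_separated X d L h h'"
  then have disj: "h \<inter> h' = {}" by (simp add: L_separated_def)
  have all_heights: "\<exists>x. \<bar>(Complex x y - c) \<bullet> v\<bar> \<le> 1/2" if "Re v \<noteq> 0" for c v :: complex and y
    using that by (intro exI[of _ "Re c - (y - Im c) * Im v / Re v"]) (simp add: inner_complex_def field_simps)
  have horizontal: "\<bar>(Complex x (Im c) - c) \<bullet> v\<bar> \<le> 1/2" if "Re v = 0" for c v :: complex and x
    using that by (simp add: inner_complex_def)
  consider "Re u \<noteq> 0" "Re u' \<noteq> 0" | "Re u = 0" "Re u' = 0" | "Re u = 0" "Re u' \<noteq> 0" | "Re u \<noteq> 0" "Re u' = 0"
    by blast
  then show False
  proof cases
    case 1
    let ?\<alpha> = "\<lambda>t. e (Complex 0 t)"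
    have geo: "geodesic_on X d {0..} ?\<alpha>"
      unfolding geodesic_on_def using eX e_dist by (auto simp: is_interval_ci dist_complex_def complex_diff cmod_def)
    have foot: "is_foot d {0..} ?\<alpha> (e (Complex x t)) t" if "0 \<le> t" for x t
      unfolding is_foot_def[OF CN geo, simplified]
      using that e_dist by (auto simp: dist_complex_def complex_diff cmod_def)
    have meet: "\<exists>z\<in>k. z \<in> X \<and> is_foot d {0..} ?\<alpha> z t"
      if t: "0 \<le> t" and v: "Re v \<noteq> 0" and k: "\<And>w. 0 \<le> Im w \<Longrightarrow> \<bar>(w - c) \<bullet> v\<bar> \<le> 1/2 \<Longrightarrow> e w \<in> k" for t v c k
    proof -
      obtain x where "\<bar>(Complex x t - c) \<bullet> v\<bar> \<le> 1/2" using all_heights[OF v] by blast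
      then show ?thesis using k[of "Complex x t"] t foot eX[of "Complex x t"] by auto
    qed
    have "\<not> L_separated X d L h h'"
    proof (rule infinite_crossing_chain[OF geo, of "{0..}" "\<lambda>i. 2 * real_of_int i + 1"])
      show "infinite {0::int..}" by (rule infinite_Ici)
      show "\<exists>z\<in>h. z \<in> X \<and> is_foot d {0..} ?\<alpha> z (2 * real_of_int i + 1)" if "i \<in> {0..}" for i
        using meet[OF _ 1(1) b(3)] that by auto
      show "\<exists>z\<in>h'. z \<in> X \<and> is_foot d {0..} ?\<alpha> z (2 * real_of_int i + 1)" if "i \<in> {0..}" for i
        using meet[OF _ 1(2) b'(3)] that by auto
    qed (auto simp: interior_real_atLeast)
    then show False using L by blast
  next
    case 2
    let ?\<alpha> = "\<lambda>t. e (Complex t 0)"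
    have geo: "geodesic_on X d UNIV ?\<alpha>"
      unfolding geodesic_on_def using eX e_dist by (auto simp: dist_complex_def complex_diff cmod_def)
    have foot: "is_foot d UNIV ?\<alpha> (e (Complex t y)) t" if "0 \<le> y" for y t
      unfolding is_foot_def[OF CN geo, simplified]
      using that e_dist by (auto simp: dist_complex_def complex_diff cmod_def)
    have meet: "\<exists>z\<in>k. z \<in> X \<and> is_foot d UNIV ?\<alpha> z t"
      if "0 \<le> Im c" "Re v = 0" "\<And>w. 0 \<le> Im w \<Longrightarrow> \<bar>(w - c) \<bullet> v\<bar> \<le> 1/2 \<Longrightarrow> e w \<in> k" for t v c k
      using that(3)[of "Complex t (Im c)"] horizontal[OF that(2), of t c] that(1) foot eX[of "Complex t (Im c)"] by auto
    have "\<not> L_separated X d L h h'"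
    proof (rule infinite_crossing_chain[OF geo, of UNIV "\<lambda>i. 2 * real_of_int i"])
      show "infinite (UNIV :: int set)" by (rule infinite_UNIV_int)
      show "\<exists>z\<in>h. z \<in> X \<and> is_foot d UNIV ?\<alpha> z (2 * real_of_int i)" for i
        using meet[OF b(1) 2(1) b(3)] by auto
      show "\<exists>z\<in>h'. z \<in> X \<and> is_foot d UNIV ?\<alpha> z (2 * real_of_int i)" for i
        using meet[OF b'(1) 2(2) b'(3)] by auto
    qed auto
    then show False using L by blast
  next
    case 3
    obtain x where x: "\<bar>(Complex x (Im b) - b') \<bullet> u'\<bar> \<le> 1/2" using all_heights[OF 3(2)] by blast
    have "e (Complex x (Im b)) \<in> h" using b(3)[of "Complex x (Im b)"] horizontal[OF 3(1), of x b] b(1) by simp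
    moreover have "e (Complex x (Im b)) \<in> h'" using b'(3)[of "Complex x (Im b)"] x b(1) by simp
    ultimately show False using disj by blast
  next
    case 4
    obtain x where x: "\<bar>(Complex x (Im b') - b) \<bullet> u\<bar> \<le> 1/2" using all_heights[OF 4(1)] by blast
    have "e (Complex x (Im b')) \<in> h'" using b'(3)[of "Complex x (Im b')"] horizontal[OF 4(2), of x b'] b'(1) by simp
    moreover have "e (Complex x (Im b')) \<in> h" using b(3)[of "Complex x (Im b')"] x b'(1) by simp
    ultimately show False using disj by blast
  qed
qed

text \<open>A chain contains at most one curtain through the wedge point, and of the others at most one
since no two of them are \<open>L\<close>-separated.\<close>

lemma half_plane_dist_L_bounded:
  assumes "x \<in> half_plane" "y \<in> half_plane"
  shows "dist_L X d L x y \<le> 3"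
proof -
  have xy: "x \<in> X" "y \<in> X" using assms eX by auto
  have "real (card c) \<le> 2" if c: "L_chain X d L c" "chain_separates X d c {x} {y}" for c
  proof -
    have ch: "curtain_chain X d c" and pw: "pairwise (L_separated X d L) c"
      using c by (auto simp: L_chain_def)
    have fin: "finite c" using separating_chain_card[OF CN ch c(2) xy] by blast
    let ?c0 = "{h\<in>c. e 0 \<in> h}" and ?c1 = "{h\<in>c. e 0 \<notin> h}"
    have "card ?c0 \<le> card {e 0}"
      by (rule disjoint_sets_with_representatives(2)[OF CN])
        (use chain_disjoint[OF CN ch] in auto)
    moreover have "card ?c1 \<le> 1"
    proof -
      have "h = h'" if h: "h \<in> ?c1" "h' \<in> ?c1" for h h'
      proof (rule ccontr)
        assume "h \<noteq> h'"
        then have L: "L_separated X d L h h'" using pw h unfolding pairwise_def by blast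
        have "separates X d h {x} {y}" "separates X d h' {x} {y}"
          using c(2) h by (auto simp: chain_separates_def)
        then obtain b u b' u' where
          "0 \<le> Im b" "norm u = 1" "\<And>w. 0 \<le> Im w \<Longrightarrow> \<bar>(w - b) \<bullet> u\<bar> \<le> 1/2 \<Longrightarrow> e w \<in> h"
          "0 \<le> Im b'" "norm u' = 1" "\<And>w. 0 \<le> Im w \<Longrightarrow> \<bar>(w - b') \<bullet> u'\<bar> \<le> 1/2 \<Longrightarrow> e w \<in> h'"
          using separating_curtain_contains_strip[OF _ assms, of h]
            separating_curtain_contains_strip[OF _ assms, of h'] h by auto
        then show False using half_plane_strips_not_L_separated[of b u h b' u' h' L] L by blast
      qed
      then show ?thesis using fin by (auto simp: card_le_Suc0_iff_eq)
    qed
    moreover have "card c = card ?c0 + card ?c1"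
      using fin by (subst card_Un_disjoint[symmetric]) (auto intro: arg_cong[where f = card])
    ultimately show ?thesis by simp
  qed
  then have "dist_L X d L x y \<le> 1 + 2" using dist_L_le[OF CN xy, of 2 L] by simp
  then show ?thesis by simp
qed

end

end

section \<open>Folding a half-plane around a hinge\<close>

text \<open>Two half-planes are glued along a ray, the gate, which starts at the hinge \<open>0\<close> and has direction
\<open>\<epsilon> = \<plusminus>1\<close> in the real axis.  A geodesic from \<open>m\<close> that bends at the hinge is straightened by
continuing it in the direction \<open>opposite \<epsilon> m\<close>.  For \<open>m = 0\<close> any direction is straight; \<open>- \<epsilon>\<close> is the one that
continues the edge of the other half-plane.\<close>

definition opposite :: "real \<Rightarrow> complex \<Rightarrow> complex" where
  "opposite \<epsilon> m = (if m = 0 then of_real (- \<epsilon>) else - sgn m)"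

text \<open>For \<open>m\<close> in the upper and \<open>q\<close> in the lower closed half-plane: the segment from \<open>m\<close> to \<open>q\<close> misses
the gate, so that \<open>q\<close> is seen from \<open>m\<close> only through the hinge.  The cross product does not decide this if both points are on
the real axis; the second disjunct takes care of those \<open>m\<close> from which all of the lower half-plane is hidden.\<close>

definition hidden :: "real \<Rightarrow> complex \<Rightarrow> complex \<Rightarrow> bool" where
  "hidden \<epsilon> m q \<longleftrightarrow> \<epsilon> * (Im q * Re m - Re q * Im m) > 0 \<or> (Im m = 0 \<and> \<epsilon> * Re m < 0)"

text \<open>The logarithm map of \<open>m\<close> on the lower half-plane: the visible part is kept, the hidden part is
collapsed radially to a ray.\<close>

definition fold_plane :: "real \<Rightarrow> complex \<Rightarrow> complex \<Rightarrow> complex" where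
  "fold_plane \<epsilon> m q = (if hidden \<epsilon> m q then cmod q *\<^sub>R opposite \<epsilon> m else q)"

lemma cmod_scaleR_sgn: "cmod m *\<^sub>R sgn m = m"
  by (cases "m = 0") (simp_all add: sgn_div_norm)

context
  fixes \<epsilon> :: real
  assumes \<epsilon>: "\<epsilon> = 1 \<or> \<epsilon> = -1"
begin

lemma norm_opposite: "cmod (opposite \<epsilon> m) = 1"
  using \<epsilon> by (auto simp: opposite_def norm_sgn)

lemma dist_opposite:
  assumes "0 \<le> r"
  shows "dist m (r *\<^sub>R opposite \<epsilon> m) = cmod m + r"
proof (cases "m = 0")
  case False
  have "m - r *\<^sub>R opposite \<epsilon> m = (cmod m + r) *\<^sub>R sgn m"
    using False cmod_scaleR_sgn[of m] by (simp add: opposite_def scaleR_add_left)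
  then have "cmod (m - r *\<^sub>R opposite \<epsilon> m) = \<bar>cmod m + r\<bar> * cmod (sgn m)"
    by (simp only: norm_scaleR)
  then show ?thesis using False assms by (simp add: dist_norm norm_sgn)
qed (use assms norm_opposite in \<open>simp add: dist_norm\<close>)

lemma dist_fold_plane:
  "dist m (fold_plane \<epsilon> m q) = (if hidden \<epsilon> m q then cmod m + cmod q else dist m q)"
  using dist_opposite[of "cmod q" m] by (simp add: fold_plane_def)

lemma opposite_real:
  assumes "Im m = 0" "m \<noteq> 0"
  shows "opposite \<epsilon> m = of_real (- sgn (Re m))"
proof -
  have "m = of_real (Re m)" using assms by (simp add: complex_eq_iff)
  then have "sgn m = of_real (sgn (Re m))" by (metis sgn_of_real)
  then show ?thesis using assms by (simp add: opposite_def)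
qed

text \<open>Gate points are kept, so the map agrees on the gate with the identity of the upper
half-plane.\<close>

lemma fold_plane_gate:
  assumes "0 \<le> u" "0 \<le> Im m"
  shows "fold_plane \<epsilon> m (of_real (\<epsilon> * u)) = of_real (\<epsilon> * u)"
proof (cases "Im m = 0 \<and> \<epsilon> * Re m < 0")
  case True
  then have "m \<noteq> 0" by auto
  then have "opposite \<epsilon> m = of_real \<epsilon>" using True \<epsilon> opposite_real[of m] by (auto simp: sgn_if)
  then show ?thesis using True \<epsilon> assms by (auto simp: fold_plane_def scaleR_conv_of_real)
next
  case False
  have "0 \<le> u * Im m" using assms by simp
  then have "\<not> hidden \<epsilon> m (of_real (\<epsilon> * u))"
    using False \<epsilon> by (auto simp: hidden_def)
  then show ?thesis by (simp add: fold_plane_def)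
qed

text \<open>The other half of the edge is collapsed to the ray, where the blocks beyond follow.\<close>

lemma fold_plane_away:
  assumes "0 \<le> u" "0 \<le> Im m"
  shows "fold_plane \<epsilon> m (of_real (- \<epsilon> * u)) = u *\<^sub>R opposite \<epsilon> m"
proof (cases "hidden \<epsilon> m (of_real (- \<epsilon> * u))")
  case True
  have "cmod (of_real (- \<epsilon> * u)) = u" using \<epsilon> assms by auto
  then show ?thesis using True by (simp add: fold_plane_def)
next
  case False
  show ?thesis
  proof (cases "u = 0")
    case u: False
    have "\<not> 0 < u * Im m" using False \<epsilon> by (auto simp: hidden_def)
    then have m: "Im m = 0" using assms u by (simp add: zero_less_mult_iff)
    then have "\<not> \<epsilon> * Re m < 0" using False by (simp add: hidden_def)
    then have "opposite \<epsilon> m = of_real (- \<epsilon>)"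
      using \<epsilon> m opposite_real[OF m] by (cases "m = 0") (auto simp: opposite_def sgn_if complex_eq_iff)
    then show ?thesis using False by (simp add: fold_plane_def scaleR_conv_of_real)
  qed (simp add: fold_plane_def)
qed

text \<open>Between a visible and a hidden point the segment meets the line through \<open>m\<close> and the hinge, at
a point of the ray, where keeping and collapsing agree.\<close>

lemma fold_plane_short:
  assumes m: "0 \<le> Im m" and q: "Im q \<le> 0" "Im q' \<le> 0"
  shows "dist (fold_plane \<epsilon> m q) (fold_plane \<epsilon> m q') \<le> dist q q'"
proof -
  have mixed: "dist (fold_plane \<epsilon> m q) (fold_plane \<epsilon> m q') \<le> dist q q'"
    if q: "Im q \<le> 0" "Im q' \<le> 0" and h: "\<not> hidden \<epsilon> m q" "hidden \<epsilon> m q'" for q q'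
  proof -
    define A where "A z = \<epsilon> * (Im z * Re m - Re z * Im m)" for z
    have Aq: "A q \<le> 0" using h(1) by (auto simp: hidden_def A_def)
    have nd: "\<not> (Im m = 0 \<and> \<epsilon> * Re m < 0)" using h(1) by (auto simp: hidden_def)
    then have Aq': "A q' > 0" using h(2) by (auto simp: hidden_def A_def)
    have mpos: "Im m > 0"
    proof (rule ccontr)
      assume "\<not> Im m > 0"
      then have "Im m = 0" using m by simp
      then have "Im q' * (\<epsilon> * Re m) > 0" using Aq' by (simp add: A_def mult.left_commute)
      then show False using nd \<open>Im m = 0\<close> q(2) by (auto simp: zero_less_mult_iff)
    qed
    define \<tau> where "\<tau> = - A q / (A q' - A q)"
    have \<tau>: "0 \<le> \<tau>" "\<tau> \<le> 1" using Aq Aq' by (auto simp: \<tau>_def field_simps)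
    define w where "w = q + \<tau> *\<^sub>R (q' - q)"
    have "A w = A q + \<tau> * (A q' - A q)" by (simp add: A_def w_def algebra_simps)
    then have Aw: "A w = 0" using Aq Aq' by (simp add: \<tau>_def)
    have "Im w = (1 - \<tau>) * Im q + \<tau> * Im q'" by (simp add: w_def algebra_simps)
    then have Imw: "Im w \<le> 0" using \<tau> q by (simp add: mult_nonneg_nonpos add_nonpos_nonpos)
    define \<kappa> where "\<kappa> = Im w / Im m"
    have w_eq: "w = \<kappa> *\<^sub>R m"
      using Aw \<epsilon> mpos by (auto simp: A_def \<kappa>_def complex_eq_iff field_simps)
    have "\<kappa> \<le> 0" using Imw mpos by (simp add: \<kappa>_def divide_nonpos_pos)
    then have "cmod w = - \<kappa> * cmod m" by (simp add: w_eq)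
    moreover have "opposite \<epsilon> m = - sgn m" using mpos by (auto simp: opposite_def)
    moreover have "cmod m *\<^sub>R sgn m = m" by (rule cmod_scaleR_sgn)
    ultimately have w: "w = cmod w *\<^sub>R opposite \<epsilon> m"
      by (metis (no_types, opaque_lifting) w_eq minus_mult_left scaleR_minus_left scaleR_minus_right minus_minus scaleR_scaleR)
    have split: "dist q w + dist w q' = dist q q'"
    proof -
      have "q - w = \<tau> *\<^sub>R (q - q')" "w - q' = (1 - \<tau>) *\<^sub>R (q - q')"
        by (simp_all add: w_def algebra_simps)
      then have "dist q w + dist w q' = \<bar>\<tau>\<bar> * cmod (q - q') + \<bar>1 - \<tau>\<bar> * cmod (q - q')"
        by (simp only: dist_norm norm_scaleR)
      then show ?thesis using \<tau> by (simp add: dist_norm algebra_simps)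
    qed
    have "dist (fold_plane \<epsilon> m q) (fold_plane \<epsilon> m q') = dist q (cmod q' *\<^sub>R opposite \<epsilon> m)"
      using h by (simp add: fold_plane_def)
    also have "\<dots> \<le> dist q w + dist w (cmod q' *\<^sub>R opposite \<epsilon> m)" by (rule dist_triangle)
    also have "dist w (cmod q' *\<^sub>R opposite \<epsilon> m) = \<bar>cmod w - cmod q'\<bar>"
    proof -
      have "w - cmod q' *\<^sub>R opposite \<epsilon> m = (cmod w - cmod q') *\<^sub>R opposite \<epsilon> m"
        by (subst w) (simp add: scaleR_diff_left)
      then show ?thesis by (simp only: dist_norm norm_scaleR norm_opposite mult_1_right)
    qed
    also have "\<dots> \<le> dist w q'" by (simp add: dist_norm norm_triangle_ineq3)
    finally show ?thesis using split by simp
  qed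
  show ?thesis
  proof (cases "hidden \<epsilon> m q = hidden \<epsilon> m q'")
    case True
    have "dist (cmod q *\<^sub>R opposite \<epsilon> m) (cmod q' *\<^sub>R opposite \<epsilon> m) = \<bar>cmod q - cmod q'\<bar>"
      by (simp only: dist_norm norm_scaleR norm_opposite mult_1_right flip: scaleR_diff_left)
    also have "\<dots> \<le> dist q q'" by (simp add: dist_norm norm_triangle_ineq3)
    finally show ?thesis using True by (simp add: fold_plane_def)
  next
    case False
    then show ?thesis using mixed[OF q] mixed[OF q(2,1)] by (auto simp: dist_commute)
  qed
qed

text \<open>The gate is a segment of length \<open>B\<close> here.  The crossing point is a convex combination of \<open>m\<close> and
\<open>q\<close>, so its abscissa does not exceed theirs.\<close>

lemma visible_crosses_gate:
  assumes m: "0 \<le> Im m" and q: "Im q \<le> 0" and vis: "\<not> hidden \<epsilon> m q"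
    and B: "0 \<le> B" "\<epsilon> * Re m \<le> B" "\<epsilon> * Re q \<le> B"
  shows "\<exists>u. 0 \<le> u \<and> u \<le> B \<and> dist m (of_real (\<epsilon> * u)) + dist (of_real (\<epsilon> * u)) q = dist m q"
proof (cases "Im m = 0 \<and> Im q = 0")
  case True
  then have "m = of_real (\<epsilon> * (\<epsilon> * Re m))" "0 \<le> \<epsilon> * Re m"
    using \<epsilon> vis by (auto simp: complex_eq_iff hidden_def)
  then show ?thesis using B by (intro exI[of _ "\<epsilon> * Re m"]) auto
next
  case False
  then have D: "Im m - Im q > 0" using m q by auto
  define \<tau> where "\<tau> = Im m / (Im m - Im q)"
  have \<tau>: "0 \<le> \<tau>" "\<tau> \<le> 1" using m q D by (auto simp: \<tau>_def field_simps)
  define w where "w = m + \<tau> *\<^sub>R (q - m)"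
  define u where "u = \<epsilon> * Re w"
  have "Im w = 0" using D by (simp add: w_def \<tau>_def field_simps)
  then have w: "w = of_real (\<epsilon> * u)" using \<epsilon> by (auto simp: complex_eq_iff u_def)
  have u_eq: "u = (1 - \<tau>) * (\<epsilon> * Re m) + \<tau> * (\<epsilon> * Re q)" by (simp add: u_def w_def algebra_simps)
  have "u * (Im m - Im q) = - (\<epsilon> * (Im q * Re m - Re q * Im m))"
  proof -
    have "\<tau> * (Im m - Im q) = Im m" using D by (simp add: \<tau>_def)
    moreover have "u * (Im m - Im q) = (Im m - Im q - \<tau> * (Im m - Im q)) * (\<epsilon> * Re m)
        + \<tau> * (Im m - Im q) * (\<epsilon> * Re q)"
      by (simp add: u_eq algebra_simps)
    ultimately show ?thesis by (simp add: algebra_simps)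
  qed
  then have "0 \<le> u * (Im m - Im q)" using vis by (auto simp: hidden_def)
  then have "0 \<le> u" using D by (simp add: zero_le_mult_iff)
  moreover have "u \<le> (1 - \<tau>) * B + \<tau> * B"
    unfolding u_eq using \<tau> B by (intro add_mono mult_left_mono) auto
  moreover have "dist m w + dist w q = dist m q"
  proof -
    have "m - w = \<tau> *\<^sub>R (m - q)" "w - q = (1 - \<tau>) *\<^sub>R (m - q)"
      by (simp_all add: w_def algebra_simps)
    then have "dist m w + dist w q = \<bar>\<tau>\<bar> * cmod (m - q) + \<bar>1 - \<tau>\<bar> * cmod (m - q)"
      by (simp only: dist_norm norm_scaleR)
    then show ?thesis using \<tau> by (simp add: dist_norm algebra_simps)
  qed
  ultimately show ?thesis using w by (intro exI[of _ u]) (simp add: algebra_simps)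
qed

end

section \<open>The triangular blocks\<close>

text \<open>The block of size \<open>a\<close> before bending: the part \<open>a \<le> Re z \<le> 2 a\<close> of the sector
\<open>0 \<le> 3 Im z \<le> Re z\<close>.  Its left and right edges become the gates, its lower edge the inner wall.\<close>

definition slab :: "real \<Rightarrow> complex set" where
  "slab a = {z. a \<le> Re z \<and> Re z \<le> 2 * a \<and> 0 \<le> Im z \<and> 3 * Im z \<le> Re z}"

text \<open>The bent block: the triangle with vertices \<open>- a/3\<close>, \<open>5 a/3\<close> and \<open>(1 + \<i>) a/2\<close>.  Its base
carries the inner gate \<open>[- a/3, 0]\<close>, the inner wall \<open>[0, a]\<close> and the outer gate \<open>[a, 5 a/3]\<close>.\<close>

definition base_triangle :: "real \<Rightarrow> complex set" where
  "base_triangle a = {w. 0 \<le> Im w \<and> 5 * Im w - 3 * Re w \<le> a \<and> 3 * Re w + 7 * Im w \<le> 5 * a}"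

text \<open>A piecewise linear homeomorphism from the slab to the triangle.  It is linear on the three triangles that the left,
lower and right edge of the slab form with the midpoint \<open>(3 + \<i>) a/2\<close> of the upper edge, and it maps these
edges isometrically to consecutive segments of the base.\<close>

definition chart :: "real \<Rightarrow> complex \<Rightarrow> complex" where
  "chart a z = Complex (Re z - a - max 0 (Im z - Re z + a) + max 0 (Im z + Re z - 2 * a))
     (min (Im z) (min (Re z - a) (2 * a - Re z)))"

text \<open>The images of the three triangles are the regions \<open>Re w \<le> Im w\<close>, \<open>Im w \<le> Re w \<le> a - Im w\<close> and
\<open>a - Im w \<le> Re w\<close>.\<close>

definition chart_inverse :: "real \<Rightarrow> complex \<Rightarrow> complex" where
  "chart_inverse a w = Complex (a + max (Im w) (min (Re w) (a - Im w)))
     (Im w + max 0 (Im w - Re w) + max 0 (Re w + Im w - a))"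

lemma chart_in_triangle: "z \<in> slab a \<Longrightarrow> chart a z \<in> base_triangle a"
  unfolding slab_def base_triangle_def chart_def by (auto simp: max_def min_def)

lemma chart_inverse_in_slab: "w \<in> base_triangle a \<Longrightarrow> chart_inverse a w \<in> slab a"
  unfolding slab_def base_triangle_def chart_inverse_def by (auto simp: max_def min_def)

lemma chart_chart_inverse: "w \<in> base_triangle a \<Longrightarrow> chart a (chart_inverse a w) = w"
proof -
  assume w: "w \<in> base_triangle a"
  let ?X = "Re w" and ?H = "Im w"
  have H: "0 \<le> ?H" "2 * ?H \<le> a" and t: "5 * ?H - 3 * ?X \<le> a" "3 * ?X + 7 * ?H \<le> 5 * a"
    using w by (auto simp: base_triangle_def)
  consider "?X \<le> ?H" | "?H \<le> ?X" "?X \<le> a - ?H" | "a - ?H \<le> ?X" by linarith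
  then show ?thesis
  proof cases
    case 1
    then have "chart_inverse a w = Complex (a + ?H) (2 * ?H - ?X)" using H by (simp add: chart_inverse_def)
    then show ?thesis using 1 H t by (simp add: chart_def complex_eq_iff)
  next
    case 2
    then have "chart_inverse a w = Complex (a + ?X) ?H" using H by (simp add: chart_inverse_def)
    then show ?thesis using 2 H t by (simp add: chart_def complex_eq_iff)
  next
    case 3
    then have "chart_inverse a w = Complex (2 * a - ?H) (?X + 2 * ?H - a)" using H by (simp add: chart_inverse_def)
    then show ?thesis using 3 H t by (simp add: chart_def complex_eq_iff)
  qed
qed

lemma chart_inverse_chart: "z \<in> slab a \<Longrightarrow> chart_inverse a (chart a z) = z"
  unfolding slab_def chart_inverse_def chart_def by (auto simp: complex_eq_iff max_def min_def)

lemma convex_triangle: "convex (base_triangle a)"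
proof -
  have "base_triangle a = {w. 0 \<le> \<i> \<bullet> w} \<inter> {w. Complex (-3) 5 \<bullet> w \<le> a} \<inter> {w. Complex 3 7 \<bullet> w \<le> 5 * a}"
    unfolding base_triangle_def by (auto simp: inner_complex_def)
  then show ?thesis
    by (simp only:) (intro convex_Int convex_halfspace_le convex_halfspace_ge[unfolded ge_iff_diff_ge_0[symmetric]] convex_halfspace_ge)
qed

lemma complex_lipschitzI:
  fixes v v' z z' :: complex
  assumes "\<bar>Re v - Re v'\<bar> \<le> A * \<bar>Re z - Re z'\<bar> + B * \<bar>Im z - Im z'\<bar>"
    and "\<bar>Im v - Im v'\<bar> \<le> C * \<bar>Re z - Re z'\<bar> + D * \<bar>Im z - Im z'\<bar>"
    and "0 \<le> A" "0 \<le> B" "0 \<le> C" "0 \<le> D" "A + B + C + D \<le> K"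
  shows "dist v v' \<le> K * dist z z'"
proof -
  have z: "\<bar>Re z - Re z'\<bar> \<le> dist z z'" "\<bar>Im z - Im z'\<bar> \<le> dist z z'"
    using abs_Re_le_cmod[of "z - z'"] abs_Im_le_cmod[of "z - z'"] by (simp_all add: dist_norm)
  have "dist v v' \<le> \<bar>Re v - Re v'\<bar> + \<bar>Im v - Im v'\<bar>"
    using cmod_le[of "v - v'"] by (simp add: dist_norm)
  also have "\<dots> \<le> (A * dist z z' + B * dist z z') + (C * dist z z' + D * dist z z')"
    using assms(1,2) mult_left_mono[OF z(1) assms(3)] mult_left_mono[OF z(2) assms(4)]
      mult_left_mono[OF z(1) assms(5)] mult_left_mono[OF z(2) assms(6)] by linarith
  also have "\<dots> = (A + B + C + D) * dist z z'" by (simp add: algebra_simps)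
  also have "\<dots> \<le> K * dist z z'" using assms(7) by (rule mult_right_mono) simp
  finally show ?thesis .
qed

lemma chart_lipschitz: "dist (chart a z) (chart a z') \<le> 10 * dist z z'"
proof (rule complex_lipschitzI)
  show "\<bar>Re (chart a z) - Re (chart a z')\<bar> \<le> 3 * \<bar>Re z - Re z'\<bar> + 2 * \<bar>Im z - Im z'\<bar>"
    unfolding chart_def complex.sel by (auto simp: max_def abs_if)
  show "\<bar>Im (chart a z) - Im (chart a z')\<bar> \<le> 1 * \<bar>Re z - Re z'\<bar> + 1 * \<bar>Im z - Im z'\<bar>"
    unfolding chart_def complex.sel by (auto simp: min_def abs_if)
qed simp_all

lemma chart_inverse_lipschitz: "dist (chart_inverse a w) (chart_inverse a w') \<le> 10 * dist w w'"
proof (rule complex_lipschitzI)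
  show "\<bar>Re (chart_inverse a w) - Re (chart_inverse a w')\<bar> \<le> 1 * \<bar>Re w - Re w'\<bar> + 1 * \<bar>Im w - Im w'\<bar>"
    unfolding chart_inverse_def complex.sel by (auto simp: min_def max_def abs_if)
  show "\<bar>Im (chart_inverse a w) - Im (chart_inverse a w')\<bar> \<le> 2 * \<bar>Re w - Re w'\<bar> + 3 * \<bar>Im w - Im w'\<bar>"
    unfolding chart_inverse_def complex.sel by (auto simp: max_def abs_if)
qed simp_all

lemma chart_inner_wall: "a \<le> s \<Longrightarrow> s \<le> 2 * a \<Longrightarrow> chart a (of_real s) = of_real (s - a)"
  by (simp add: chart_def complex_eq_iff)

lemma chart_inner_gate: "Re z = a \<Longrightarrow> 0 \<le> Im z \<Longrightarrow> 3 * Im z \<le> a \<Longrightarrow> chart a z = of_real (- Im z)"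
  by (simp add: chart_def complex_eq_iff)

lemma chart_outer_gate: "Re z = 2 * a \<Longrightarrow> 0 \<le> Im z \<Longrightarrow> 3 * Im z \<le> 2 * a \<Longrightarrow> chart a z = of_real (a + Im z)"
  by (simp add: chart_def complex_eq_iff)

section \<open>The spiral space\<close>

text \<open>The factor \<open>3\<close> leaves room for a curtain, which has width \<open>1\<close>, in the interior of the
shortest inner wall.\<close>

definition gate :: "nat \<Rightarrow> real" where
  "gate j = 3 * 2 ^ j"

abbreviation block :: "nat \<Rightarrow> complex set" where
  "block j \<equiv> slab (gate j)"

abbreviation block_chart :: "nat \<Rightarrow> complex \<Rightarrow> complex" where
  "block_chart j \<equiv> chart (gate j)"

text \<open>The points of the spiral are those of the sector, so that gates need no identification; only
the metric is that of the bent blocks.\<close>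

definition spiral :: "complex set" where
  "spiral = (\<Union>j. block j)"

inductive chain_path :: "complex \<Rightarrow> complex \<Rightarrow> real \<Rightarrow> bool" where
  chain_path_refl: "x \<in> spiral \<Longrightarrow> chain_path x x 0"
| chain_path_step: "chain_path x y l \<Longrightarrow> y \<in> block j \<Longrightarrow> z \<in> block j \<Longrightarrow> chain_path x z (l + dist (block_chart j y) (block_chart j z))"

text \<open>Outside the carrier the distance is set to \<open>0\<close> since \<^locale>\<open>Metric_space\<close> requires symmetry and
nonnegativity everywhere.\<close>

definition spiral_dist :: "complex \<Rightarrow> complex \<Rightarrow> real" where
  "spiral_dist x y = (if x \<in> spiral \<and> y \<in> spiral then Inf {l. chain_path x y l} else 0)"

text \<open>Such maps do not increase the length of chains, so they bound the distance of the
spiral from below.\<close>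

definition short_on_blocks :: "(complex \<Rightarrow> 'b::metric_space) \<Rightarrow> bool" where
  "short_on_blocks f \<longleftrightarrow> (\<forall>j. \<forall>y\<in>block j. \<forall>z\<in>block j. dist (f y) (f z) \<le> dist (block_chart j y) (block_chart j z))"

lemma gate_Suc [simp]: "gate (Suc j) = 2 * gate j"
  by (simp add: gate_def)

lemma gate_ge [simp]: "3 \<le> gate j"
  by (simp add: gate_def)

lemma double_gate_ge [simp]: "3 \<le> 2 * gate j"
  using gate_ge[of j] by linarith

lemma gate_pos [simp]: "0 < gate j" "0 \<le> gate j"
  by (simp_all add: gate_def)

lemma gate_mono: "i \<le> j \<Longrightarrow> gate i \<le> gate j"
  by (simp add: gate_def)

lemma spiral_iff: "z \<in> spiral \<longleftrightarrow> 3 \<le> Re z \<and> 0 \<le> Im z \<and> 3 * Im z \<le> Re z"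
proof
  assume "z \<in> spiral"
  then obtain j where "z \<in> block j" by (auto simp: spiral_def)
  then show "3 \<le> Re z \<and> 0 \<le> Im z \<and> 3 * Im z \<le> Re z"
    using gate_ge[of j] by (auto simp: slab_def simp del: gate_ge)
next
  assume z: "3 \<le> Re z \<and> 0 \<le> Im z \<and> 3 * Im z \<le> Re z"
  obtain n where "Re z < 2 ^ n" using real_arch_pow[of 2 "Re z"] by auto
  also have "(2::real) ^ n \<le> gate n" by (simp add: gate_def)
  finally have n: "Re z \<le> 2 * gate n" using gate_pos[of n] by linarith
  define j where "j = (LEAST j. Re z \<le> 2 * gate j)"
  have j: "Re z \<le> 2 * gate j" unfolding j_def by (rule LeastI[of _ n]) (rule n)
  have "gate j \<le> Re z"
  proof (cases j)
    case (Suc i)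
    have "\<not> Re z \<le> 2 * gate i" using not_less_Least[of i "\<lambda>j. Re z \<le> 2 * gate j"] Suc unfolding j_def by simp
    then show ?thesis using Suc by simp
  qed (use z in \<open>simp add: gate_def\<close>)
  then have "z \<in> block j" using z j by (simp add: slab_def)
  then show "z \<in> spiral" by (auto simp: spiral_def)
qed

lemma block_overlap:
  assumes "z \<in> block i" "z \<in> block k" "i < k"
  shows "k = Suc i" "Re z = 2 * gate i" "0 \<le> Im z" "3 * Im z \<le> 2 * gate i"
proof -
  have z: "Re z \<le> 2 * gate i" "gate k \<le> Re z" "0 \<le> Im z" "3 * Im z \<le> Re z"
    using assms by (auto simp: slab_def)
  have "\<not> Suc i < k"
  proof
    assume "Suc i < k"
    then have "gate (Suc (Suc i)) \<le> gate k" by (intro gate_mono) simp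
    then show False using z gate_pos[of i] by simp
  qed
  then show k: "k = Suc i" using assms by simp
  show "Re z = 2 * gate i" "0 \<le> Im z" "3 * Im z \<le> 2 * gate i" using z k by auto
qed

lemma outer_gate: "\<lbrakk>Re z = 2 * gate i; 0 \<le> Im z; 3 * Im z \<le> 2 * gate i\<rbrakk> \<Longrightarrow>
    z \<in> block i \<and> z \<in> block (Suc i) \<and> block_chart i z = of_real (gate i + Im z) \<and> block_chart (Suc i) z = of_real (- Im z)"
  using chart_outer_gate[of z "gate i"] chart_inner_gate[of z "gate (Suc i)"] gate_pos[of i]
  by (simp add: slab_def)

lemma block_chart_upper: "z \<in> block j \<Longrightarrow> 0 \<le> Im (block_chart j z)"
  using chart_in_triangle by (simp add: base_triangle_def)

lemma chain_path_props: "chain_path x y l \<Longrightarrow> x \<in> spiral \<and> y \<in> spiral \<and> 0 \<le> l"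
  by (induction rule: chain_path.induct) (auto simp: spiral_def)

lemma chain_path_single:
  assumes "y \<in> block j" "z \<in> block j"
  shows "chain_path y z (dist (block_chart j y) (block_chart j z))"
proof -
  have "y \<in> spiral" using assms by (auto simp: spiral_def)
  then show ?thesis using chain_path_step[OF chain_path_refl, of y j z] assms by simp
qed

lemma chain_path_trans: "chain_path y z l' \<Longrightarrow> chain_path x y l \<Longrightarrow> chain_path x z (l + l')"
proof (induction rule: chain_path.induct)
  case (chain_path_step y z l' j w)
  then show ?case using chain_path.chain_path_step[of x z "l + l'" j w] by (simp add: add.assoc)
qed simp

lemma chain_path_sym: "chain_path x y l \<Longrightarrow> chain_path y x l"
proof (induction rule: chain_path.induct)
  case (chain_path_step x y l j z)
  then show ?case
    using chain_path_trans[of y x l z "dist (block_chart j z) (block_chart j y)"] chain_path_single[of z j y]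
    by (simp add: dist_commute add.commute)
qed (rule chain_path_refl)

lemma chain_path_short: "chain_path x y l \<Longrightarrow> short_on_blocks f \<Longrightarrow> dist (f x) (f y) \<le> l"
proof (induction rule: chain_path.induct)
  case (chain_path_step x y l j z)
  then have "dist (f y) (f z) \<le> dist (block_chart j y) (block_chart j z)" by (auto simp: short_on_blocks_def)
  then show ?case using chain_path_step dist_triangle[of "f x" "f z" "f y"] by linarith
qed simp

text \<open>The Euclidean segment from \<open>x\<close> to \<open>y\<close>, cut at the gates, is a chain.\<close>

lemma euclidean_chain_path_blocks:
  "x \<in> block i \<Longrightarrow> y \<in> block (i + n) \<Longrightarrow> \<exists>l. chain_path x y l \<and> l \<le> 10 * dist x y"
proof (induction n arbitrary: i x)
  case 0
  then show ?case using chain_path_single[of x i y] chart_lipschitz[of "gate i" x y] by auto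
next
  case (Suc n)
  have x: "Re x \<le> 2 * gate i" using Suc.prems by (auto simp: slab_def)
  have "gate (Suc i) \<le> gate (i + Suc n)" by (intro gate_mono) simp
  then have y: "2 * gate i \<le> Re y" using Suc.prems by (auto simp: slab_def)
  have "\<exists>w\<in>closed_segment x y. Re w = 2 * gate i"
  proof (cases "Re x = Re y")
    case True
    then show ?thesis using x y by (intro bexI[of _ x]) auto
  next
    case False
    define t where "t = (2 * gate i - Re x) / (Re y - Re x)"
    have t: "0 \<le> t" "t \<le> 1" "t * (Re y - Re x) = 2 * gate i - Re x"
      using x y False by (auto simp: t_def divide_simps)
    then have "Re (x + t *\<^sub>R (y - x)) = 2 * gate i" by simp
    then have "0 \<le> t" "t \<le> 1" "Re (x + t *\<^sub>R (y - x)) = 2 * gate i" using t by auto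
    then show ?thesis unfolding closed_segment_def
      by (intro bexI[of _ "x + t *\<^sub>R (y - x)"]) (auto intro!: exI[of _ t] simp: algebra_simps)
  qed
  then obtain w where w: "w \<in> closed_segment x y" "Re w = 2 * gate i" by blast
  have xy: "x \<in> spiral" "y \<in> spiral" using Suc.prems unfolding spiral_def by blast+
  have "convex spiral"
  proof -
    have eq: "spiral = {w. 3 \<le> 1 \<bullet> w} \<inter> {w. 0 \<le> \<i> \<bullet> w} \<inter> {w. Complex (-1) 3 \<bullet> w \<le> 0}"
      using spiral_iff by (auto simp: inner_complex_def)
    show ?thesis
      unfolding eq by (intro convex_Int convex_halfspace_le convex_halfspace_ge)
  qed
  then have "w \<in> spiral" using w xy by (meson closed_segment_subset subsetD)
  then have wb: "w \<in> block i" "w \<in> block (Suc i)" using w outer_gate[of w i] by (auto simp: spiral_iff)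
  obtain l where l: "chain_path w y l" "l \<le> 10 * dist w y" using Suc.IH[OF wb(2)] Suc.prems by auto
  have "chain_path x y (dist (block_chart i x) (block_chart i w) + l)"
    using chain_path_trans[OF l(1) chain_path_single[OF Suc.prems(1) wb(1)]] .
  moreover have "dist (block_chart i x) (block_chart i w) \<le> 10 * dist x w" by (rule chart_lipschitz)
  moreover have "dist x y = dist x w + dist w y"
    using w(1) between_mem_segment[of x y w] Line_Segment.between[of x y w] by simp
  ultimately show ?case using l by (intro exI[of _ "dist (block_chart i x) (block_chart i w) + l"]) simp
qed

lemma euclidean_chain_path:
  assumes "x \<in> spiral" "y \<in> spiral"
  shows "\<exists>l. chain_path x y l \<and> l \<le> 10 * dist x y"
proof -
  obtain i k where ik: "x \<in> block i" "y \<in> block k" using assms by (auto simp: spiral_def)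
  show ?thesis
  proof (cases "i \<le> k")
    case True
    then show ?thesis using euclidean_chain_path_blocks[of x i y "k - i"] ik by simp
  next
    case False
    then obtain l where "chain_path y x l" "l \<le> 10 * dist y x"
      using euclidean_chain_path_blocks[of y k x "i - k"] ik by auto
    then show ?thesis using chain_path_sym by (auto simp: dist_commute)
  qed
qed

lemma spiral_dist_le: "chain_path x y l \<Longrightarrow> spiral_dist x y \<le> l"
proof -
  assume l: "chain_path x y l"
  then have "x \<in> spiral" "y \<in> spiral" using chain_path_props by blast+
  moreover have "Inf {l. chain_path x y l} \<le> l"
    using l chain_path_props by (intro cInf_lower bdd_belowI[of _ 0]) auto
  ultimately show ?thesis by (simp add: spiral_dist_def)
qed

lemma spiral_dist_ge:
  assumes "short_on_blocks f" "x \<in> spiral" "y \<in> spiral"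
  shows "dist (f x) (f y) \<le> spiral_dist x y"
proof -
  have "dist (f x) (f y) \<le> Inf {l. chain_path x y l}"
    using euclidean_chain_path[OF assms(2,3)] chain_path_short assms by (intro cInf_greatest) auto
  then show ?thesis using assms by (simp add: spiral_dist_def)
qed

lemma spiral_dist_le_euclidean:
  assumes "x \<in> spiral" "y \<in> spiral"
  shows "spiral_dist x y \<le> 10 * dist x y"
  using euclidean_chain_path[OF assms] spiral_dist_le by fastforce

text \<open>The inverses of the charts are \<open>10\<close>-Lipschitz, so \<open>1/10\<close> of the identity is short on
blocks.\<close>

lemma euclidean_le_spiral_dist:
  assumes "x \<in> spiral" "y \<in> spiral"
  shows "dist x y \<le> 10 * spiral_dist x y"
proof -
  have "short_on_blocks (\<lambda>z. (1/10) *\<^sub>R z)"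
    unfolding short_on_blocks_def
  proof (intro allI ballI)
    fix j y z assume "y \<in> block j" "z \<in> block j"
    then have "dist y z \<le> 10 * dist (block_chart j y) (block_chart j z)"
      using chart_inverse_lipschitz[of "gate j" "block_chart j y" "block_chart j z"] by (simp add: chart_inverse_chart)
    then show "dist ((1/10) *\<^sub>R y) ((1/10) *\<^sub>R z) \<le> dist (block_chart j y) (block_chart j z)"
      by (simp add: dist_norm flip: scaleR_diff_right)
  qed
  from spiral_dist_ge[OF this assms] show ?thesis by (simp add: dist_norm flip: scaleR_diff_right)
qed

section \<open>Distances to the hinges\<close>

definition block_index :: "complex \<Rightarrow> nat" where
  "block_index z = (LEAST j. z \<in> block j)"

text \<open>The end point of the inner wall of block \<open>j\<close>, where block \<open>j + 1\<close> begins.\<close>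

definition hinge :: "nat \<Rightarrow> complex" where
  "hinge j = of_real (2 * gate j)"

text \<open>The distance from \<open>3\<close>, the beginning of the spine: the inner walls before block \<open>j\<close> have total
length \<open>gate j - 3\<close>, and the chart of block \<open>j\<close> has its origin at the hinge before it.\<close>

definition from_base :: "complex \<Rightarrow> real" where
  "from_base z = gate (block_index z) - 3 + cmod (block_chart (block_index z) z)"

text \<open>Up to a constant, the distance from any hinge farther out: the way to it runs through the hinge at
the end of the own block, which the chart maps to \<open>gate j\<close>, and then along inner walls.\<close>

definition from_outside :: "complex \<Rightarrow> real" where
  "from_outside z = cmod (block_chart (block_index z) z - of_real (gate (block_index z))) - (2 * gate (block_index z) - 3)"

lemma block_index_block: "z \<in> spiral \<Longrightarrow> z \<in> block (block_index z)"
  unfolding block_index_def spiral_def by (auto intro: LeastI)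

lemma block_index_le: "z \<in> block j \<Longrightarrow> block_index z \<le> j"
  unfolding block_index_def by (rule Least_le)

lemma block_index_cases:
  assumes "z \<in> block k"
  obtains "block_index z = k" | i where "k = Suc i" "block_index z = i" "Re z = 2 * gate i" "0 \<le> Im z" "3 * Im z \<le> 2 * gate i"
proof -
  have "z \<in> block (block_index z)" using assms by (intro block_index_block) (auto simp: spiral_def)
  then show ?thesis using block_overlap[of z "block_index z" k] block_index_le[OF assms] assms that by (cases "block_index z = k") auto
qed

lemma from_base_block:
  assumes "z \<in> block k"
  shows "from_base z = gate k - 3 + cmod (block_chart k z)"
  using assms
proof (cases rule: block_index_cases)
  case (2 i)
  then show ?thesis using outer_gate[OF 2(3-5)] by (simp add: from_base_def del: of_real_add of_real_minus)
qed (simp add: from_base_def)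

lemma from_outside_block:
  assumes "z \<in> block k"
  shows "from_outside z = cmod (block_chart k z - of_real (gate k)) - (2 * gate k - 3)"
  using assms
proof (cases rule: block_index_cases)
  case (2 i)
  have "block_chart k z - of_real (gate k) = of_real (- Im z - 2 * gate i)"
    using outer_gate[OF 2(3-5)] 2 by simp
  then have "cmod (block_chart k z - of_real (gate k)) = Im z + 2 * gate i"
    using 2 by (simp only: norm_of_real)
  then show ?thesis using outer_gate[OF 2(3-5)] 2 by (simp add: from_outside_def)
qed (simp add: from_outside_def)

lemma hinge_block: "hinge j \<in> block j" "hinge j \<in> block (Suc j)" "block_chart j (hinge j) = of_real (gate j)" "block_chart (Suc j) (hinge j) = 0"
  "hinge j \<in> spiral"
  using outer_gate[of "hinge j" j] by (auto simp: hinge_def spiral_def)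

lemma from_base_hinge: "from_base (hinge j) = 2 * gate j - 3"
  using from_base_block[OF hinge_block(1)[of j]] hinge_block(3)[of j] by simp

lemma from_outside_hinge: "from_outside (hinge j) = 3 - 2 * gate j"
  using from_outside_block[OF hinge_block(1)[of j]] hinge_block(3)[of j] by simp

lemma path_from_hinge_outwards:
  "q \<in> block (Suc j + n) \<Longrightarrow> chain_path (hinge j) q (from_base q - (2 * gate j - 3))"
proof (induction n arbitrary: q)
  case 0
  then have "chain_path (hinge j) q (dist (block_chart (Suc j) (hinge j)) (block_chart (Suc j) q))"
    by (intro chain_path_single hinge_block) auto
  then show ?case using from_base_block[OF 0] hinge_block(4)[of j] by simp
next
  case (Suc n)
  let ?k = "Suc j + n"
  have "chain_path (hinge ?k) q (dist (block_chart (Suc ?k) (hinge ?k)) (block_chart (Suc ?k) q))"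
    using Suc.prems by (intro chain_path_single hinge_block(2)) simp
  from chain_path_trans[OF this Suc.IH[OF hinge_block(1)]] show ?case
    by (rule back_subst[of "chain_path (hinge j) q"])
      (use from_base_block[of q "Suc ?k"] Suc.prems from_base_hinge[of ?k] hinge_block(4)[of ?k] in simp)
qed

lemma path_from_hinge_inwards:
  "q \<in> block k \<Longrightarrow> chain_path (hinge (k + n)) q (from_outside q - (3 - 2 * gate (k + n)))"
proof (induction n arbitrary: q k)
  case 0
  then have "chain_path (hinge k) q (dist (block_chart k (hinge k)) (block_chart k q))"
    by (intro chain_path_single hinge_block) auto
  then show ?case using from_outside_block[OF 0] hinge_block(3)[of k] by (simp add: dist_norm norm_minus_commute)
next
  case (Suc n)
  have "chain_path (hinge k) q (dist (block_chart k (hinge k)) (block_chart k q))"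
    using Suc.prems by (intro chain_path_single hinge_block) simp
  from chain_path_trans[OF this Suc.IH[OF hinge_block(2)]]
  have "chain_path (hinge (Suc k + n)) q
    (from_outside (hinge k) - (3 - 2 * gate (Suc k + n)) + dist (block_chart k (hinge k)) (block_chart k q))" .
  moreover have "from_outside (hinge k) - (3 - 2 * gate (Suc k + n)) + dist (block_chart k (hinge k)) (block_chart k q)
      = from_outside q - (3 - 2 * gate (Suc k + n))"
    using from_outside_block[OF Suc.prems] from_outside_hinge[of k] hinge_block(3)[of k]
    by (simp add: dist_norm norm_minus_commute)
  ultimately show ?case by (simp only: add_Suc add_Suc_right)
qed

section \<open>The logarithm maps\<close>

text \<open>The logarithm map of the point with coordinate \<open>M\<close> in block \<open>j\<close>, restricted to block \<open>k\<close>.  The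
adjacent blocks are developed into the lower half-plane, by a half-turn of their chart about the common hinge, and
then folded.  All blocks beyond are seen through hinges that lie behind each other, so they are
collapsed to a ray.\<close>

definition log_on_block :: "nat \<Rightarrow> complex \<Rightarrow> nat \<Rightarrow> complex \<Rightarrow> complex" where
  "log_on_block j M k q =
    (if k = j then block_chart j q
     else if k = Suc j then of_real (gate j) + fold_plane 1 (M - of_real (gate j)) (- block_chart k q)
     else if j < k then of_real (gate j) + (from_base q - (2 * gate j - 3)) *\<^sub>R opposite 1 (M - of_real (gate j))
     else if Suc k = j then fold_plane (-1) M (of_real (gate k) - block_chart k q)
     else (from_outside q - (3 - gate j)) *\<^sub>R opposite (-1) M)"

definition log_map :: "nat \<Rightarrow> complex \<Rightarrow> complex \<Rightarrow> complex" where
  "log_map j M q = log_on_block j M (block_index q) q"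

text \<open>On the common gate of two blocks both formulas agree; these are \<open>fold_plane_gate\<close> next to block \<open>j\<close> and
\<open>fold_plane_away\<close> one block farther.\<close>

lemma log_map_block:
  assumes q: "q \<in> block k" and M: "0 \<le> Im M"
  shows "log_map j M q = log_on_block j M k q"
  using q
proof (cases rule: block_index_cases)
  case (2 i)
  note g = outer_gate[OF 2(3-5)]
  let ?u = "gate k + Im q"
  have u: "0 \<le> ?u" using 2 gate_pos[of k] by linarith
  have k: "gate k = 2 * gate i" using 2 by simp
  have R: "from_base q = gate k - 3 + Im q"
    using from_base_block[OF q] g 2 by (simp del: of_real_minus)
  have O: "from_outside q = Im q - (gate k - 3)"
    using from_outside_block[of q i] g 2 by simp
  consider "i = j" | "i = Suc j" | "Suc j < i" | "Suc i = j" | "Suc (Suc i) = j" | "Suc (Suc i) < j" by linarith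
  then have "log_on_block j M i q = log_on_block j M k q"
  proof cases
    case 1
    have "- block_chart k q = of_real (1 * Im q)" using g 2 by simp
    then have "fold_plane 1 (M - of_real (gate j)) (- block_chart k q) = of_real (Im q)"
      using fold_plane_gate[of 1 "Im q" "M - of_real (gate j)"] M 2 by simp
    then show ?thesis using 1 2 g by (simp add: log_on_block_def)
  next
    case c: 2
    have "- block_chart i q = of_real (- 1 * (gate i + Im q))" using g by simp
    then have "fold_plane 1 (M - of_real (gate j)) (- block_chart i q) = (gate i + Im q) *\<^sub>R opposite 1 (M - of_real (gate j))"
      using fold_plane_away[of 1 "gate i + Im q" "M - of_real (gate j)"] M 2 gate_pos[of i] by simp
    moreover have "from_base q - (2 * gate j - 3) = gate i + Im q" using R k c by simp
    ultimately show ?thesis using c 2 by (simp add: log_on_block_def)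
  next
    case 3
    then show ?thesis using 2 by (simp add: log_on_block_def)
  next
    case 4
    have "of_real (gate i) - block_chart i q = of_real (- 1 * Im q)" using g by simp
    then have "fold_plane (-1) M (of_real (gate i) - block_chart i q) = of_real (- Im q)"
      using fold_plane_gate[of "-1" "Im q" M] M 2 by simp
    then show ?thesis using 4 2 g by (simp add: log_on_block_def)
  next
    case 5
    have eq: "of_real (gate k) - block_chart k q = of_real (- (- 1) * (gate k + Im q))" using g 2 by simp
    have "fold_plane (-1) M (of_real (gate k) - block_chart k q) = (gate k + Im q) *\<^sub>R opposite (-1) M"
      unfolding eq by (rule fold_plane_away) (use M u in auto)
    moreover have "from_outside q - (3 - gate j) = gate k + Im q" using O k 5 by auto
    ultimately show ?thesis using 5 2 by (simp add: log_on_block_def)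
  next
    case 6
    then show ?thesis using 2 by (simp add: log_on_block_def)
  qed
  then show ?thesis using 2 by (simp add: log_map_def)
qed (simp add: log_map_def)

lemma log_map_short:
  assumes M: "0 \<le> Im M"
  shows "short_on_blocks (log_map j M)"
  unfolding short_on_blocks_def
proof (intro allI ballI)
  fix k y z assume y: "y \<in> block k" and z: "z \<in> block k"
  have Im: "Im (- block_chart k y) \<le> 0" "Im (- block_chart k z) \<le> 0" using block_chart_upper y z by auto
  have radial: "dist (a *\<^sub>R opposite e m) (b *\<^sub>R opposite e m) = \<bar>a - b\<bar>" if "e = 1 \<or> e = -1" for a b e m
    by (simp only: dist_norm norm_scaleR norm_opposite[OF that] mult_1_right flip: scaleR_diff_left)
  have "dist (log_on_block j M k y) (log_on_block j M k z) \<le> dist (block_chart k y) (block_chart k z)"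
  proof -
    consider "k = j" | "k = Suc j" | "Suc j < k" | "Suc k = j" | "Suc k < j" by linarith
    then show ?thesis
    proof cases
      case 1
      then show ?thesis by (simp add: log_on_block_def)
    next
      case 2
      then show ?thesis
        using fold_plane_short[of 1 "M - of_real (gate j)" "- block_chart k y" "- block_chart k z"] M Im
        by (simp add: log_on_block_def dist_norm norm_minus_commute)
    next
      case 3
      have "dist (log_on_block j M k y) (log_on_block j M k z) = \<bar>from_base y - from_base z\<bar>"
        using 3 radial[of 1] by (simp add: log_on_block_def)
      also have "\<dots> \<le> dist (block_chart k y) (block_chart k z)"
        using from_base_block[OF y] from_base_block[OF z] by (simp add: dist_norm norm_triangle_ineq3)
      finally show ?thesis .
    next
      case 4
      then show ?thesis
        using fold_plane_short[of "-1" M "of_real (gate k) - block_chart k y" "of_real (gate k) - block_chart k z"] M Im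
        by (simp add: log_on_block_def dist_norm norm_minus_commute)
    next
      case 5
      have "dist (log_on_block j M k y) (log_on_block j M k z) = \<bar>from_outside y - from_outside z\<bar>"
        using 5 radial[of "-1"] by (simp add: log_on_block_def)
      also have "\<dots> \<le> dist (block_chart k y) (block_chart k z)"
        using from_outside_block[OF y] from_outside_block[OF z]
          norm_triangle_ineq3[of "block_chart k y - of_real (gate k)" "block_chart k z - of_real (gate k)"]
        by (simp add: dist_norm)
      finally show ?thesis .
    qed
  qed
  then show "dist (log_map j M y) (log_map j M z) \<le> dist (block_chart k y) (block_chart k z)"
    using log_map_block[OF y M] log_map_block[OF z M] by simp
qed

text \<open>The chain runs straight to \<open>q\<close> if \<open>q\<close> is visible, the triangles being so flat that a
straight line meets the line of the gate before the gate ends; otherwise it runs along the hinges.\<close>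

lemma log_map_radial:
  assumes m: "m \<in> block j" and q: "q \<in> block k"
  shows "chain_path m q (dist (block_chart j m) (log_on_block j (block_chart j m) k q))"
proof -
  let ?M = "block_chart j m"
  have M: "0 \<le> Im ?M" "?M \<in> base_triangle (gate j)" and Q: "0 \<le> Im (block_chart k q)" "block_chart k q \<in> base_triangle (gate k)"
    using block_chart_upper m q chart_in_triangle by auto
  consider "k = j" | "k = Suc j" | "Suc j < k" | "Suc k = j" | "Suc k < j" by linarith
  then show ?thesis
  proof cases
    case 1
    then show ?thesis using chain_path_single[OF m] q by (simp add: log_on_block_def)
  next
    case 2
    let ?m = "?M - of_real (gate j)"
    have eq: "dist ?M (log_on_block j ?M k q) = dist ?m (fold_plane 1 ?m (- block_chart k q))"
      using 2 by (simp add: log_on_block_def dist_norm algebra_simps)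
    show ?thesis
    proof (cases "hidden 1 ?m (- block_chart k q)")
      case True
      have "chain_path m q (dist ?M (block_chart j (hinge j)) + dist (block_chart k (hinge j)) (block_chart k q))"
      proof (rule chain_path_trans[OF chain_path_single chain_path_single])
        show "hinge j \<in> block k" using 2 hinge_block(2)[of j] by simp
      qed (use m q hinge_block(1) in auto)
      moreover have "dist ?M (block_chart j (hinge j)) = cmod ?m" "dist (block_chart k (hinge j)) (block_chart k q) = cmod (block_chart k q)"
        using 2 hinge_block(3,4)[of j] by (simp_all add: dist_norm)
      ultimately show ?thesis using True eq dist_fold_plane[of 1 ?m "- block_chart k q"] by simp
    next
      case False
      \<comment> \<open>The slanted sides of the two triangles keep both points to the left of the end of the gate.\<close>
      have "3 * Re ?M + 7 * Im ?M \<le> 5 * gate j" "5 * Im (block_chart k q) - 3 * Re (block_chart k q) \<le> 2 * gate j"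
        using M(2) Q(2) 2 by (auto simp: base_triangle_def)
      then have b: "0 \<le> 2 * gate j / 3" "1 * Re ?m \<le> 2 * gate j / 3" "1 * Re (- block_chart k q) \<le> 2 * gate j / 3"
        using M(1) Q(1) by auto
      obtain u where u: "0 \<le> u" "u \<le> 2 * gate j / 3"
        "dist ?m (of_real (1 * u)) + dist (of_real (1 * u)) (- block_chart k q) = dist ?m (- block_chart k q)"
        using visible_crosses_gate[of 1 ?m "- block_chart k q" "2 * gate j / 3"] M(1) Q(1) False b by auto
      define g where "g = Complex (2 * gate j) u"
      have g: "g \<in> block j" "g \<in> block k" "block_chart j g = of_real (gate j + u)" "block_chart k g = of_real (- u)"
        using outer_gate[of g j] u 2 by (auto simp: g_def)
      have "dist ?M (block_chart j g) = dist ?m (of_real (1 * u))"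
        unfolding g by (simp add: dist_norm algebra_simps)
      moreover have "dist (block_chart k g) (block_chart k q) = dist (of_real (1 * u)) (- block_chart k q)"
      proof -
        have "of_real (- u) - block_chart k q = - (of_real (1 * u) - - block_chart k q)" by simp
        then show ?thesis unfolding g by (simp only: dist_norm norm_minus_cancel)
      qed
      ultimately have "dist ?M (block_chart j g) + dist (block_chart k g) (block_chart k q) = dist ?m (- block_chart k q)" using u(3) by simp
      moreover have "chain_path m q (dist ?M (block_chart j g) + dist (block_chart k g) (block_chart k q))"
        using chain_path_trans[OF chain_path_single[OF g(2) q] chain_path_single[OF m g(1)]] .
      ultimately show ?thesis using False eq by (simp add: fold_plane_def)
    qed
  next
    case 3
    let ?m = "?M - of_real (gate j)" and ?r = "from_base q - (2 * gate j - 3)"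
    have p: "chain_path (hinge j) q ?r"
      using path_from_hinge_outwards[of q j "k - Suc j"] q 3 by simp
    then have "0 \<le> ?r" using chain_path_props by blast
    then have "dist ?m (?r *\<^sub>R opposite 1 ?m) = cmod ?m + ?r" by (intro dist_opposite) auto
    moreover have "dist ?M (log_on_block j ?M k q) = dist ?m (?r *\<^sub>R opposite 1 ?m)"
      using 3 by (simp add: log_on_block_def dist_norm algebra_simps)
    moreover have "dist ?M (block_chart j (hinge j)) = cmod ?m" using hinge_block(3)[of j] by (simp add: dist_norm)
    ultimately show ?thesis
      using chain_path_trans[OF p chain_path_single[OF m hinge_block(1)]] by simp
  next
    case 4
    let ?q = "of_real (gate k) - block_chart k q"
    have eq: "dist ?M (log_on_block j ?M k q) = dist ?M (fold_plane (-1) ?M ?q)"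
      using 4 by (simp add: log_on_block_def)
    have j: "gate j = 2 * gate k" using 4 by auto
    show ?thesis
    proof (cases "hidden (-1) ?M ?q")
      case True
      have "chain_path m q (dist ?M (block_chart j (hinge k)) + dist (block_chart k (hinge k)) (block_chart k q))"
      proof (rule chain_path_trans[OF chain_path_single chain_path_single])
        show "hinge k \<in> block j" using 4 hinge_block(2)[of k] by auto
      qed (use m q hinge_block(1) in auto)
      moreover have "dist ?M (block_chart j (hinge k)) = cmod ?M" "dist (block_chart k (hinge k)) (block_chart k q) = cmod ?q"
        using 4 hinge_block(3,4)[of k] by (auto simp: dist_norm)
      ultimately show ?thesis using True eq dist_fold_plane[of "-1" ?M ?q] by simp
    next
      case False
      \<comment> \<open>Likewise to the right of the end of the inner gate.\<close>
      have "5 * Im ?M - 3 * Re ?M \<le> gate j" "3 * Re (block_chart k q) + 7 * Im (block_chart k q) \<le> 5 * gate k"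
        using M(2) Q(2) by (auto simp: base_triangle_def)
      then have b: "0 \<le> gate j / 3" "- 1 * Re ?M \<le> gate j / 3" "- 1 * Re ?q \<le> gate j / 3"
        using M(1) Q(1) j by auto
      obtain u where u: "0 \<le> u" "u \<le> gate j / 3"
        "dist ?M (of_real (- 1 * u)) + dist (of_real (- 1 * u)) ?q = dist ?M ?q"
        using visible_crosses_gate[of "-1" ?M ?q "gate j / 3"] M(1) Q(1) False b by auto
      define g where "g = Complex (2 * gate k) u"
      have g: "g \<in> block k" "g \<in> block j" "block_chart k g = of_real (gate k + u)" "block_chart j g = of_real (- u)"
        using outer_gate[of g k] u 4 j by (auto simp: g_def)
      have "dist ?M (block_chart j g) = dist ?M (of_real (- 1 * u))" unfolding g by simp
      moreover have "dist (block_chart k g) (block_chart k q) = dist (of_real (- 1 * u)) ?q"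
        unfolding g by (simp add: dist_norm norm_minus_commute algebra_simps)
      ultimately have "dist ?M (block_chart j g) + dist (block_chart k g) (block_chart k q) = dist ?M ?q" using u(3) by simp
      moreover have "chain_path m q (dist ?M (block_chart j g) + dist (block_chart k g) (block_chart k q))"
        using chain_path_trans[OF chain_path_single[OF g(1) q] chain_path_single[OF m g(2)]] .
      ultimately show ?thesis using False eq by (simp add: fold_plane_def)
    qed
  next
    case 5
    then obtain i where i: "j = Suc i" "k < i" by (metis Suc_lessE)
    let ?r = "from_outside q - (3 - gate j)"
    have p: "chain_path (hinge i) q ?r"
      using path_from_hinge_inwards[of q k "i - k"] q i by simp
    then have "0 \<le> ?r" using chain_path_props by blast
    then have "dist ?M (?r *\<^sub>R opposite (-1) ?M) = cmod ?M + ?r" by (intro dist_opposite) auto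
    moreover have "dist ?M (log_on_block j ?M k q) = dist ?M (?r *\<^sub>R opposite (-1) ?M)"
      using 5 by (simp add: log_on_block_def)
    moreover have "dist ?M (block_chart j (hinge i)) = cmod ?M" using hinge_block(4)[of i] i by simp
    ultimately show ?thesis
      using chain_path_trans[OF p chain_path_single[OF m]] hinge_block(2)[of i] i by simp
  qed
qed

text \<open>The logarithm map bounds the distance from below, being short on blocks, and the chain of the
same length bounds it from above.\<close>

lemma spiral_dist_log:
  assumes m: "m \<in> block j" and q: "q \<in> block k"
  shows "spiral_dist m q = dist (block_chart j m) (log_on_block j (block_chart j m) k q)"
    and "chain_path m q (spiral_dist m q)"
proof -
  have M: "0 \<le> Im (block_chart j m)" using block_chart_upper m .
  have S: "m \<in> spiral" "q \<in> spiral" using m q by (auto simp: spiral_def)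
  have "log_map j (block_chart j m) m = block_chart j m" using log_map_block[OF m M] by (simp add: log_on_block_def)
  then have "dist (block_chart j m) (log_on_block j (block_chart j m) k q) \<le> spiral_dist m q"
    using spiral_dist_ge[OF log_map_short[OF M] S, of j] log_map_block[OF q M, of j] by simp
  moreover have p: "chain_path m q (dist (block_chart j m) (log_on_block j (block_chart j m) k q))" by (rule log_map_radial[OF m q])
  ultimately show "spiral_dist m q = dist (block_chart j m) (log_on_block j (block_chart j m) k q)"
    using spiral_dist_le[OF p] by simp
  then show "chain_path m q (spiral_dist m q)" using p by simp
qed

lemma spiral_dist_block:
  assumes "y \<in> block j" "z \<in> block j"
  shows "spiral_dist y z = dist (block_chart j y) (block_chart j z)"
  using spiral_dist_log(1)[OF assms] by (simp add: log_on_block_def)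

lemma chain_path_geodesic:
  assumes "x \<in> spiral" "y \<in> spiral"
  shows "chain_path x y (spiral_dist x y)"
  using assms spiral_dist_log(2) unfolding spiral_def by blast

lemma spiral_dist_commute: "spiral_dist x y = spiral_dist y x"
proof -
  have "{l. chain_path x y l} = {l. chain_path y x l}" using chain_path_sym by blast
  then show ?thesis by (simp add: spiral_dist_def)
qed

lemma Metric_space_spiral: "Metric_space spiral spiral_dist"
proof
  fix x y
  show "0 \<le> spiral_dist x y"
    using chain_path_props[OF chain_path_geodesic[of x y]]
    by (cases "x \<in> spiral \<and> y \<in> spiral") (auto simp: spiral_dist_def)
  show "spiral_dist x y = spiral_dist y x" by (rule spiral_dist_commute)
  assume xy: "x \<in> spiral" "y \<in> spiral"
  show "spiral_dist x y = 0 \<longleftrightarrow> x = y"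
    using euclidean_le_spiral_dist[OF xy] spiral_dist_le_euclidean[OF xy]
      chain_path_props[OF chain_path_geodesic[OF xy]] by auto
  fix z assume "z \<in> spiral"
  then show "spiral_dist x z \<le> spiral_dist x y + spiral_dist y z"
    using spiral_dist_le[OF chain_path_trans[OF chain_path_geodesic chain_path_geodesic]] xy by blast
qed

interpretation spiral: Metric_space spiral spiral_dist
  by (rule Metric_space_spiral)

lemma chain_path_split:
  "chain_path x y l \<Longrightarrow> 0 \<le> t \<Longrightarrow> t \<le> l \<Longrightarrow> \<exists>w. chain_path x w t \<and> chain_path w y (l - t)"
proof (induction arbitrary: t rule: chain_path.induct)
  case (chain_path_refl x)
  then show ?case using chain_path.chain_path_refl[of x] by (auto intro!: exI[of _ x])
next
  case (chain_path_step x y l j z)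
  show ?case
  proof (cases "t \<le> l")
    case True
    then obtain w where w: "chain_path x w t" "chain_path w y (l - t)"
      using chain_path_step.IH chain_path_step.prems by blast
    have "chain_path w z (l - t + dist (block_chart j y) (block_chart j z))"
      using chain_path.chain_path_step[OF w(2)] chain_path_step.hyps by blast
    then show ?thesis using w by (auto simp: algebra_simps)
  next
    case False
    let ?D = "dist (block_chart j y) (block_chart j z)"
    define \<tau> where "\<tau> = (t - l) / ?D"
    have D: "?D > 0" using False chain_path_step.prems by linarith
    have \<tau>: "0 \<le> \<tau>" "\<tau> \<le> 1" "\<tau> * ?D = t - l"
      using False D chain_path_step.prems by (auto simp: \<tau>_def divide_simps)
    define c where "c = (1 - \<tau>) *\<^sub>R block_chart j y + \<tau> *\<^sub>R block_chart j z"
    have "c \<in> base_triangle (gate j)"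
      unfolding c_def using \<tau> chart_in_triangle chain_path_step.hyps
      by (intro convexD_alt[OF convex_triangle]) auto
    then have w: "chart_inverse (gate j) c \<in> block j" "block_chart j (chart_inverse (gate j) c) = c"
      using chart_inverse_in_slab chart_chart_inverse by auto
    have "block_chart j y - c = \<tau> *\<^sub>R (block_chart j y - block_chart j z)" "c - block_chart j z = (1 - \<tau>) *\<^sub>R (block_chart j y - block_chart j z)"
      by (simp_all add: c_def algebra_simps)
    then have "dist (block_chart j y) c = \<bar>\<tau>\<bar> * ?D" "dist c (block_chart j z) = \<bar>1 - \<tau>\<bar> * ?D"
      by (simp_all only: dist_norm norm_scaleR)
    then have dc: "l + dist (block_chart j y) c = t" "dist c (block_chart j z) = l + ?D - t"
      using \<tau> by (auto simp: algebra_simps)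
    have "chain_path x (chart_inverse (gate j) c) (l + dist (block_chart j y) (block_chart j (chart_inverse (gate j) c)))"
      using chain_path.chain_path_step[OF chain_path_step.hyps(1,2) w(1)] .
    moreover have "chain_path (chart_inverse (gate j) c) z (dist (block_chart j (chart_inverse (gate j) c)) (block_chart j z))"
      using chain_path_single[OF w(1)] chain_path_step.hyps by blast
    ultimately show ?thesis using w dc by auto
  qed
qed

lemma spiral_between_point:
  assumes "y \<in> spiral" "z \<in> spiral" "0 \<le> t" "t \<le> spiral_dist y z"
  shows "\<exists>m\<in>spiral. spiral_dist y m = t \<and> spiral_dist m z = spiral_dist y z - t"
proof -
  obtain w where w: "chain_path y w t" "chain_path w z (spiral_dist y z - t)"
    using chain_path_split[OF chain_path_geodesic[OF assms(1,2)] assms(3,4)] by blast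
  then have "w \<in> spiral" using chain_path_props by blast
  moreover have "spiral_dist y w \<le> t" "spiral_dist w z \<le> spiral_dist y z - t"
    using w spiral_dist_le by auto
  ultimately show ?thesis using spiral.triangle[of y w z] assms by (intro bexI[of _ w]) auto
qed

section \<open>The Stewart inequality for the spiral\<close>

lemma aligned_inner:
  fixes a p M :: "'b::real_inner"
  assumes "aligned dist a p M" "p \<noteq> M"
  obtains c where "0 \<le> c" "a - p = c *\<^sub>R (p - M)"
proof -
  have "norm (a - p) + norm (p - M) = norm ((a - p) + (p - M))"
    using assms(1) by (simp add: aligned_def dist_norm)
  then have "norm (p - M) *\<^sub>R (a - p) = norm (a - p) *\<^sub>R (p - M)"
    using norm_triangle_eq[of "a - p" "p - M"] by simp
  then have "norm (p - M) *\<^sub>R (a - p) = norm (p - M) *\<^sub>R ((norm (a - p) / norm (p - M)) *\<^sub>R (p - M))"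
    using assms(2) by simp
  then have "a - p = (norm (a - p) / norm (p - M)) *\<^sub>R (p - M)"
    by (rule scaleR_left_imp_eq[rotated]) (use assms(2) in simp)
  then show ?thesis using that[of "norm (a - p) / norm (p - M)"] by simp
qed

text \<open>In an inner product space a concatenation of segments that is straight at each corner is
straight.\<close>

lemma aligned_inner_extend:
  fixes a p M q b :: "'b::real_inner"
  assumes "aligned dist a p M" "aligned dist p M q" "aligned dist b q M" "p \<noteq> M" "q \<noteq> M"
  shows "aligned dist a M b"
proof -
  obtain c1 where c1: "0 \<le> c1" "a - p = c1 *\<^sub>R (p - M)" using aligned_inner[OF assms(1,4)] .
  obtain c2 where c2: "0 \<le> c2" "p - M = c2 *\<^sub>R (M - q)" using aligned_inner[OF assms(2)] assms(5) by metis
  obtain c3 where c3: "0 \<le> c3" "b - q = c3 *\<^sub>R (q - M)" using aligned_inner[OF assms(3,5)] .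
  have a: "a - M = ((c1 + 1) * c2) *\<^sub>R (M - q)"
  proof -
    have "a - M = (a - p) + (p - M)" by simp
    also have "\<dots> = (c1 + 1) *\<^sub>R (p - M)" unfolding c1(2) by (simp add: scaleR_add_left)
    finally show ?thesis unfolding c2(2) by simp
  qed
  have b: "M - b = (c3 + 1) *\<^sub>R (M - q)"
  proof -
    have "M - b = - (b - q) + (M - q)" by simp
    then show ?thesis unfolding c3(2) by (simp add: algebra_simps)
  qed
  have "a - b = ((c1 + 1) * c2 + (c3 + 1)) *\<^sub>R (M - q)"
    using a b by (metis add.commute diff_add_cancel diff_add_eq scaleR_add_left add_diff_eq)
  then have "dist a b = ((c1 + 1) * c2 + (c3 + 1)) * norm (M - q)"
    unfolding dist_norm using c1(1) c2(1) c3(1) by simp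
  moreover have "dist a M = ((c1 + 1) * c2) * norm (M - q)"
    unfolding dist_norm a using c1(1) c2(1) by simp
  moreover have "dist M b = (c3 + 1) * norm (M - q)"
    unfolding dist_norm b using c3(1) by simp
  ultimately show ?thesis by (simp add: aligned_def algebra_simps)
qed

text \<open>A geodesic through \<open>m\<close> that is in one block near \<open>m\<close> is mapped to a straight segment by the
logarithm map of \<open>m\<close>.  There Stewart's equality holds, with the distance of \<open>x\<close> from \<open>m\<close> unchanged and those from \<open>y\<close> and \<open>z\<close>
not increased.\<close>

lemma stewart_in_block:
  assumes m: "m \<in> block j" "m1 \<in> block j" "m2 \<in> block j" "m1 \<noteq> m" "m2 \<noteq> m"
    and S: "x \<in> spiral" "y \<in> spiral" "z \<in> spiral"
    and al: "aligned spiral_dist y m1 m" "aligned spiral_dist m m2 z" "aligned spiral_dist y m z"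
  shows "stewart spiral_dist x y m z"
proof -
  let ?M = "block_chart j m"
  define e where "e = log_map j ?M"
  have M: "0 \<le> Im ?M" using block_chart_upper m(1) .
  have mS: "m \<in> spiral" "m1 \<in> spiral" "m2 \<in> spiral" using m unfolding spiral_def by blast+
  have short: "dist (e u) (e v) \<le> spiral_dist u v" if "u \<in> spiral" "v \<in> spiral" for u v
    unfolding e_def using spiral_dist_ge[OF log_map_short[OF M] that] .
  have e_block: "e u = block_chart j u" if "u \<in> block j" for u
    unfolding e_def using log_map_block[OF that M] by (simp add: log_on_block_def)
  have rad: "dist (e u) ?M = spiral_dist u m" if u: "u \<in> spiral" for u
  proof -
    obtain k where k: "u \<in> block k" using u unfolding spiral_def by blast
    show ?thesis unfolding e_def
      using spiral_dist_log(1)[OF m(1) k] log_map_block[OF k M] by (simp add: dist_commute spiral_dist_commute)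
  qed
  have inj: "block_chart j m1 \<noteq> ?M" "block_chart j m2 \<noteq> ?M" using chart_inverse_chart m by metis+
  have 1: "aligned dist (e y) (block_chart j m1) ?M"
    using short[OF S(2) mS(2)] rad[OF S(2)] rad[OF mS(2)] e_block[OF m(2)] al(1)
      dist_triangle[of "e y" ?M "block_chart j m1"] unfolding aligned_def by simp
  have 2: "aligned dist (e z) (block_chart j m2) ?M"
    using short[OF S(3) mS(3)] rad[OF S(3)] rad[OF mS(3)] e_block[OF m(3)] al(2)
      dist_triangle[of "e z" ?M "block_chart j m2"] unfolding aligned_def by (simp add: spiral_dist_commute)
  have 3: "aligned dist (block_chart j m1) ?M (block_chart j m2)"
  proof -
    have "spiral_dist m1 m2 = dist (block_chart j m1) (block_chart j m2)" using spiral_dist_block m by blast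
    moreover have "spiral_dist y z \<le> spiral_dist y m1 + spiral_dist m1 m2 + spiral_dist m2 z"
      using spiral.triangle[of y m1 z] spiral.triangle[of m1 m2 z] S mS by linarith
    moreover have "spiral_dist m1 m = dist (block_chart j m1) ?M" "spiral_dist m m2 = dist ?M (block_chart j m2)"
      using spiral_dist_block m by blast+
    ultimately show ?thesis
      using al dist_triangle[of "block_chart j m1" "block_chart j m2" ?M] unfolding aligned_def by linarith
  qed
  have al': "aligned dist (e y) ?M (e z)" using aligned_inner_extend[OF 1 3 2 inj] .
  have D: "dist (e y) (e z) = spiral_dist y z"
    using al' al(3) rad[OF S(2)] rad[OF S(3)] unfolding aligned_def by (simp add: dist_commute spiral_dist_commute)
  have "(spiral_dist x m)\<^sup>2 * spiral_dist y z =
      (dist (e x) (e y))\<^sup>2 * spiral_dist m z + (dist (e x) (e z))\<^sup>2 * spiral_dist y m - spiral_dist y m * spiral_dist m z * spiral_dist y z"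
    using stewart_equality[OF al', of "e x"] D rad[OF S(1)] rad[OF S(2)] rad[OF S(3)]
    by (simp add: dist_commute spiral_dist_commute)
  also have "\<dots> \<le> (spiral_dist x y)\<^sup>2 * spiral_dist m z + (spiral_dist x z)\<^sup>2 * spiral_dist y m - spiral_dist y m * spiral_dist m z * spiral_dist y z"
    using short S by (intro diff_right_mono add_mono mult_right_mono power_mono) auto
  finally show ?thesis unfolding stewart_def .
qed

text \<open>With this the inequality at a gate, where the geodesic may bend at a hinge, follows from the
inequality at nearby points off the gate.\<close>

lemma stewart_limit:
  assumes "Metric_space X d" "x \<in> X" "y \<in> X" "m \<in> X" "z \<in> X"
    and ex: "\<And>\<delta>. 0 < \<delta> \<Longrightarrow> \<exists>m'\<in>X. d m m' \<le> \<delta> \<and> stewart d x y m' z"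
  shows "stewart d x y m z"
proof -
  interpret Metric_space X d by fact
  have "\<exists>m'\<in>X. d m m' \<le> inverse (real (Suc n)) \<and> stewart d x y m' z" for n
    by (rule ex) simp
  then obtain s where s: "\<And>n. s n \<in> X" "\<And>n. d m (s n) \<le> inverse (real (Suc n))" "\<And>n. stewart d x y (s n) z"
    by metis
  have lim: "(\<lambda>n. d w (s n)) \<longlonglongrightarrow> d w m" if w: "w \<in> X" for w
  proof (rule LIM_zero_cancel, rule Lim_null_comparison)
    show "(\<lambda>n. inverse (real (Suc n))) \<longlonglongrightarrow> 0" by (rule LIMSEQ_inverse_real_of_nat)
    have "\<bar>d w (s n) - d w m\<bar> \<le> inverse (real (Suc n))" for n
      using triangle[of w m "s n"] triangle[of w "s n" m] w assms(4) s(1)[of n] s(2)[of n] by (simp add: commute)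
    then show "\<forall>\<^sub>F n in sequentially. norm (d w (s n) - d w m) \<le> inverse (real (Suc n))" by simp
  qed
  have lim': "(\<lambda>n. d (s n) w) \<longlonglongrightarrow> d m w" if "w \<in> X" for w using lim[OF that] by (simp add: commute)
  show ?thesis unfolding stewart_def
  proof (rule LIMSEQ_le)
    show "(\<lambda>n. (d x (s n))\<^sup>2 * d y z) \<longlonglongrightarrow> (d x m)\<^sup>2 * d y z"
      using assms by (intro tendsto_intros lim)
    show "(\<lambda>n. (d x y)\<^sup>2 * d (s n) z + (d x z)\<^sup>2 * d y (s n) - d y (s n) * d (s n) z * d y z) \<longlonglongrightarrow>
        (d x y)\<^sup>2 * d m z + (d x z)\<^sup>2 * d y m - d y m * d m z * d y z"
      using assms by (intro tendsto_intros lim lim')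
  qed (use s(3) in \<open>auto simp: stewart_def\<close>)
qed

text \<open>A point of the outer boundary of the block may be interior in this sense; only gates are
excluded, apart from the inner gate of block \<open>0\<close>, which nothing is glued to.\<close>

definition interior_to :: "nat \<Rightarrow> complex \<Rightarrow> bool" where
  "interior_to j m \<longleftrightarrow> m \<in> block j \<and> (\<exists>\<eta>>0. \<forall>w\<in>spiral. spiral_dist m w < \<eta> \<longrightarrow> w \<in> block j)"

lemma Re_close:
  assumes "m \<in> spiral" "w \<in> spiral"
  shows "\<bar>Re w - Re m\<bar> \<le> 10 * spiral_dist m w"
  using euclidean_le_spiral_dist[OF assms] abs_Re_le_cmod[of "w - m"]
  by (simp add: dist_norm norm_minus_commute)

lemma not_gate_interior:
  assumes m: "m \<in> spiral" and ng: "\<And>i. Re m \<noteq> 2 * gate i"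
  shows "interior_to (block_index m) m"
proof -
  let ?j = "block_index m"
  have mb: "m \<in> block ?j" using block_index_block[OF m] .
  have up: "Re m < 2 * gate ?j" using mb ng[of ?j] by (auto simp: slab_def)
  have lo: "gate ?j < Re m \<or> ?j = 0"
  proof (cases ?j)
    case (Suc i)
    then show ?thesis using mb ng[of i] by (simp add: slab_def less_le)
  qed simp
  define \<eta> where "\<eta> = min (2 * gate ?j - Re m) (if ?j = 0 then 1 else Re m - gate ?j) / 10"
  have "\<eta> > 0" using up lo by (auto simp: \<eta>_def)
  moreover have "w \<in> block ?j" if w: "w \<in> spiral" "spiral_dist m w < \<eta>" for w
  proof -
    have "\<bar>Re w - Re m\<bar> < min (2 * gate ?j - Re m) (if ?j = 0 then 1 else Re m - gate ?j)"
      using Re_close[OF m w(1)] w(2) by (simp add: \<eta>_def)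
    moreover have "3 \<le> Re w" "0 \<le> Im w" "3 * Im w \<le> Re w" using w by (auto simp: spiral_iff)
    ultimately have "gate ?j \<le> Re w" "Re w \<le> 2 * gate ?j"
      by (auto split: if_splits simp: gate_def)
    then show ?thesis using \<open>0 \<le> Im w\<close> \<open>3 * Im w \<le> Re w\<close> by (simp add: slab_def)
  qed
  ultimately show ?thesis using mb unfolding interior_to_def by blast
qed

lemma near_points_on_geodesic:
  assumes S: "y \<in> spiral" "m \<in> spiral" "z \<in> spiral" and ne: "y \<noteq> m" "z \<noteq> m"
    and al: "aligned spiral_dist y m z" and \<delta>: "0 < \<delta>"
  obtains m1 m2 where "m1 \<in> spiral" "m2 \<in> spiral" "m1 \<noteq> m" "m2 \<noteq> m"
    "spiral_dist m m1 < \<delta>" "spiral_dist m m2 < \<delta>" "aligned spiral_dist y m1 m" "aligned spiral_dist m m2 z"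
    "aligned spiral_dist y m1 z" "aligned spiral_dist y m2 z"
proof -
  have pos: "spiral_dist y m > 0" "spiral_dist m z > 0" using S ne by auto
  define r where "r = min (\<delta> / 2) (min (spiral_dist y m) (spiral_dist m z))"
  have r: "0 < r" "r < \<delta>" "r \<le> spiral_dist y m" "r \<le> spiral_dist m z" using pos \<delta> by (auto simp: r_def)
  obtain m1 where m1: "m1 \<in> spiral" "spiral_dist m m1 = r" "spiral_dist m1 y = spiral_dist m y - r"
    using spiral_between_point[OF S(2,1), of r] r by (auto simp: spiral_dist_commute)
  obtain m2 where m2: "m2 \<in> spiral" "spiral_dist m m2 = r" "spiral_dist m2 z = spiral_dist m z - r"
    using spiral_between_point[OF S(2,3), of r] r by auto
  show ?thesis
  proof (rule that[OF m1(1) m2(1)])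
    show "m1 \<noteq> m" "m2 \<noteq> m" using m1 m2 r S by auto
    show "spiral_dist m m1 < \<delta>" "spiral_dist m m2 < \<delta>" using m1 m2 r by auto
    show a1: "aligned spiral_dist y m1 m" and a2: "aligned spiral_dist m m2 z"
      using m1 m2 by (auto simp: aligned_def spiral_dist_commute)
    show "aligned spiral_dist y m1 z"
      using a1 al spiral.triangle[of y m1 z] spiral.triangle[of m1 m z] S m1 unfolding aligned_def by linarith
    show "aligned spiral_dist y m2 z"
      using a2 al spiral.triangle[of y m2 z] spiral.triangle[of y m m2] S m2 unfolding aligned_def by linarith
  qed
qed

lemma stewart_endpoints:
  assumes "Metric_space X d" "x \<in> X" "y \<in> X" "z \<in> X" "m = y \<or> m = z"
  shows "stewart d x y m z"
proof -
  interpret Metric_space X d by fact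
  have "d y y = 0" "d z z = 0" using assms by auto
  then show ?thesis using assms(5) by (auto simp: stewart_def)
qed

lemma stewart_interior:
  assumes m: "interior_to j m" and S: "x \<in> spiral" "y \<in> spiral" "z \<in> spiral"
    and al: "aligned spiral_dist y m z"
  shows "stewart spiral_dist x y m z"
proof (cases "m = y \<or> m = z")
  case True
  then show ?thesis using stewart_endpoints[OF Metric_space_spiral S] by blast
next
  case False
  obtain \<eta> where mb: "m \<in> block j" and \<eta>: "\<eta> > 0" "\<And>w. w \<in> spiral \<Longrightarrow> spiral_dist m w < \<eta> \<Longrightarrow> w \<in> block j"
    using m unfolding interior_to_def by blast
  have mS: "m \<in> spiral" using mb unfolding spiral_def by blast
  obtain m1 m2 where "m1 \<in> spiral" "m2 \<in> spiral" "m1 \<noteq> m" "m2 \<noteq> m"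
    "spiral_dist m m1 < \<eta>" "spiral_dist m m2 < \<eta>" "aligned spiral_dist y m1 m" "aligned spiral_dist m m2 z"
    using near_points_on_geodesic[OF S(2) mS S(3) _ _ al \<eta>(1)] False by metis
  then show ?thesis using stewart_in_block[OF mb _ _ _ _ S, of m1 m2] \<eta>(2) al by blast
qed

text \<open>Close to \<open>m\<close> the geodesic either stays in one of the two blocks on both sides of \<open>m\<close>, or it has points
off the gate on one side, arbitrarily close to \<open>m\<close>.\<close>

lemma stewart_gate:
  assumes m: "m \<in> spiral" "Re m = 2 * gate i" and S: "x \<in> spiral" "y \<in> spiral" "z \<in> spiral"
    and al: "aligned spiral_dist y m z"
  shows "stewart spiral_dist x y m z"
proof (cases "m = y \<or> m = z")
  case True
  then show ?thesis using stewart_endpoints[OF Metric_space_spiral S] by blast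
next
  case False
  show ?thesis
  proof (rule stewart_limit[OF Metric_space_spiral S(1,2) m(1) S(3)])
    fix \<delta> :: real assume \<delta>: "\<delta> > 0"
    \<comment> \<open>The real part changes by at most \<open>10 r \<le> gate i / 2\<close>, so points within \<open>r\<close> of \<open>m\<close> are in one of the two blocks.\<close>
    define r where "r = min \<delta> (gate i / 20)"
    have r: "r > 0" "r \<le> \<delta>" "10 * r \<le> gate i / 2" using \<delta> gate_pos[of i] by (auto simp: r_def)
    obtain m1 m2 where m12: "m1 \<in> spiral" "m2 \<in> spiral" "m1 \<noteq> m" "m2 \<noteq> m"
      "spiral_dist m m1 < r" "spiral_dist m m2 < r" "aligned spiral_dist y m1 m" "aligned spiral_dist m m2 z"
      "aligned spiral_dist y m1 z" "aligned spiral_dist y m2 z"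
      using near_points_on_geodesic[OF S(2) m(1) S(3) _ _ al r(1)] False by metis
    have near: "gate i < Re w" "Re w < 4 * gate i" if "w \<in> spiral" "spiral_dist m w < r" for w
      using Re_close[OF m(1) that(1)] that(2) r(3) m(2) gate_pos[of i] by linarith+
    have mb: "m \<in> block i" "m \<in> block (Suc i)" using outer_gate[OF m(2)] m by (auto simp: spiral_iff)
    have lower: "w \<in> block i" if "w \<in> spiral" "spiral_dist m w < r" "Re w \<le> 2 * gate i" for w
      using near[OF that(1,2)] that by (auto simp: slab_def spiral_iff)
    have upper: "w \<in> block (Suc i)" if "w \<in> spiral" "spiral_dist m w < r" "2 * gate i \<le> Re w" for w
      using near[OF that(1,2)] that by (auto simp: slab_def spiral_iff)
    consider "Re m1 \<le> 2 * gate i" "Re m2 \<le> 2 * gate i" | "2 * gate i \<le> Re m1" "2 * gate i \<le> Re m2"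
      | "Re m1 \<noteq> 2 * gate i" by linarith
    then show "\<exists>m'\<in>spiral. spiral_dist m m' \<le> \<delta> \<and> stewart spiral_dist x y m' z"
    proof cases
      case 1
      then have "stewart spiral_dist x y m z"
        using stewart_in_block[OF mb(1) lower lower m12(3,4) S m12(7,8) al] m12 by blast
      then show ?thesis using m \<delta> by (intro bexI[of _ m]) auto
    next
      case 2
      then have "stewart spiral_dist x y m z"
        using stewart_in_block[OF mb(2) upper upper m12(3,4) S m12(7,8) al] m12 by blast
      then show ?thesis using m \<delta> by (intro bexI[of _ m]) auto
    next
      case 3
      have "Re m1 \<noteq> 2 * gate k" for k
      proof -
        consider "k < i" | "k = i" | "i < k" by linarith
        then show ?thesis
        proof cases
          case 1
          then have "gate (Suc k) \<le> gate i" by (intro gate_mono) simp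
          then show ?thesis using near(1)[OF m12(1,5)] by simp
        next
          case 3
          then have "gate (Suc i) \<le> gate k" by (intro gate_mono) simp
          then show ?thesis using near(2)[OF m12(1,5)] by simp
        qed (use 3 in simp)
      qed
      then have "stewart spiral_dist x y m1 z"
        using stewart_interior[OF not_gate_interior[OF m12(1)] S m12(9)] by blast
      then show ?thesis using m12 r by (intro bexI[of _ m1]) auto
    qed
  qed
qed

theorem stewart_space_spiral: "stewart_space spiral spiral_dist"
  unfolding stewart_space_def
proof (intro conjI ballI impI)
  fix y z t assume "y \<in> spiral" "z \<in> spiral" "t \<in> {0..spiral_dist y z}"
  then show "\<exists>m\<in>spiral. spiral_dist y m = t \<and> spiral_dist m z = spiral_dist y z - t"
    using spiral_between_point[of y z t] by simp
next
  fix x y m z assume "x \<in> spiral" "y \<in> spiral" "m \<in> spiral" "z \<in> spiral" "aligned spiral_dist y m z"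
  then show "stewart spiral_dist x y m z"
    using stewart_gate[of m _ x y z] stewart_interior[OF not_gate_interior, of m x y z] by blast
qed (rule Metric_space_spiral)

section \<open>Geodesics of the spiral pass through the hinges\<close>

lemma dist_hinge_outwards:
  assumes "v \<in> block k" "i < k"
  shows "spiral_dist (hinge i) v = from_base v - (2 * gate i - 3)"
    and "0 \<le> from_base v - (2 * gate i - 3)"
proof -
  have v: "v \<in> spiral" using assms unfolding spiral_def by blast
  have p: "chain_path (hinge i) v (from_base v - (2 * gate i - 3))"
    using path_from_hinge_outwards[of v i "k - Suc i"] assms by simp
  then show nn: "0 \<le> from_base v - (2 * gate i - 3)" using chain_path_props by blast
  show "spiral_dist (hinge i) v = from_base v - (2 * gate i - 3)"
  proof (cases "k = Suc i")
    case True
    then show ?thesis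
      using spiral_dist_block[OF hinge_block(2)[of i], of v] from_base_block[OF assms(1)] hinge_block(4)[of i] assms(1) by simp
  next
    case False
    have "dist (0::complex) ((from_base v - (2 * gate i - 3)) *\<^sub>R opposite 1 0) = from_base v - (2 * gate i - 3)"
      using dist_opposite[of 1, OF _ nn, of 0] by simp
    then show ?thesis
      using spiral_dist_log(1)[OF hinge_block(1)[of i] assms(1)] False assms(2) hinge_block(3)[of i]
      by (simp add: log_on_block_def dist_norm)
  qed
qed

text \<open>The logarithm map collapses blocks that are not adjacent to the ray behind the hinge.\<close>

lemma dist_far_blocks:
  assumes u: "u \<in> block i" and v: "v \<in> block k" and ik: "Suc i < k"
  shows "spiral_dist u v = spiral_dist u (hinge i) + (from_base v - (2 * gate i - 3))"
proof -
  let ?m = "block_chart i u - of_real (gate i)" and ?r = "from_base v - (2 * gate i - 3)"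
  have "dist (block_chart i u) (log_on_block i (block_chart i u) k v) = dist ?m (?r *\<^sub>R opposite 1 ?m)"
    using ik by (simp add: log_on_block_def dist_norm algebra_simps)
  also have "\<dots> = cmod ?m + ?r"
    using dist_opposite[of 1] dist_hinge_outwards(2)[OF v, of i] ik by simp
  also have "cmod ?m = spiral_dist u (hinge i)"
    using spiral_dist_block[OF u hinge_block(1)] hinge_block(3)[of i] by (simp add: dist_norm)
  finally show ?thesis using spiral_dist_log(1)[OF u v] by simp
qed

text \<open>If the block of \<open>u\<close> is before block \<open>n\<close> then the hinge of its own block comes first, and \<open>hinge n\<close> and \<open>v\<close>
follow at distances that \<^const>\<open>from_base\<close> measures.\<close>

lemma aligned_hinge:
  assumes "u \<in> spiral" "v \<in> spiral" "block_index u \<le> n" "n + 2 \<le> block_index v"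
  shows "aligned spiral_dist u (hinge n) v"
proof -
  have u: "u \<in> block (block_index u)" and v: "v \<in> block (block_index v)" using block_index_block assms by auto
  have hv: "spiral_dist (hinge n) v = from_base v - (2 * gate n - 3)"
    using dist_hinge_outwards(1)[OF v, of n] assms by simp
  show ?thesis
  proof (cases "block_index u = n")
    case True
    then show ?thesis using dist_far_blocks[OF u v] hv assms by (simp add: aligned_def)
  next
    case False
    have "spiral_dist u (hinge n) = spiral_dist u (hinge (block_index u)) + (from_base (hinge n) - (2 * gate (block_index u) - 3))"
      using dist_far_blocks[OF u hinge_block(2)[of n]] False assms by simp
    moreover have "spiral_dist u v = spiral_dist u (hinge (block_index u)) + (from_base v - (2 * gate (block_index u) - 3))"
      using dist_far_blocks[OF u v] False assms by simp
    ultimately show ?thesis using hv from_base_hinge[of n] by (simp add: aligned_def)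
  qed
qed

definition spine :: "real \<Rightarrow> complex" where
  "spine t = of_real (3 + t)"

lemma spine_in: "0 \<le> t \<Longrightarrow> spine t \<in> spiral"
  by (simp add: spine_def spiral_iff)

lemma block_chart_spine: "spine t \<in> block k \<Longrightarrow> block_chart k (spine t) = of_real (3 + t - gate k) \<and> gate k \<le> 3 + t"
  using chart_inner_wall[of "gate k" "3 + t"] by (simp add: spine_def slab_def)

lemma from_base_spine:
  assumes "0 \<le> t"
  shows "from_base (spine t) = t"
proof -
  obtain k where k: "spine t \<in> block k" using spine_in[OF assms] unfolding spiral_def by blast
  have "cmod (block_chart k (spine t)) = 3 + t - gate k" using block_chart_spine[OF k] by (simp only: norm_of_real) simp
  then show ?thesis using from_base_block[OF k] by simp
qed

lemma hinge_spine: "hinge j = spine (2 * gate j - 3)"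
  by (simp add: hinge_def spine_def)

lemma spine_dist:
  assumes "0 \<le> s" "0 \<le> t"
  shows "spiral_dist (spine s) (spine t) = \<bar>s - t\<bar>"
proof -
  have short: "short_on_blocks from_base"
    unfolding short_on_blocks_def
    using from_base_block by (auto simp: dist_real_def dist_norm norm_triangle_ineq3)
  have le: "spiral_dist (spine s) (spine t) = t - s" if st: "0 \<le> s" "s \<le> t" for s t
  proof (rule antisym)
    have t: "0 \<le> t" using st by simp
    show "t - s \<le> spiral_dist (spine s) (spine t)"
      using spiral_dist_ge[OF short spine_in[OF st(1)] spine_in[OF t]] from_base_spine st t by (simp add: dist_real_def)
    have s: "spine s \<in> block (block_index (spine s))" and k: "spine t \<in> block (block_index (spine t))"
      using block_index_block spine_in st t by auto
    let ?i = "block_index (spine s)" and ?k = "block_index (spine t)"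
    note Fs = block_chart_spine[OF s] and Ft = block_chart_spine[OF k]
    consider "?i = ?k" | "?i < ?k" | "?k < ?i" by linarith
    then show "spiral_dist (spine s) (spine t) \<le> t - s"
    proof cases
      case 1
      then have "spiral_dist (spine s) (spine t) = dist (of_real (3 + s - gate ?i)) (of_real (3 + t - gate ?i) :: complex)"
        using spiral_dist_block[OF s, of "spine t"] k Fs Ft by simp
      then show ?thesis using st by (simp only: dist_of_real) (simp add: dist_real_def)
    next
      case 2
      have up: "3 + s \<le> 2 * gate ?i" using s by (simp add: slab_def spine_def)
      have "spiral_dist (spine s) (hinge ?i) = dist (of_real (3 + s - gate ?i)) (of_real (gate ?i) :: complex)"
        using spiral_dist_block[OF s hinge_block(1)] Fs hinge_block(3)[of ?i] by simp
      also have "\<dots> = 2 * gate ?i - 3 - s" using up by (simp only: dist_of_real) (simp add: dist_real_def)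
      finally show ?thesis
        using spiral.triangle[OF spine_in[OF st(1)] hinge_block(5)[of ?i] spine_in[OF t]]
          dist_hinge_outwards(1)[OF k 2] from_base_spine[OF t] by simp
    next
      case 3
      have "gate (Suc ?k) \<le> gate ?i" using 3 by (intro gate_mono) simp
      moreover have "3 + t \<le> 2 * gate ?k" using k by (simp add: slab_def spine_def)
      ultimately have "s = t" using Fs st by simp
      then show ?thesis using spine_in[OF t] by simp
    qed
  qed
  show ?thesis
  proof (cases "s \<le> t")
    case True
    then show ?thesis using le[of s t] assms by simp
  next
    case False
    then show ?thesis using le[of t s] assms by (simp add: spiral_dist_commute)
  qed
qed

text \<open>From another block, a point in the interior of an inner wall is reached only through one of
the two hinges at its ends, which is closer.\<close>

lemma spine_foot_idx:
  assumes u: "u \<in> spiral" and t: "gate j < 3 + t" "3 + t < 2 * gate j" and ne: "block_index u \<noteq> j"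
  shows "\<exists>s\<ge>0. spiral_dist u (spine s) < spiral_dist u (spine t)"
proof -
  define w where "w = spine t"
  have t0: "0 \<le> t" using t gate_ge[of j] by linarith
  have w: "w \<in> block j" using t by (simp add: w_def spine_def slab_def)
  have Fw: "block_chart j w = of_real (3 + t - gate j)" using block_chart_spine[of t j] w by (simp add: w_def)
  have ub: "u \<in> block (block_index u)" using block_index_block[OF u] .
  consider "Suc j < block_index u" | "block_index u = Suc j" | "Suc (block_index u) = j" | "Suc (block_index u) < j" using ne by linarith
  then show ?thesis
  proof cases
    case 1
    have "spiral_dist w u = spiral_dist w (hinge j) + spiral_dist (hinge j) u"
      using dist_far_blocks[OF w ub 1] dist_hinge_outwards(1)[OF ub, of j] 1 by simp
    moreover have "spiral_dist w (hinge j) > 0"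
      using spine_dist[OF t0, of "2 * gate j - 3"] t gate_ge[of j] by (simp add: w_def hinge_spine)
    ultimately show ?thesis
      using gate_ge[of j] by (intro exI[of _ "2 * gate j - 3"]) (simp add: w_def spiral_dist_commute hinge_spine)
  next
    case 2
    let ?m = "block_chart j w - of_real (gate j)"
    have m: "Re ?m < 0" "Im ?m = 0" using Fw t by auto
    then have "hidden 1 ?m (- block_chart (Suc j) u)" by (simp add: hidden_def)
    then have "dist ?m (fold_plane 1 ?m (- block_chart (Suc j) u)) = cmod ?m + cmod (block_chart (Suc j) u)"
      using dist_fold_plane[of 1 ?m "- block_chart (Suc j) u"] by simp
    moreover have "dist (block_chart j w) (log_on_block j (block_chart j w) (Suc j) u) = dist ?m (fold_plane 1 ?m (- block_chart (Suc j) u))"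
      by (simp add: log_on_block_def dist_norm algebra_simps)
    ultimately have "spiral_dist w u = cmod ?m + cmod (block_chart (Suc j) u)"
      using spiral_dist_log(1)[OF w, of u "Suc j"] ub 2 by simp
    moreover have "spiral_dist (hinge j) u = cmod (block_chart (Suc j) u)"
      using spiral_dist_block[OF hinge_block(2)[of j], of u] ub 2 hinge_block(4)[of j] by simp
    moreover have "cmod ?m > 0" using m by auto
    ultimately show ?thesis
      using gate_ge[of j] by (intro exI[of _ "2 * gate j - 3"]) (simp add: w_def spiral_dist_commute hinge_spine)
  next
    case 3
    let ?i = "block_index u"
    have j: "gate j = 2 * gate ?i" using 3 by auto
    have m: "Re (block_chart j w) > 0" "Im (block_chart j w) = 0" using Fw t by auto
    then have "hidden (-1) (block_chart j w) (of_real (gate ?i) - block_chart ?i u)" by (simp add: hidden_def)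
    then have "dist (block_chart j w) (fold_plane (-1) (block_chart j w) (of_real (gate ?i) - block_chart ?i u)) = cmod (block_chart j w) + cmod (of_real (gate ?i) - block_chart ?i u)"
      using dist_fold_plane[of "-1" "block_chart j w" "of_real (gate ?i) - block_chart ?i u"] by simp
    then have "spiral_dist w u = cmod (block_chart j w) + cmod (of_real (gate ?i) - block_chart ?i u)"
      using spiral_dist_log(1)[OF w ub] 3 by (simp add: log_on_block_def)
    moreover have "spiral_dist (hinge ?i) u = cmod (of_real (gate ?i) - block_chart ?i u)"
      using spiral_dist_block[OF hinge_block(1) ub] hinge_block(3)[of ?i] by (simp add: dist_norm)
    moreover have "cmod (block_chart j w) > 0" using m by auto
    ultimately show ?thesis
      using gate_ge[of ?i] by (intro exI[of _ "2 * gate ?i - 3"]) (simp add: w_def spiral_dist_commute hinge_spine)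
  next
    case 4
    then obtain i where i: "j = Suc i" "block_index u < i" by (metis Suc_lessE)
    have "spiral_dist u w = spiral_dist u (hinge (block_index u)) + (t - (2 * gate (block_index u) - 3))"
      using dist_far_blocks[OF ub w 4] from_base_spine[OF t0] by (simp add: w_def)
    moreover have "spiral_dist u (hinge i) = spiral_dist u (hinge (block_index u)) + (2 * gate i - 3 - (2 * gate (block_index u) - 3))"
      using dist_far_blocks[OF ub hinge_block(2)[of i]] i from_base_hinge[of i] by simp
    ultimately show ?thesis
      using gate_ge[of i] t(1) i by (intro exI[of _ "2 * gate i - 3"]) (simp add: w_def hinge_spine)
  qed
qed

section \<open>Wedges of CAT(0) spaces\<close>

lemma stewart_swap:
  assumes "\<And>u v. d u v = d v u" "stewart d x z m y"
  shows "stewart d x y m z"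
proof -
  have c: "d z m = d m z" "d m y = d y m" "d z y = d y z" using assms(1) by blast+
  show ?thesis using assms(2) unfolding stewart_def c by (simp add: algebra_simps)
qed

text \<open>The case that \<open>x\<close> sees \<open>y\<close>, \<open>m\<close> and \<open>z\<close>, at distances \<open>c + Y\<close>, \<open>c + M\<close> and \<open>c + Z\<close>, through a common
point.  The terms linear in \<open>c\<close> say that the distance from that point is convex along the geodesic, which follows from Stewart's
inequality for it.\<close>

lemma stewart_through_point:
  fixes c M Y Z p q D :: real
  assumes "M\<^sup>2 * D \<le> Y\<^sup>2 * q + Z\<^sup>2 * p - p * q * D" "p + q = D" "0 \<le> p" "0 \<le> q" "0 \<le> c" "0 \<le> Y" "0 \<le> Z"
    and "\<bar>Y - Z\<bar> \<le> D"
  shows "(c + M)\<^sup>2 * D \<le> (c + Y)\<^sup>2 * q + (c + Z)\<^sup>2 * p - p * q * D"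
proof -
  have D: "0 \<le> D" using assms by simp
  have YZ: "(Y - Z)\<^sup>2 \<le> D\<^sup>2" using assms(8) by (simp add: abs_le_square_iff[symmetric] abs_of_nonneg[OF D])
  have "(M * D)\<^sup>2 = (M\<^sup>2 * D) * D" by (simp add: power2_eq_square)
  also have "\<dots> \<le> (Y\<^sup>2 * q + Z\<^sup>2 * p - p * q * D) * D" using assms(1) D by (rule mult_right_mono)
  also have "\<dots> = (Y * q + Z * p)\<^sup>2 + p * q * ((Y - Z)\<^sup>2 - D\<^sup>2)"
    using assms(2) by (simp add: power2_eq_square algebra_simps flip: assms(2))
  also have "\<dots> \<le> (Y * q + Z * p)\<^sup>2"
    using YZ assms(3,4) by (simp add: mult_nonneg_nonpos)
  finally have "M * D \<le> Y * q + Z * p" using assms by (intro power2_le_imp_le[of "M * D"]) auto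
  then have "c * (M * D) \<le> c * (Y * q + Z * p)" using assms(5) by (rule mult_left_mono)
  moreover have "(c + M)\<^sup>2 * D = c\<^sup>2 * p + c\<^sup>2 * q + 2 * (c * (M * D)) + M\<^sup>2 * D"
    by (simp add: power2_eq_square algebra_simps flip: assms(2))
  moreover have "(c + Y)\<^sup>2 * q + (c + Z)\<^sup>2 * p - p * q * D
      = c\<^sup>2 * p + c\<^sup>2 * q + 2 * (c * (Y * q + Z * p)) + (Y\<^sup>2 * q + Z\<^sup>2 * p - p * q * D)"
    by (simp add: power2_eq_square algebra_simps)
  ultimately show ?thesis using assms(1) by linarith
qed

text \<open>The case that the side from \<open>y\<close> is prolonged by \<open>r\<close> beyond a point at distance \<open>W\<close> from \<open>x\<close>, and \<open>x\<close>
sees the new end through that point.  Both sides differ by \<open>r\<close> times an expression that the triangle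
inequality \<open>\<bar>W - (p + q)\<bar> \<le> X\<close> bounds.\<close>

lemma stewart_extend_side:
  fixes M X W p q r :: real
  assumes "M\<^sup>2 * (p + q) \<le> X\<^sup>2 * q + W\<^sup>2 * p - p * q * (p + q)" "0 \<le> p" "0 \<le> q" "0 \<le> r" "0 \<le> X"
    and M: "M\<^sup>2 \<le> X\<^sup>2 \<or> 0 < p" and "\<bar>W - (p + q)\<bar> \<le> X"
  shows "M\<^sup>2 * (p + (q + r)) \<le> X\<^sup>2 * (q + r) + (W + r)\<^sup>2 * p - p * (q + r) * (p + (q + r))"
proof (cases "p = 0")
  case True
  then show ?thesis using assms by (simp add: mult_right_mono)
next
  case False
  then have s: "0 < p + q" using assms by simp
  have "(W - (p + q))\<^sup>2 \<le> X\<^sup>2" using assms(5,7) by (simp add: abs_le_square_iff[symmetric])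
  then have "p * (W - (p + q))\<^sup>2 \<le> p * X\<^sup>2" using assms(2) by (rule mult_left_mono)
  then have "X\<^sup>2 * q + W\<^sup>2 * p - p * q * (p + q) \<le> (X\<^sup>2 + 2 * W * p - 2 * p * q - p\<^sup>2) * (p + q)"
    by (simp add: power2_eq_square algebra_simps)
  then have "M\<^sup>2 * (p + q) \<le> (X\<^sup>2 + 2 * W * p - 2 * p * q - p\<^sup>2) * (p + q)" using assms(1) by linarith
  then have "M\<^sup>2 \<le> X\<^sup>2 + 2 * W * p - 2 * p * q - p\<^sup>2" using s by simp
  then have "r * M\<^sup>2 \<le> r * (X\<^sup>2 + 2 * W * p - 2 * p * q - p\<^sup>2)" using assms(4) by (rule mult_left_mono)
  then show ?thesis using assms(1) by (simp add: power2_eq_square algebra_simps)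
qed

text \<open>A geodesic with both ends in one part stays there, and one with ends in both
passes through the wedge point.\<close>

lemma stewart_wedge_half:
  assumes X1: "stewart_space X1 d" and X2: "stewart_space X2 d" and M: "Metric_space (X1 \<union> X2) d"
    and o: "o' \<in> X1" "o' \<in> X2" and cross: "\<And>x y. x \<in> X1 \<Longrightarrow> y \<in> X2 \<Longrightarrow> d x y = d x o' + d o' y"
    and S: "x \<in> X1" "y \<in> X1 \<union> X2" "m \<in> X1 \<union> X2" "z \<in> X1 \<union> X2" and al: "aligned d y m z"
  shows "stewart d x y m z"
proof -
  interpret Metric_space "X1 \<union> X2" d by fact
  have stay: "m \<in> Y1"
    if Y: "Y1 = X1 \<and> Y2 = X2 \<or> Y1 = X2 \<and> Y2 = X1" and yz: "y \<in> Y1" "z \<in> Y1"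
      and m: "m \<in> X1 \<union> X2" "aligned d y m z" for Y1 Y2 y m z
  proof (cases "m \<in> Y1")
    case False
    then have m2: "m \<in> Y2" using Y m by blast
    have "d u m = d u o' + d o' m" if "u \<in> Y1" for u
      using Y cross[of u m] cross[of m u] that m2 commute by auto
    from this[OF yz(1)] this[OF yz(2)] have "d y m = d y o' + d o' m" "d m z = d o' m + d z o'"
      by (simp_all add: commute)
    moreover have "d y z \<le> d y o' + d z o'" using triangle[of y o' z] Y yz o by (auto simp: commute)
    ultimately have "d o' m = 0" using m(2) nonneg[of o' m] unfolding aligned_def by linarith
    then show ?thesis using Y o m by auto
  qed
  have mixed: "stewart d x y m z" if yz: "y \<in> X1" "z \<in> X2" and m: "m \<in> X1 \<union> X2" and al: "aligned d y m z" for y m z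
  proof (cases "m \<in> X1")
    case True
    have mz: "d m z = d m o' + d o' z" and yz': "d y z = d y o' + d o' z" and xz: "d x z = d x o' + d o' z"
      using cross yz True S(1) by blast+
    have yo: "d y o' = d y m + d m o'" using mz yz' al unfolding aligned_def by linarith
    then have "aligned d y m o'" by (simp add: aligned_def)
    then have st: "(d x m)\<^sup>2 * (d y m + d m o') \<le> (d x y)\<^sup>2 * d m o' + (d x o')\<^sup>2 * d y m - d y m * d m o' * (d y m + d m o')"
      using stewart_inequality[OF X1 S(1) yz(1) True o(1)] yo by simp
    have "(d x m)\<^sup>2 \<le> (d x y)\<^sup>2 \<or> 0 < d y m" using yz True by (cases "y = m") auto
    moreover have "\<bar>d x o' - (d y m + d m o')\<bar> \<le> d x y"
      using triangle[of x y o'] triangle[of y x o'] S yz o yo by (auto simp: commute abs_le_iff)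
    ultimately show ?thesis
      using stewart_extend_side[OF st] mz yz' xz yo unfolding stewart_def by (simp add: add.assoc)
  next
    case False
    then have m2: "m \<in> X2" using m by blast
    have ym: "d y m = d y o' + d o' m" and yz': "d y z = d y o' + d o' z" and xz: "d x z = d x o' + d o' z"
      and xm: "d x m = d x o' + d o' m"
      using cross yz m2 S(1) by blast+
    have oz: "d o' z = d o' m + d m z" using ym yz' al unfolding aligned_def by linarith
    have "\<bar>d x o' - d y o'\<bar> \<le> d x y"
      using triangle[of x y o'] triangle[of y x o'] S yz o by (auto simp: commute abs_le_iff)
    then have "(d x o' - d y o')\<^sup>2 \<le> (d x y)\<^sup>2" by (simp add: abs_le_square_iff[symmetric])
    then have "(d x o' - d y o')\<^sup>2 * d m z \<le> (d x y)\<^sup>2 * d m z" by (rule mult_right_mono) simp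
    moreover have "(d x o' + d o' m)\<^sup>2 * (d y o' + (d o' m + d m z)) = (d x o' - d y o')\<^sup>2 * d m z
       + (d x o' + (d o' m + d m z))\<^sup>2 * (d y o' + d o' m) - (d y o' + d o' m) * d m z * (d y o' + (d o' m + d m z))"
      by (simp add: power2_eq_square algebra_simps)
    ultimately show ?thesis unfolding stewart_def ym xm yz' xz oz by linarith
  qed
  consider "y \<in> X1" "z \<in> X1" | "y \<in> X2" "z \<in> X2" | "y \<in> X1" "z \<in> X2" | "y \<in> X2" "z \<in> X1" using S by blast
  then show ?thesis
  proof cases
    case 1
    have "m \<in> X1" using stay[of X1 X2 y z m] 1 S(3) al by blast
    then show ?thesis using stewart_inequality[OF X1 S(1) 1(1) _ 1(2) al] unfolding stewart_def by blast
  next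
    case 2
    have m: "m \<in> X2" using stay[of X2 X1 y z m] 2 S(3) al by blast
    have "(d o' m)\<^sup>2 * d y z \<le> (d o' y)\<^sup>2 * d m z + (d o' z)\<^sup>2 * d y m - d y m * d m z * d y z"
      using stewart_inequality[OF X2 o(2) 2(1) m 2(2) al] .
    moreover have "\<bar>d o' y - d o' z\<bar> \<le> d y z"
      using triangle[of o' y z] triangle[of o' z y] S o by (auto simp: commute abs_le_iff)
    ultimately show ?thesis
      using stewart_through_point[of "d o' m" "d y z" "d o' y" "d m z" "d o' z" "d y m" "d x o'"] al
        cross[OF S(1) 2(1)] cross[OF S(1) 2(2)] cross[OF S(1) m]
      unfolding stewart_def aligned_def by simp
  next
    case 3
    then show ?thesis using mixed S(3) al by blast
  next
    case 4
    have "aligned d z m y" using al by (simp add: aligned_def commute)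
    then show ?thesis using mixed[OF 4(2,1) S(3)] stewart_swap[of d] commute by blast
  qed
qed

theorem stewart_space_wedge:
  assumes X1: "stewart_space X1 d" and X2: "stewart_space X2 d" and M: "Metric_space (X1 \<union> X2) d"
    and o: "o' \<in> X1" "o' \<in> X2" and cross: "\<And>x y. x \<in> X1 \<Longrightarrow> y \<in> X2 \<Longrightarrow> d x y = d x o' + d o' y"
  shows "stewart_space (X1 \<union> X2) d"
  unfolding stewart_space_def
proof (intro conjI ballI impI)
  interpret Metric_space "X1 \<union> X2" d by fact
  have mixed: "\<exists>m\<in>X1 \<union> X2. d y m = t \<and> d m z = d y z - t"
    if yz: "y \<in> X1" "z \<in> X2" and t: "0 \<le> t" "t \<le> d y z" for y z t
  proof (cases "t \<le> d y o'")
    case True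
    obtain m where "m \<in> X1" "d y m = t" "d m o' = d y o' - t"
      using stewart_between_point[OF X1 yz(1) o(1) t(1) True] .
    then show ?thesis using cross[OF _ yz(2), of m] cross[OF yz] by (intro bexI[of _ m]) auto
  next
    case False
    obtain m where "m \<in> X2" "d o' m = t - d y o'" "d m z = d o' z - (t - d y o')"
      using stewart_between_point[OF X2 o(2) yz(2), of "t - d y o'"] t cross[OF yz] False by auto
    then show ?thesis using cross[OF yz(1), of m] cross[OF yz] by (intro bexI[of _ m]) auto
  qed
  fix y z t assume y: "y \<in> X1 \<union> X2" and z: "z \<in> X1 \<union> X2" and t: "t \<in> {0..d y z}"
  consider "y \<in> X1" "z \<in> X1" | "y \<in> X2" "z \<in> X2" | "y \<in> X1" "z \<in> X2" | "y \<in> X2" "z \<in> X1" using y z by blast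
  then show "\<exists>m\<in>X1 \<union> X2. d y m = t \<and> d m z = d y z - t"
  proof cases
    case 1
    then show ?thesis using stewart_between_point[OF X1, of y z t] t by (metis Un_iff atLeastAtMost_iff)
  next
    case 2
    then show ?thesis using stewart_between_point[OF X2, of y z t] t by (metis Un_iff atLeastAtMost_iff)
  next
    case 3
    then show ?thesis using mixed[of y z t] t by simp
  next
    case 4
    then obtain m where "m \<in> X1 \<union> X2" "d z m = d z y - t" "d m y = d z y - (d z y - t)"
      using mixed[of z y "d z y - t"] t by (auto simp: commute)
    then show ?thesis by (intro bexI[of _ m]) (auto simp: commute)
  qed
next
  fix x y m z assume x: "x \<in> X1 \<union> X2" and S: "y \<in> X1 \<union> X2" "m \<in> X1 \<union> X2" "z \<in> X1 \<union> X2" and al: "aligned d y m z"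
  interpret Metric_space "X1 \<union> X2" d by fact
  have M': "Metric_space (X2 \<union> X1) d" using M by (simp add: Un_commute)
  have cross': "d x y = d x o' + d o' y" if "x \<in> X2" "y \<in> X1" for x y
    using cross[OF that(2,1)] by (simp add: commute)
  show "stewart d x y m z"
  proof (cases "x \<in> X1")
    case True
    then show ?thesis using stewart_wedge_half[OF X1 X2 M o cross] S al by blast
  next
    case False
    then show ?thesis using stewart_wedge_half[OF X2 X1 M' o(2,1) cross'] S al x by blast
  qed
qed (rule M)

lemma stewart_space_convex:
  fixes S :: "'b::real_inner set"
  assumes "convex S"
  shows "stewart_space S dist"
  unfolding stewart_space_def
proof (intro conjI ballI impI)
  show "Metric_space S dist" by standard (auto simp: dist_commute dist_triangle)
next
  fix y z and t :: real assume yz: "y \<in> S" "z \<in> S" and t: "t \<in> {0..dist y z}"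
  show "\<exists>m\<in>S. dist y m = t \<and> dist m z = dist y z - t"
  proof (cases "y = z")
    case True
    then show ?thesis using t yz by auto
  next
    case False
    define \<tau> where "\<tau> = t / dist y z"
    have \<tau>: "0 \<le> \<tau>" "\<tau> \<le> 1" "\<tau> * dist y z = t" using t False by (auto simp: \<tau>_def)
    define m where "m = (1 - \<tau>) *\<^sub>R y + \<tau> *\<^sub>R z"
    have "m \<in> S" unfolding m_def using assms yz \<tau> by (intro convexD_alt) auto
    moreover have e: "y - m = \<tau> *\<^sub>R (y - z)" "m - z = (1 - \<tau>) *\<^sub>R (y - z)"
      by (simp_all add: m_def algebra_simps)
    have "dist y m = \<tau> * dist y z" unfolding dist_norm e using \<tau>(1) by simp
    moreover have "dist m z = (1 - \<tau>) * dist y z" unfolding dist_norm e using \<tau>(2) by simp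
    ultimately show ?thesis using \<tau>(3) by (intro bexI[of _ m]) (auto simp: left_diff_distrib)
  qed
next
  fix x y m z :: 'b assume "aligned dist y m z"
  then show "stewart dist x y m z" using stewart_equality[of y m z x] by (simp add: stewart_def)
qed

lemma stewart_space_isometric_image:
  assumes Y: "stewart_space Y e" and M: "Metric_space (g ` Y) d"
    and iso: "\<And>u v. u \<in> Y \<Longrightarrow> v \<in> Y \<Longrightarrow> d (g u) (g v) = e u v"
  shows "stewart_space (g ` Y) d"
  unfolding stewart_space_def
proof (intro conjI ballI impI)
  fix y z t assume "y \<in> g ` Y" "z \<in> g ` Y" "t \<in> {0..d y z}"
  then obtain u v where uv: "u \<in> Y" "v \<in> Y" "y = g u" "z = g v" "0 \<le> t" "t \<le> e u v" using iso by auto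
  obtain m where "m \<in> Y" "e u m = t" "e m v = e u v - t"
    using stewart_between_point[OF Y uv(1,2,5,6)] .
  then show "\<exists>m\<in>g ` Y. d y m = t \<and> d m z = d y z - t" using uv iso by auto
next
  fix x y m z assume "x \<in> g ` Y" "y \<in> g ` Y" "m \<in> g ` Y" "z \<in> g ` Y" and al: "aligned d y m z"
  then obtain x' y' m' z' where *: "x' \<in> Y" "y' \<in> Y" "m' \<in> Y" "z' \<in> Y" "x = g x'" "y = g y'" "m = g m'" "z = g z'"
    by blast
  then have "aligned e y' m' z'" using al iso by (simp add: aligned_def)
  then show "stewart d x y m z"
    using stewart_inequality[OF Y *(1-4)] * iso by (simp add: stewart_def)
qed (rule M)

section \<open>The three spaces\<close>

text \<open>The spiral occupies the coordinates \<open>0\<close>, \<open>1\<close> and the half-plane the coordinates \<open>2\<close>, \<open>3\<close>.  The shift by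
\<open>3\<close> moves the beginning of the spine to the origin, so that the two copies meet exactly there.\<close>

definition join_coords :: "complex \<Rightarrow> complex \<Rightarrow> nat \<Rightarrow> real" where
  "join_coords z w n = (if n = 0 then Re z - 3 else if n = 1 then Im z
     else if n = 2 then Re w else if n = 3 then Im w else 0)"

definition spiral_part :: "(nat \<Rightarrow> real) \<Rightarrow> complex" where
  "spiral_part f = Complex (f 0 + 3) (f 1)"

definition plane_part :: "(nat \<Rightarrow> real) \<Rightarrow> complex" where
  "plane_part f = Complex (f 2) (f 3)"

definition spiral_copy :: "(nat \<Rightarrow> real) set" where
  "spiral_copy = (\<lambda>z. join_coords z 0) ` spiral"

definition half_plane_copy :: "(nat \<Rightarrow> real) set" where
  "half_plane_copy = (\<lambda>w. join_coords 3 w) ` {w. 0 \<le> Im w}"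

text \<open>One of the two summands vanishes if both points are in the same part; so the metric of the wedge is the
restriction of an \<open>\<ell>\<^sup>1\<close> product metric, and a single function serves as metric of all three spaces.\<close>

definition wedge_dist :: "(nat \<Rightarrow> real) \<Rightarrow> (nat \<Rightarrow> real) \<Rightarrow> real" where
  "wedge_dist f g = spiral_dist (spiral_part f) (spiral_part g) + dist (plane_part f) (plane_part g)"

abbreviation wedge :: "(nat \<Rightarrow> real) set" where
  "wedge \<equiv> spiral_copy \<union> half_plane_copy"

lemma join_coords_parts [simp]: "spiral_part (join_coords z w) = z" "plane_part (join_coords z w) = w"
  by (simp_all add: join_coords_def spiral_part_def plane_part_def complex_eq_iff)

lemma base_in_spiral [simp]: "3 \<in> spiral"
  by (simp add: spiral_iff)

lemma spiral_copyE:
  assumes "f \<in> spiral_copy"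
  obtains z where "f = join_coords z 0" "z \<in> spiral"
  using assms by (auto simp: spiral_copy_def)

lemma half_plane_copyE:
  assumes "f \<in> half_plane_copy"
  obtains w where "f = join_coords 3 w" "0 \<le> Im w"
  using assms by (auto simp: half_plane_copy_def)

lemma wedge_parts:
  assumes "f \<in> wedge"
  shows "spiral_part f \<in> spiral" "0 \<le> Im (plane_part f)" "f = join_coords (spiral_part f) (plane_part f)"
  using assms by (auto elim!: spiral_copyE half_plane_copyE)

lemma wedge_dist_simps [simp]: "wedge_dist (join_coords z w) (join_coords z' w') = spiral_dist z z' + dist w w'"
  by (simp add: wedge_dist_def)

lemma Metric_space_wedge: "Metric_space wedge wedge_dist"
proof
  fix f g
  show "0 \<le> wedge_dist f g" by (simp add: wedge_dist_def)
  show "wedge_dist f g = wedge_dist g f" by (simp add: wedge_dist_def spiral_dist_commute dist_commute)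
  assume fg: "f \<in> wedge" "g \<in> wedge"
  show "wedge_dist f g = 0 \<longleftrightarrow> f = g"
  proof
    assume "wedge_dist f g = 0"
    then have "spiral_dist (spiral_part f) (spiral_part g) = 0" "dist (plane_part f) (plane_part g) = 0"
      using spiral.nonneg[of "spiral_part f" "spiral_part g"] zero_le_dist[of "plane_part f" "plane_part g"]
      unfolding wedge_dist_def by linarith+
    then have "spiral_part f = spiral_part g" "plane_part f = plane_part g"
      using wedge_parts[OF fg(1)] wedge_parts[OF fg(2)] by auto
    then show "f = g" using wedge_parts(3)[OF fg(1)] wedge_parts(3)[OF fg(2)] by metis
  qed (use wedge_parts fg in \<open>simp add: wedge_dist_def\<close>)
  fix h assume h: "h \<in> wedge"
  show "wedge_dist f h \<le> wedge_dist f g + wedge_dist g h"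
    using spiral.triangle[OF wedge_parts(1)[OF fg(1)] wedge_parts(1)[OF fg(2)] wedge_parts(1)[OF h]]
      dist_triangle[of "plane_part f" "plane_part h" "plane_part g"] unfolding wedge_dist_def by linarith
qed

lemma Metric_space_wedge_subset: "A \<subseteq> wedge \<Longrightarrow> Metric_space A wedge_dist"
  using Metric_space.subspace[OF Metric_space_wedge] .

lemma stewart_space_spiral_copy: "stewart_space spiral_copy wedge_dist"
  unfolding spiral_copy_def
  by (rule stewart_space_isometric_image[OF stewart_space_spiral])
    (use Metric_space_wedge_subset[of spiral_copy] in \<open>auto simp: spiral_copy_def\<close>)

lemma stewart_space_half_plane_copy: "stewart_space half_plane_copy wedge_dist"
  unfolding half_plane_copy_def
proof (rule stewart_space_isometric_image)
  have "{w. 0 \<le> Im w} = {w. 0 \<le> \<i> \<bullet> w}" by (auto simp: inner_complex_def)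
  then show "stewart_space {w. 0 \<le> Im w} dist"
    using stewart_space_convex[OF convex_halfspace_ge[of 0 \<i>]] by simp
qed (use Metric_space_wedge_subset[of half_plane_copy] in \<open>auto simp: half_plane_copy_def\<close>)

lemma stewart_space_wedge_space: "stewart_space wedge wedge_dist"
proof (rule stewart_space_wedge[OF stewart_space_spiral_copy stewart_space_half_plane_copy Metric_space_wedge])
  show "join_coords 3 0 \<in> spiral_copy" "join_coords 3 0 \<in> half_plane_copy"
    by (auto simp: spiral_copy_def half_plane_copy_def)
qed (auto elim!: spiral_copyE half_plane_copyE)

section \<open>Bounded and unbounded parts of the curtain models\<close>

context
  fixes lam :: "nat \<Rightarrow> real"
  assumes lam: "\<forall>L\<ge>1. 0 < lam L" and summable: "lam summable_on {1..}"
begin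

text \<open>This covers the half-plane by itself and as a part of the wedge; likewise the next lemma for the
spiral.\<close>

lemma half_plane_curtain_dist_bounded:
  assumes X: "stewart_space X wedge_dist" "half_plane_copy \<subseteq> X" "X \<subseteq> wedge"
    and fg: "f \<in> half_plane_copy" "g \<in> half_plane_copy"
  shows "curtain_dist lam X wedge_dist f g \<le> (\<Sum>\<^sub>\<infinity>L\<in>{1..}. lam L) * 3"
proof (rule curtain_dist_le[OF X(1)])
  fix L
  show "dist_L X wedge_dist L f g \<le> 3"
  proof (rule half_plane_dist_L_bounded[OF X(1), where e = "join_coords 3"])
    show "join_coords 3 w \<in> X" if "0 \<le> Im w" for w
      using that X(2) by (auto simp: half_plane_copy_def)
    show "aligned wedge_dist (join_coords 3 w) (join_coords 3 0) z"
      if "z \<in> X" "z \<notin> join_coords 3 ` {w. 0 \<le> Im w}" for w z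
    proof -
      have "z \<in> spiral_copy" using that X(3) by (auto simp: half_plane_copy_def)
      then show ?thesis by (auto elim!: spiral_copyE simp: aligned_def)
    qed
  qed (use fg in \<open>auto simp: half_plane_copy_def\<close>)
qed (use lam summable fg X(2) in \<open>auto intro: less_imp_le\<close>)

lemma block_index_base: "block_index 3 = 0"
  using block_index_le[of 3 0] by (simp add: slab_def gate_def)

text \<open>The curtains are placed in the middle of the inner walls, at \<open>3/2 gate j - 3\<close> on the spine.  Points
of the half-plane count to block \<open>0\<close>, where they are attached.\<close>

lemma spine_curtain_dist_unbounded:
  assumes X: "stewart_space X wedge_dist" "spiral_copy \<subseteq> X" "X \<subseteq> wedge"
  shows "\<exists>t\<ge>0. B < curtain_dist lam X wedge_dist (join_coords 3 0) (join_coords (spine t) 0)"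
proof -
  let ?\<alpha> = "\<lambda>t. join_coords (spine t) 0" and ?r = "\<lambda>j. 3/2 * gate j - 3"
  have \<alpha>X: "?\<alpha> t \<in> X" if "0 \<le> t" for t
    using spine_in[OF that] X(2) by (auto simp: spiral_copy_def)
  have geo: "geodesic_on X wedge_dist {0..} ?\<alpha>"
    unfolding geodesic_on_def using \<alpha>X spine_dist by (auto simp: is_interval_ci)
  have long: "1 + real N \<le> dist_L X wedge_dist 3 (?\<alpha> 0) (?\<alpha> (?r (4 * N)))" for N
  proof (rule hinged_ray_long_chain[OF X(1) geo, where idx = "\<lambda>f. block_index (spiral_part f)" and p = "\<lambda>n. join_coords (hinge n) 0"])
    show "join_coords (hinge n) 0 \<in> X" for n
      using hinge_block(5)[of n] X(2) by (auto simp: spiral_copy_def)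
    show "aligned wedge_dist u (join_coords (hinge n) 0) v"
      if "u \<in> X" "v \<in> X" "block_index (spiral_part u) \<le> n" "n + 2 \<le> block_index (spiral_part v)" for u v n
    proof -
      have uv: "u \<in> wedge" "v \<in> wedge" using that X(3) by auto
      have "v \<in> spiral_copy" using uv(2) that(4) block_index_base by (auto elim!: half_plane_copyE)
      then have "plane_part v = 0" by (auto elim!: spiral_copyE)
      then show ?thesis
        using aligned_hinge[OF wedge_parts(1)[OF uv(1)] wedge_parts(1)[OF uv(2)] that(3,4)]
        unfolding aligned_def wedge_dist_def by simp
    qed
    show "?r i + 1 < ?r j" if "i < j" for i j
    proof -
      have "gate (Suc i) \<le> gate j" using that by (intro gate_mono) simp
      moreover have "3 \<le> gate i" by (rule gate_ge)
      ultimately show ?thesis unfolding gate_Suc by linarith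
    qed
    show "block_index (spiral_part u) = j"
      if u: "u \<in> X" and foot: "is_foot wedge_dist {0..} ?\<alpha> u t" and t: "t \<in> {?r j - 1/2..?r j + 1/2}" for u t j
    proof (rule ccontr)
      assume ne: "block_index (spiral_part u) \<noteq> j"
      have "spiral_part u \<in> spiral" using u X(3) wedge_parts by blast
      moreover have "gate j < 3 + t" "3 + t < 2 * gate j" using t gate_ge[of j] unfolding atLeastAtMost_iff by linarith+
      ultimately obtain s where s: "0 \<le> s" "spiral_dist (spiral_part u) (spine s) < spiral_dist (spiral_part u) (spine t)"
        using spine_foot_idx ne by blast
      then have "wedge_dist u (?\<alpha> s) < wedge_dist u (?\<alpha> t)" by (simp add: wedge_dist_def)
      then show False using foot s by (force simp: is_foot_def[OF X(1) geo])
    qed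
  qed (simp add: gate_def)
  have l3: "lam 3 > 0" using lam by simp
  obtain N where N: "B < real N * lam 3" using reals_Archimedean3[OF l3] by blast
  have r0: "0 \<le> ?r (4 * N)" using gate_ge[of "4 * N"] by linarith
  have "spine 0 = 3" by (simp add: spine_def)
  have "B < lam 3 * (1 + real N)" using N l3 by (simp add: algebra_simps)
  also have "\<dots> \<le> lam 3 * dist_L X wedge_dist 3 (?\<alpha> 0) (?\<alpha> (?r (4 * N)))"
    using long[of N] l3 by simp
  also have "\<dots> \<le> curtain_dist lam X wedge_dist (?\<alpha> 0) (?\<alpha> (?r (4 * N)))"
    using lam summable \<alpha>X r0 by (intro curtain_dist_ge[OF X(1)]) (auto intro: less_imp_le)
  finally have "B < curtain_dist lam X wedge_dist (join_coords 3 0) (?\<alpha> (?r (4 * N)))"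
    unfolding \<open>spine 0 = 3\<close> .
  then show ?thesis using r0 by blast
qed

end

section \<open>The quasi-isometries\<close>

text \<open>With \<open>v = 3 Im z\<close> and \<open>u = Re z - v\<close> the sector becomes the quadrant \<open>u, v \<ge> 0\<close>, which
\<open>(u - v, min u v)\<close> opens to a half-plane.  The shift by \<open>3\<close> moves the beginning of the spine to \<open>0\<close>.\<close>

definition unroll :: "complex \<Rightarrow> complex" where
  "unroll z = Complex (Re z - 3 - 6 * Im z) (min (Re z - 3 * Im z) (3 * Im z))"

text \<open>The inverse of \<^const>\<open>unroll\<close>, except that the part of the sector with \<open>Re z < 3\<close>, which the spiral
lacks, is pushed to \<open>Re z = 3\<close>.\<close>

definition roll_up :: "complex \<Rightarrow> complex" where
  "roll_up w = Complex (max 3 (2 * Im w + \<bar>Re w + 3\<bar>)) ((Im w + max 0 (- Re w - 3)) / 3)"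

lemma roll_up_in_spiral: "0 \<le> Im w \<Longrightarrow> roll_up w \<in> spiral"
  by (auto simp: spiral_iff roll_up_def max_def)

lemma unroll_upper: "z \<in> spiral \<Longrightarrow> 0 \<le> Im (unroll z)"
  by (auto simp: spiral_iff unroll_def min_def)

lemma roll_up_unroll: "z \<in> spiral \<Longrightarrow> roll_up (unroll z) = z"
  by (auto simp: spiral_iff roll_up_def unroll_def complex_eq_iff min_def max_def abs_if)

lemma unroll_roll_up:
  assumes "0 \<le> Im w"
  shows "dist w (unroll (roll_up w)) \<le> 12"
proof -
  define s y where "s = Re (roll_up w)" and "y = 3 * Im (roll_up w)"
  have s: "s = max 3 (2 * Im w + \<bar>Re w + 3\<bar>)" and y: "y = Im w + max 0 (- Re w - 3)"
    by (simp_all add: s_def y_def roll_up_def)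
  have "Re (unroll (roll_up w)) = s - 3 - 2 * y" "Im (unroll (roll_up w)) = min (s - y) y"
    by (simp_all add: s_def y_def unroll_def)
  then have "\<bar>Re w - Re (unroll (roll_up w))\<bar> \<le> 3" "\<bar>Im w - Im (unroll (roll_up w))\<bar> \<le> 3"
    using assms s y by (auto simp: min_def max_def abs_if split: if_splits)
  then show ?thesis using cmod_le[of "w - unroll (roll_up w)"] by (simp add: dist_norm)
qed

lemma unroll_lipschitz: "dist (unroll z) (unroll z') \<le> 20 * dist z z'"
proof (rule complex_lipschitzI)
  show "\<bar>Re (unroll z) - Re (unroll z')\<bar> \<le> 1 * \<bar>Re z - Re z'\<bar> + 6 * \<bar>Im z - Im z'\<bar>"
    unfolding unroll_def complex.sel by (auto simp: abs_if)
  show "\<bar>Im (unroll z) - Im (unroll z')\<bar> \<le> 1 * \<bar>Re z - Re z'\<bar> + 3 * \<bar>Im z - Im z'\<bar>"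
    unfolding unroll_def complex.sel by (auto simp: min_def abs_if)
qed simp_all

lemma roll_up_lipschitz: "dist (roll_up w) (roll_up w') \<le> 10 * dist w w'"
proof (rule complex_lipschitzI)
  show "\<bar>Re (roll_up w) - Re (roll_up w')\<bar> \<le> 1 * \<bar>Re w - Re w'\<bar> + 2 * \<bar>Im w - Im w'\<bar>"
    unfolding roll_up_def complex.sel by (auto simp: max_def abs_if)
  have "3 * Im (roll_up v) = Im v + max 0 (- Re v - 3)" for v by (simp add: roll_up_def)
  from this[of w] this[of w']
  show "\<bar>Im (roll_up w) - Im (roll_up w')\<bar> \<le> 1 * \<bar>Re w - Re w'\<bar> + 1 * \<bar>Im w - Im w'\<bar>"
    by (auto simp: max_def abs_if split: if_splits)
qed simp_all

lemma unroll_quasi_isometric: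
  assumes "z \<in> spiral" "z' \<in> spiral"
  shows "spiral_dist z z' \<le> 200 * dist (unroll z) (unroll z')" "dist (unroll z) (unroll z') \<le> 200 * spiral_dist z z'"
proof -
  have "dist z z' \<le> 10 * dist (unroll z) (unroll z')"
    using roll_up_lipschitz[of "unroll z" "unroll z'"] assms by (simp add: roll_up_unroll)
  then show "spiral_dist z z' \<le> 200 * dist (unroll z) (unroll z')"
    using spiral_dist_le_euclidean[OF assms] zero_le_dist[of "unroll z" "unroll z'"] by linarith
  show "dist (unroll z) (unroll z') \<le> 200 * spiral_dist z z'"
    using unroll_lipschitz[of z z'] euclidean_le_spiral_dist[OF assms] by linarith
qed

lemma roll_up_quasi_isometric:
  assumes "0 \<le> Im w" "0 \<le> Im w'"
  shows "dist w w' \<le> 200 * spiral_dist (roll_up w) (roll_up w') + 24"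
    "spiral_dist (roll_up w) (roll_up w') \<le> 200 * dist w w'"
proof -
  note S = roll_up_in_spiral[OF assms(1)] roll_up_in_spiral[OF assms(2)]
  have "dist w w' \<le> dist w (unroll (roll_up w)) + dist (unroll (roll_up w)) (unroll (roll_up w')) + dist w' (unroll (roll_up w'))"
    using dist_triangle[of w w' "unroll (roll_up w)"] dist_triangle[of "unroll (roll_up w)" w' "unroll (roll_up w')"]
    by (simp add: dist_commute)
  then show "dist w w' \<le> 200 * spiral_dist (roll_up w) (roll_up w') + 24"
    using unroll_roll_up[OF assms(1)] unroll_roll_up[OF assms(2)] unroll_quasi_isometric(2)[OF S] by linarith
  show "spiral_dist (roll_up w) (roll_up w') \<le> 200 * dist w w'"
    using spiral_dist_le_euclidean[OF S] roll_up_lipschitz[of w w'] zero_le_dist[of w w'] by linarith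
qed

text \<open>The spiral is mapped to the half-plane and the half-plane to the spiral.  The formula is the same
on both parts because \<open>roll_up 0 = 3\<close> and \<open>unroll 3 = 0\<close>.\<close>

definition swap_parts :: "(nat \<Rightarrow> real) \<Rightarrow> nat \<Rightarrow> real" where
  "swap_parts f = join_coords (roll_up (plane_part f)) (unroll (spiral_part f))"

lemma roll_up_0 [simp]: "roll_up 0 = 3" and unroll_3 [simp]: "unroll 3 = 0"
  by (simp_all add: roll_up_def unroll_def complex_eq_iff)

lemma swap_parts_spiral [simp]: "swap_parts (join_coords z 0) = join_coords 3 (unroll z)"
  and swap_parts_half_plane [simp]: "swap_parts (join_coords 3 w) = join_coords (roll_up w) 0"
  by (simp_all add: swap_parts_def)

lemma swap_parts_image: "swap_parts ` spiral_copy \<subseteq> half_plane_copy" "swap_parts ` half_plane_copy \<subseteq> spiral_copy"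
  using unroll_upper roll_up_in_spiral
  by (auto simp: spiral_copy_def half_plane_copy_def)

lemma swap_parts_coarse_isometry:
  assumes "f \<in> wedge" "g \<in> wedge"
  shows "wedge_dist f g / 200 - 24 \<le> wedge_dist (swap_parts f) (swap_parts g)"
    "wedge_dist (swap_parts f) (swap_parts g) \<le> 200 * wedge_dist f g + 24"
proof -
  note u = unroll_quasi_isometric[OF wedge_parts(1)[OF assms(1)] wedge_parts(1)[OF assms(2)]]
  note r = roll_up_quasi_isometric[OF wedge_parts(2)[OF assms(1)] wedge_parts(2)[OF assms(2)]]
  note defs = swap_parts_def wedge_dist_simps wedge_dist_def[of f g]
  show "wedge_dist f g / 200 - 24 \<le> wedge_dist (swap_parts f) (swap_parts g)"
    unfolding defs using add_mono[OF u(1) r(1)] by (simp add: field_simps)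
  show "wedge_dist (swap_parts f) (swap_parts g) \<le> 200 * wedge_dist f g + 24"
    unfolding defs using add_mono[OF u(2) r(2)] by simp
qed

lemma swap_parts_dense_half_plane:
  assumes "g \<in> half_plane_copy"
  shows "\<exists>f\<in>spiral_copy. wedge_dist g (swap_parts f) \<le> 24"
proof -
  obtain w where w: "g = join_coords 3 w" "0 \<le> Im w" using assms by (elim half_plane_copyE)
  then have "wedge_dist g (swap_parts (join_coords (roll_up w) 0)) \<le> 24"
    using unroll_roll_up[OF w(2)] by simp
  moreover have "join_coords (roll_up w) 0 \<in> spiral_copy"
    using roll_up_in_spiral[OF w(2)] by (auto simp: spiral_copy_def)
  ultimately show ?thesis by blast
qed

lemma swap_parts_dense_spiral:
  assumes "g \<in> spiral_copy"
  shows "\<exists>f\<in>half_plane_copy. wedge_dist g (swap_parts f) \<le> 24"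
proof -
  obtain z where z: "g = join_coords z 0" "z \<in> spiral" using assms by (elim spiral_copyE)
  then have "wedge_dist g (swap_parts (join_coords 3 (unroll z))) \<le> 24"
    by (simp add: roll_up_unroll)
  moreover have "join_coords 3 (unroll z) \<in> half_plane_copy"
    using unroll_upper[OF z(2)] by (auto simp: half_plane_copy_def)
  ultimately show ?thesis by blast
qed

lemma quasi_isometryI:
  assumes "\<phi> ` X \<subseteq> Y" "1 \<le> K" "0 \<le> C"
    and "\<And>x y. x \<in> X \<Longrightarrow> y \<in> X \<Longrightarrow> d x y / K - C \<le> e (\<phi> x) (\<phi> y)"
    and "\<And>x y. x \<in> X \<Longrightarrow> y \<in> X \<Longrightarrow> e (\<phi> x) (\<phi> y) \<le> K * d x y + C"
    and "\<And>z. z \<in> Y \<Longrightarrow> \<exists>x\<in>X. e z (\<phi> x) \<le> C"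
  shows "quasi_isometry X d Y e \<phi>"
  using assms unfolding quasi_isometry_def by blast

lemma quasi_isometry_swap_parts_wedge: "quasi_isometry wedge wedge_dist wedge wedge_dist swap_parts"
proof (rule quasi_isometryI[where K = 200 and C = 24])
  show "swap_parts ` wedge \<subseteq> wedge" using swap_parts_image by blast
  fix g assume "g \<in> wedge"
  then show "\<exists>f\<in>wedge. wedge_dist g (swap_parts f) \<le> 24"
    using swap_parts_dense_spiral swap_parts_dense_half_plane by blast
qed (use swap_parts_coarse_isometry in auto)

lemma quasi_isometry_swap_parts: "quasi_isometry spiral_copy wedge_dist half_plane_copy wedge_dist swap_parts"
proof (rule quasi_isometryI[where K = 200 and C = 24])
  show "swap_parts ` spiral_copy \<subseteq> half_plane_copy" by (rule swap_parts_image)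
  show "\<exists>f\<in>spiral_copy. wedge_dist g (swap_parts f) \<le> 24" if "g \<in> half_plane_copy" for g
    using that by (rule swap_parts_dense_half_plane)
qed (use swap_parts_coarse_isometry in auto)

section \<open>Curtain models and quasi-isometries\<close>

text \<open>In the first part the points of the half-plane that are rolled up to the spine are at bounded distance from
the base point in the curtain model, but their images are not.  In the second part the lower
estimate of a quasi-isometry would bound the curtain model of the spiral.\<close>

theorem theorem1p1:
  fixes lam :: "nat \<Rightarrow> real"
  assumes "\<And>L. 1 \<le> L \<Longrightarrow> 0 < lam L \<and> lam L < 1"
    and "(\<lambda>L. (real L)\<^sup>2 * lam L) summable_on {1..}"
    and "(\<Sum>\<^sub>\<infinity>L\<in>{1..}. lam L) < (\<Sum>\<^sub>\<infinity>L\<in>{1..}. real L * lam L)"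
    and "(\<Sum>\<^sub>\<infinity>L\<in>{1..}. real L * lam L) < (\<Sum>\<^sub>\<infinity>L\<in>{1..}. (real L)\<^sup>2 * lam L)"
  shows "(\<exists>(X :: (nat \<Rightarrow> real) set) d \<phi>.
            CAT0 X d \<and> quasi_isometry X d X d \<phi> \<and>
            \<not> quasi_isometry X (curtain_dist lam X d) X (curtain_dist lam X d) \<phi>) \<and>
         (\<exists>(W :: (nat \<Rightarrow> real) set) dW (Z :: (nat \<Rightarrow> real) set) dZ.
            CAT0 W dW \<and> CAT0 Z dZ \<and> quasi_isometric W dW Z dZ \<and>
            \<not> quasi_isometric W (curtain_dist lam W dW) Z (curtain_dist lam Z dZ))"
proof
  have pos: "\<forall>L\<ge>1. 0 < lam L" using assms(1) by blast
  have sum: "lam summable_on {1..}"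
  proof (rule summable_on_comparison_test[OF assms(2)])
    fix L :: nat assume L: "L \<in> {1..}"
    then have "1 \<le> (real L)\<^sup>2" by simp
    then have "1 * lam L \<le> (real L)\<^sup>2 * lam L" using pos L by (intro mult_right_mono) (auto intro: less_imp_le)
    then show "lam L \<le> (real L)\<^sup>2 * lam L" by simp
    show "0 \<le> lam L" using pos L by (auto intro: less_imp_le)
  qed
  let ?B = "(\<Sum>\<^sub>\<infinity>L\<in>{1..}. lam L) * 3"
  let ?base = "join_coords 3 0"
  note bounded = half_plane_curtain_dist_bounded[where lam = lam, OF pos sum]
  note unbounded = spine_curtain_dist_unbounded[where lam = lam, OF pos sum]
  have "\<not> quasi_isometry wedge (curtain_dist lam wedge wedge_dist) wedge (curtain_dist lam wedge wedge_dist) swap_parts"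
  proof
    let ?D = "curtain_dist lam wedge wedge_dist"
    assume "quasi_isometry wedge ?D wedge ?D swap_parts"
    then obtain K C where K: "1 \<le> K" and up: "\<And>f g. f \<in> wedge \<Longrightarrow> g \<in> wedge \<Longrightarrow> ?D (swap_parts f) (swap_parts g) \<le> K * ?D f g + C"
      unfolding quasi_isometry_def by blast
    obtain t where t: "0 \<le> t" "K * ?B + C < ?D ?base (join_coords (spine t) 0)"
      using unbounded[OF stewart_space_wedge_space, of "K * ?B + C"] by auto
    define w where "w = unroll (spine t)"
    have w: "0 \<le> Im w" "roll_up w = spine t"
      using unroll_upper roll_up_unroll spine_in[OF t(1)] by (auto simp: w_def)
    have H: "?base \<in> half_plane_copy" "join_coords 3 w \<in> half_plane_copy"
      using w by (auto simp: half_plane_copy_def)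
    have "?D ?base (join_coords (spine t) 0) \<le> K * ?D ?base (join_coords 3 w) + C"
      using up[of ?base "join_coords 3 w"] H w by simp
    also have "\<dots> \<le> K * ?B + C"
      using bounded[OF stewart_space_wedge_space _ _ H] K by (intro add_right_mono mult_left_mono) auto
    finally show False using t by simp
  qed
  then show "\<exists>(X :: (nat \<Rightarrow> real) set) d \<phi>.
            CAT0 X d \<and> quasi_isometry X d X d \<phi> \<and>
            \<not> quasi_isometry X (curtain_dist lam X d) X (curtain_dist lam X d) \<phi>"
    using stewart_space_CAT0[OF stewart_space_wedge_space] quasi_isometry_swap_parts_wedge by blast
  have "\<not> quasi_isometric spiral_copy (curtain_dist lam spiral_copy wedge_dist)
      half_plane_copy (curtain_dist lam half_plane_copy wedge_dist)"
  proof
    let ?D = "curtain_dist lam spiral_copy wedge_dist" and ?E = "curtain_dist lam half_plane_copy wedge_dist"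
    assume "quasi_isometric spiral_copy ?D half_plane_copy ?E"
    then obtain \<phi> K C where \<phi>: "\<phi> ` spiral_copy \<subseteq> half_plane_copy" and K: "1 \<le> K"
      and lo: "\<And>f g. f \<in> spiral_copy \<Longrightarrow> g \<in> spiral_copy \<Longrightarrow> ?D f g / K - C \<le> ?E (\<phi> f) (\<phi> g)"
      unfolding quasi_isometric_def quasi_isometry_def by blast
    obtain t where t: "0 \<le> t" "K * (?B + C) < ?D ?base (join_coords (spine t) 0)"
      using unbounded[OF stewart_space_spiral_copy, of "K * (?B + C)"] by auto
    have S: "?base \<in> spiral_copy" "join_coords (spine t) 0 \<in> spiral_copy"
      using spine_in[OF t(1)] by (auto simp: spiral_copy_def)
    have "?D ?base (join_coords (spine t) 0) / K - C \<le> ?B"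
      using lo[OF S] bounded[OF stewart_space_half_plane_copy _ _, of "\<phi> ?base" "\<phi> (join_coords (spine t) 0)"] \<phi> S
      by fastforce
    then have "?D ?base (join_coords (spine t) 0) \<le> K * (?B + C)" using K by (simp add: field_simps)
    then show False using t by simp
  qed
  then show "\<exists>(W :: (nat \<Rightarrow> real) set) dW (Z :: (nat \<Rightarrow> real) set) dZ.
            CAT0 W dW \<and> CAT0 Z dZ \<and> quasi_isometric W dW Z dZ \<and>
            \<not> quasi_isometric W (curtain_dist lam W dW) Z (curtain_dist lam Z dZ)"
    using stewart_space_CAT0[OF stewart_space_spiral_copy] stewart_space_CAT0[OF stewart_space_half_plane_copy]
      quasi_isometry_swap_parts unfolding quasi_isometric_def by blast
qed

end
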